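(* Let $\mathcal{M}$ be a countably infinite $\aleph_0$-categorical structure. The following are equivalent. (1) $\mathcal{M}$ is MS-measurable. (2) There is a function $h=(\dim,\mathrm{meas}):\mathsf{Def}(\mathcal{M})\to(\mathbb{N}\times\mathbb{R}^{>0})\cup\{(0,0)\}$ satisfying: (cMS1) for all finite $C\subseteq M$, $\bar a\in M^n$ and $g\in\mathrm{Aut}(\mathcal{M})$, $h(g\bar a/gC)=h(\bar a/C)$; (cMS2) for every finite $C\subseteq M$ and every $C$-definable $X\subseteq M^n$, if $X=\mathrm{tp}(\bar a_0/C)\uplus\cdots\uplus\mathrm{tp}(\bar a_{k-1}/C)$, then $\dim(X)=\max_{i<k}\dim(\bar a_i/C)$ and $\mathrm{meas}(X)=\sum\{\mathrm{meas}(\bar a_i/C):\dim(\bar a_i/C)=\dim(X)\}$; (cMS3) for every finite $C\subseteq M$ and $\bar a\in\mathrm{acl}(C)^n$, $\dim(\bar a/C)=0$ and $\mathrm{meas}(\bar a/C)=|\{g\bar a:g\in\mathrm{Aut}(\mathcal{M}/C)\}|$; (cMS4) for every finite $C\subseteq M$, $\bar a\in M^n$ and $\bar b\in M^m$ with $\bar b\subseteq\mathrm{dcl}(C\bar a)$, letting $X=\mathrm{tp}(\bar a/C)$, we have $\dim(X)=\dim(\bar b/C)+\dim(\bar a/C\bar b)$ and $\mathrm{meas}(X)=\mathrm{meas}(\bar b/C)\cdot\mathrm{meas}(\bar a/C\bar b)$.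
   Context: $\mathsf{Def}(\mathcal{N})$ is the set of all subsets of powers $N^n$ ($n\ge1$) definable with parameters. An infinite $\mathcal{L}$-structure $\mathcal{N}$ is MS-measurable if there is $h=(\dim,\mathrm{meas}):\mathsf{Def}(\mathcal{N})\to(\mathbb{N}\times\mathbb{R}^{>0})\cup\{(0,0)\}$ such that: (MS1) for each $\mathcal{L}$-formula $\phi(\bar x,\bar y)$ there is a finite set $D$ with $h(\phi(\mathcal{N},\bar a))\in D$ for all $\bar a$; (MS2) if $\phi(\mathcal{N},\bar a)$ is finite then $h(\phi(\mathcal{N},\bar a))=(0,|\phi(\mathcal{N},\bar a)|)$; (MS3) for each $\phi(\bar x,\bar y)$ and each $(d,\mu)\in D$, $\{\bar a:h(\phi(\mathcal{N},\bar a))=(d,\mu)\}$ is $\emptyset$-definable; (MS4) for every definable surjection $f:X\to Y$ with $X,Y\in\mathsf{Def}(\mathcal{N})$, letting $D=\{h(f^{-1}[\bar b]):\bar b\in Y\}$ and $Y(d,\mu)=\{\bar b\in Y:h(f^{-1}[\bar b])=(d,\mu)\}$, we have $\dim(X)=\max\{d+\dim(Y(d,\mu)):(d,\mu)\in D\}$ and $\mathrm{meas}(X)=\sum\{\mu\cdot\mathrm{meas}(Y(d,\mu)):(d,\mu)\in D,\ d+\dim(Y(d,\mu))=\dim(X)\}$. Notation in an $\aleph_0$-categorical structure (where every type over a finite set is isolated): $\mathrm{tp}(\bar a/C)$ also denotes the set defined by a formula isolating it; $h(\bar a/C)$, $\dim(\bar a/C)$, $\mathrm{meas}(\bar a/C)$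 denote the values of $h$, $\dim$, $\mathrm{meas}$ on that set; $X=\mathrm{tp}(\bar a_0/C)\uplus\cdots\uplus\mathrm{tp}(\bar a_{k-1}/C)$ means $X$ is the disjoint union of the solution sets of these (distinct) complete types over $C$. *)

theory Defs
  imports Complex_Main "HOL-Library.Countable_Set" "HOL-Library.Disjoint_Sets"
begin

section \<open>First-order languages and structures\<close>

text \<open>
  A symbol is a name together with an arity.  The symbols form explicit sets, as HOL types are
  nonempty and a language may have no function symbols or no relation symbols.
\<close>

record ('f, 'r) language =
  funs :: "('f \<times> nat) set"
  rels :: "('r \<times> nat) set"

text \<open>
  The universe of a structure is the whole type \<open>'a\<close>.  Interpretations are only relevant on lists
  whose length is the arity of a symbol of the language.
\<close>

record ('f, 'r, 'a) struct =
  fun_int :: "'f \<Rightarrow> 'a list \<Rightarrow> 'a"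
  rel_int :: "'r \<Rightarrow> 'a list \<Rightarrow> bool"

datatype 'f fo_term = Var nat | Fun 'f "'f fo_term list"

datatype ('f, 'r) fo_formula =
    Eq "'f fo_term" "'f fo_term"
  | Rel 'r "'f fo_term list"
  | Neg "('f, 'r) fo_formula"
  | Conj "('f, 'r) fo_formula" "('f, 'r) fo_formula"
  | Exists nat "('f, 'r) fo_formula"

primrec term_vars :: "'f fo_term \<Rightarrow> nat set" where
  "term_vars (Var i) = {i}"
| "term_vars (Fun f ts) = \<Union> (set (map term_vars ts))"

primrec wf_term :: "('f, 'r) language \<Rightarrow> 'f fo_term \<Rightarrow> bool" where
  "wf_term L (Var i) \<longleftrightarrow> True"
| "wf_term L (Fun f ts) \<longleftrightarrow> (f, length ts) \<in> funs L \<and> list_all id (map (wf_term L) ts)"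

primrec free_vars :: "('f, 'r) fo_formula \<Rightarrow> nat set" where
  "free_vars (Eq s t) = term_vars s \<union> term_vars t"
| "free_vars (Rel r ts) = \<Union> (term_vars ` set ts)"
| "free_vars (Neg \<phi>) = free_vars \<phi>"
| "free_vars (Conj \<phi> \<psi>) = free_vars \<phi> \<union> free_vars \<psi>"
| "free_vars (Exists i \<phi>) = free_vars \<phi> - {i}"

primrec wf_formula :: "('f, 'r) language \<Rightarrow> ('f, 'r) fo_formula \<Rightarrow> bool" where
  "wf_formula L (Eq s t) \<longleftrightarrow> wf_term L s \<and> wf_term L t"
| "wf_formula L (Rel r ts) \<longleftrightarrow> (r, length ts) \<in> rels L \<and> (\<forall>t\<in>set ts. wf_term L t)"
| "wf_formula L (Neg \<phi>) \<longleftrightarrow> wf_formula L \<phi>"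
| "wf_formula L (Conj \<phi> \<psi>) \<longleftrightarrow> wf_formula L \<phi> \<and> wf_formula L \<psi>"
| "wf_formula L (Exists i \<phi>) \<longleftrightarrow> wf_formula L \<phi>"

primrec eval_term :: "('f, 'r, 'a) struct \<Rightarrow> (nat \<Rightarrow> 'a) \<Rightarrow> 'f fo_term \<Rightarrow> 'a" where
  "eval_term M e (Var i) = e i"
| "eval_term M e (Fun f ts) = fun_int M f (map (eval_term M e) ts)"

primrec sat :: "('f, 'r, 'a) struct \<Rightarrow> (nat \<Rightarrow> 'a) \<Rightarrow> ('f, 'r) fo_formula \<Rightarrow> bool" where
  "sat M e (Eq s t) \<longleftrightarrow> eval_term M e s = eval_term M e t"
| "sat M e (Rel r ts) \<longleftrightarrow> rel_int M r (map (eval_term M e) ts)"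
| "sat M e (Neg \<phi>) \<longleftrightarrow> \<not> sat M e \<phi>"
| "sat M e (Conj \<phi> \<psi>) \<longleftrightarrow> sat M e \<phi> \<and> sat M e \<psi>"
| "sat M e (Exists i \<phi>) \<longleftrightarrow> (\<exists>a. sat M (e(i := a)) \<phi>)"

definition formula_in :: "('f, 'r) language \<Rightarrow> nat \<Rightarrow> ('f, 'r) fo_formula \<Rightarrow> bool" where
  "formula_in L k \<phi> \<longleftrightarrow> wf_formula L \<phi> \<and> free_vars \<phi> \<subseteq> {..<k}"

definition elementarily_equiv ::
    "('f, 'r) language \<Rightarrow> ('f, 'r, 'a) struct \<Rightarrow> ('f, 'r, 'b) struct \<Rightarrow> bool" where
  "elementarily_equiv L M N \<longleftrightarrow>
     (\<forall>\<sigma>. formula_in L 0 \<sigma> \<longrightarrow> ((\<forall>e. sat M e \<sigma>) \<longleftrightarrow> (\<forall>e. sat N e \<sigma>)))"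

definition isomorphism ::
    "('f, 'r) language \<Rightarrow> ('f, 'r, 'a) struct \<Rightarrow> ('f, 'r, 'b) struct \<Rightarrow> ('a \<Rightarrow> 'b) \<Rightarrow> bool" where
  "isomorphism L M N g \<longleftrightarrow> bij g \<and>
     (\<forall>(f, n)\<in>funs L. \<forall>xs. length xs = n \<longrightarrow> g (fun_int M f xs) = fun_int N f (map g xs)) \<and>
     (\<forall>(r, n)\<in>rels L. \<forall>xs. length xs = n \<longrightarrow> (rel_int M r xs \<longleftrightarrow> rel_int N r (map g xs)))"

definition Aut :: "('f, 'r) language \<Rightarrow> ('f, 'r, 'a) struct \<Rightarrow> ('a \<Rightarrow> 'a) set" where
  "Aut L M = {g. isomorphism L M M g}"

definition Aut_over ::
    "('f, 'r) language \<Rightarrow> ('f, 'r, 'a) struct \<Rightarrow> 'a set \<Rightarrow> ('a \<Rightarrow> 'a) set" where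
  "Aut_over L M C = {g \<in> Aut L M. \<forall>c\<in>C. g c = c}"

text \<open>
  The theory of \<open>M\<close> has exactly one countably infinite model up to isomorphism; every such model
  has an isomorphic copy with universe \<open>nat\<close>.  As usual for this notion, the language is countable.
  Without this, the natural numbers with all functions and relations as symbols would qualify,
  although infinitely many types over the empty set are realised there.
\<close>

definition aleph0_categorical :: "('f, 'r) language \<Rightarrow> ('f, 'r, 'a) struct \<Rightarrow> bool" where
  "aleph0_categorical L M \<longleftrightarrow> countable (funs L) \<and> countable (rels L) \<and>
     (\<forall>N :: ('f, 'r, nat) struct. elementarily_equiv L M N \<longrightarrow> (\<exists>g. isomorphism L M N g))"


section \<open>Definable sets and types\<close>

text \<open>Elements of the \<open>n\<close>-th power of the universe are lists of length \<open>n\<close>.\<close>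

definition tuples :: "nat \<Rightarrow> 'a list set" where
  "tuples n = {xs. length xs = n}"

text \<open>
  The set \<open>\<phi>(M, as)\<close>, where in \<open>\<phi>(x, y)\<close> the tuple \<open>x\<close> consists of the variables
  \<open>0, \<dots>, n - 1\<close> and \<open>y\<close> of the following \<open>length as\<close> ones.
\<close>

definition solution_set ::
    "('f, 'r, 'a) struct \<Rightarrow> nat \<Rightarrow> ('f, 'r) fo_formula \<Rightarrow> 'a list \<Rightarrow> 'a list set" where
  "solution_set M n \<phi> as = {xs \<in> tuples n. sat M (\<lambda>i. (xs @ as) ! i) \<phi>}"

definition definable_over ::
    "('f, 'r) language \<Rightarrow> ('f, 'r, 'a) struct \<Rightarrow> 'a set \<Rightarrow> nat \<Rightarrow> 'a list set \<Rightarrow> bool" where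
  "definable_over L M C n X \<longleftrightarrow>
     (\<exists>\<phi> cs. set cs \<subseteq> C \<and> formula_in L (n + length cs) \<phi> \<and> X = solution_set M n \<phi> cs)"

definition Def :: "('f, 'r) language \<Rightarrow> ('f, 'r, 'a) struct \<Rightarrow> 'a list set set" where
  "Def L M = {X. \<exists>n\<ge>1. definable_over L M UNIV n X}"

definition acl :: "('f, 'r) language \<Rightarrow> ('f, 'r, 'a) struct \<Rightarrow> 'a set \<Rightarrow> 'a set" where
  "acl L M C = {a. \<exists>X. definable_over L M C 1 X \<and> finite X \<and> [a] \<in> X}"

definition dcl :: "('f, 'r) language \<Rightarrow> ('f, 'r, 'a) struct \<Rightarrow> 'a set \<Rightarrow> 'a set" where
  "dcl L M C = {a. definable_over L M C 1 {[a]}}"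

text \<open>A formula over \<open>C\<close> is represented by a formula together with a list of parameters from \<open>C\<close>.\<close>

definition complete_type ::
    "('f, 'r) language \<Rightarrow> ('f, 'r, 'a) struct \<Rightarrow> 'a list \<Rightarrow> 'a set
      \<Rightarrow> (('f, 'r) fo_formula \<times> 'a list) set" where
  "complete_type L M as C =
     {(\<phi>, cs). set cs \<subseteq> C \<and> formula_in L (length as + length cs) \<phi> \<and>
        as \<in> solution_set M (length as) \<phi> cs}"

text \<open>
  The solution set in \<open>M\<close> of the type of \<open>as\<close> over \<open>C\<close>.  If a formula isolates this type, then it
  defines this set.
\<close>

definition tp ::
    "('f, 'r) language \<Rightarrow> ('f, 'r, 'a) struct \<Rightarrow> 'a list \<Rightarrow> 'a set \<Rightarrow> 'a list set" where
  "tp L M as C =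
     {bs \<in> tuples (length as). \<forall>(\<phi>, cs)\<in>complete_type L M as C. bs \<in> solution_set M (length as) \<phi> cs}"


section \<open>Measurability\<close>

text \<open>
  A function on \<open>Def L M\<close> is rendered as a total function on \<open>'a list set\<close>; its values outside
  \<open>Def L M\<close> play no role.
\<close>

definition dim_meas_fun ::
    "('f, 'r) language \<Rightarrow> ('f, 'r, 'a) struct \<Rightarrow> ('a list set \<Rightarrow> nat \<times> real) \<Rightarrow> bool" where
  "dim_meas_fun L M h \<longleftrightarrow> (\<forall>X\<in>Def L M. h X \<in> UNIV \<times> {0<..} \<union> {(0, 0)})"

abbreviation dim :: "('a list set \<Rightarrow> nat \<times> real) \<Rightarrow> 'a list set \<Rightarrow> nat" where
  "dim h X \<equiv> fst (h X)"

abbreviation meas :: "('a list set \<Rightarrow> nat \<times> real) \<Rightarrow> 'a list set \<Rightarrow> real" where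
  "meas h X \<equiv> snd (h X)"

text \<open>(MS1) and (MS3) are stated together, since they share the set \<open>D\<close>.\<close>

definition MS1_MS3 ::
    "('f, 'r) language \<Rightarrow> ('f, 'r, 'a) struct \<Rightarrow> ('a list set \<Rightarrow> nat \<times> real) \<Rightarrow> bool" where
  "MS1_MS3 L M h \<longleftrightarrow>
     (\<forall>n\<ge>1. \<forall>m \<phi>. formula_in L (n + m) \<phi> \<longrightarrow>
        (\<exists>D. finite D \<and>
           (\<forall>as\<in>tuples m. h (solution_set M n \<phi> as) \<in> D) \<and>
           (\<forall>(d, \<mu>)\<in>D.
              definable_over L M {} m {as \<in> tuples m. h (solution_set M n \<phi> as) = (d, \<mu>)})))"

definition MS2 ::
    "('f, 'r) language \<Rightarrow> ('f, 'r, 'a) struct \<Rightarrow> ('a list set \<Rightarrow> nat \<times> real) \<Rightarrow> bool" where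
  "MS2 L M h \<longleftrightarrow> (\<forall>X\<in>Def L M. finite X \<longrightarrow> h X = (0, real (card X)))"

text \<open>
  A map between definable sets is definable if its graph is.  For empty \<open>X\<close> the maximum is
  over the empty set and is read as \<open>0\<close>, which the range of \<open>h\<close> enforces as the sum is \<open>0\<close>.
\<close>

definition MS4 ::
    "('f, 'r) language \<Rightarrow> ('f, 'r, 'a) struct \<Rightarrow> ('a list set \<Rightarrow> nat \<times> real) \<Rightarrow> bool" where
  "MS4 L M h \<longleftrightarrow>
     (\<forall>n\<ge>1. \<forall>m\<ge>1. \<forall>X Y f.
        definable_over L M UNIV n X \<and> definable_over L M UNIV m Y \<and>
        definable_over L M UNIV (n + m) ((\<lambda>x. x @ f x) ` X) \<and> f ` X = Y \<longrightarrow>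
        (let D = (\<lambda>b. h {x \<in> X. f x = b}) ` Y;
             Yv = (\<lambda>d \<mu>. {b \<in> Y. h {x \<in> X. f x = b} = (d, \<mu>)})
         in (X \<noteq> {} \<longrightarrow> dim h X = Max {d + dim h (Yv d \<mu>) |d \<mu>. (d, \<mu>) \<in> D}) \<and>
            meas h X =
              (\<Sum>(d, \<mu>)\<in>{(d, \<mu>) \<in> D. d + dim h (Yv d \<mu>) = dim h X}. \<mu> * meas h (Yv d \<mu>))))"

definition MS_measurable :: "('f, 'r) language \<Rightarrow> ('f, 'r, 'a) struct \<Rightarrow> bool" where
  "MS_measurable L M \<longleftrightarrow> infinite (UNIV :: 'a set) \<and>
     (\<exists>h. dim_meas_fun L M h \<and> MS1_MS3 L M h \<and> MS2 L M h \<and> MS4 L M h)"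


text \<open>
  In the conditions below, tuples are nonempty because \<open>Def\<close> consists of subsets of positive powers.
\<close>

definition cMS1 ::
    "('f, 'r) language \<Rightarrow> ('f, 'r, 'a) struct \<Rightarrow> ('a list set \<Rightarrow> nat \<times> real) \<Rightarrow> bool" where
  "cMS1 L M h \<longleftrightarrow>
     (\<forall>C as. \<forall>g\<in>Aut L M. finite C \<and> as \<noteq> [] \<longrightarrow> h (tp L M (map g as) (g ` C)) = h (tp L M as C))"

definition cMS2 ::
    "('f, 'r) language \<Rightarrow> ('f, 'r, 'a) struct \<Rightarrow> ('a list set \<Rightarrow> nat \<times> real) \<Rightarrow> bool" where
  "cMS2 L M h \<longleftrightarrow>
     (\<forall>C. \<forall>n\<ge>1. \<forall>X (k :: nat) (a :: nat \<Rightarrow> 'a list).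
        finite C \<and> definable_over L M C n X \<and> (\<forall>i<k. a i \<in> tuples n) \<and>
        disjoint_family_on (\<lambda>i. tp L M (a i) C) {..<k} \<and> X = (\<Union>i<k. tp L M (a i) C) \<longrightarrow>
        (k > 0 \<longrightarrow> dim h X = Max ((\<lambda>i. dim h (tp L M (a i) C)) ` {..<k})) \<and>
        meas h X = (\<Sum>i | i < k \<and> dim h (tp L M (a i) C) = dim h X. meas h (tp L M (a i) C)))"

definition cMS3 ::
    "('f, 'r) language \<Rightarrow> ('f, 'r, 'a) struct \<Rightarrow> ('a list set \<Rightarrow> nat \<times> real) \<Rightarrow> bool" where
  "cMS3 L M h \<longleftrightarrow>
     (\<forall>C as. finite C \<and> as \<noteq> [] \<and> set as \<subseteq> acl L M C \<longrightarrow>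
        dim h (tp L M as C) = 0 \<and>
        meas h (tp L M as C) = real (card {map g as |g. g \<in> Aut_over L M C}))"

definition cMS4 ::
    "('f, 'r) language \<Rightarrow> ('f, 'r, 'a) struct \<Rightarrow> ('a list set \<Rightarrow> nat \<times> real) \<Rightarrow> bool" where
  "cMS4 L M h \<longleftrightarrow>
     (\<forall>C as bs. finite C \<and> as \<noteq> [] \<and> bs \<noteq> [] \<and> set bs \<subseteq> dcl L M (C \<union> set as) \<longrightarrow>
        dim h (tp L M as C) = dim h (tp L M bs C) + dim h (tp L M as (C \<union> set bs)) \<and>
        meas h (tp L M as C) = meas h (tp L M bs C) * meas h (tp L M as (C \<union> set bs)))"

end

theory Submission
  imports Defs
begin

text \<open>
  By the theorem of Ryll-Nardzewski, for finite \<open>C\<close> a set is \<open>C\<close>-definable iff it is invariant under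
  \<open>Aut(M/C)\<close>, types over \<open>C\<close> are orbits, and there are finitely many of them in each power.  It is
  obtained from the omitting types theorem: a model is read off a generic chain of definable sets of
  valuations, and categoricity turns it into an enumeration of \<open>M\<close> itself.  The same \<open>h\<close> then serves
  in both directions.  Additivity over orbits follows from (MS4) for the map collapsing each orbit to
  a point, and (cMS4) from (MS4) for the map \<open>tp(a/C) \<rightarrow> tp(b/C)\<close>.  Conversely, for \<open>f : X \<rightarrow> Y\<close>
  over \<open>C\<close> the orbits in \<open>X\<close> above \<open>tp(b/C)\<close> correspond to the orbits over \<open>Cb\<close> in the fibre of
  \<open>b\<close>, so (cMS4) gives the contribution of \<open>tp(b/C)\<close> to \<open>h(X)\<close>, and grouping by the value of \<open>h\<close> on
  the fibres yields (MS4).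
\<close>

section \<open>Definable sets of valuations\<close>

text \<open>Everything takes place inside \<open>M\<close>: the variables themselves serve as Henkin
  constants, so the language is never extended. The obstacle is that a generic chain yields only a
  filter of valuations, which need not have a common point. The quotient of the variables by this
  filter is a model with universe \<open>nat\<close> that satisfies the same sentences as
  \<open>M\<close>, and an isomorphism back to \<open>M\<close> replaces the filter by one actual
  surjective valuation. Compactness for parameter-free definable sets and isolation of types are two
  instances of this. In the second half the obstacle is bookkeeping: (MS4) groups the points of
  \<open>Y\<close> by the value of \<open>h\<close> on their fibres, while (cMS2) and (cMS4) speak
  of orbits, and all of them restrict sums to the top dimension. Once pairs of dimension and measure
  are added in a commutative monoid, the passage is a regrouping of finite sums. Only empty sets
  need separate care: \<open>(0, 0)\<close> is neutral for the addition but not absorbing for the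
  multiplication.\<close>

lemma eval_term_cong:
  "(\<And>i. i \<in> term_vars t \<Longrightarrow> e i = e' i) \<Longrightarrow> eval_term M e t = eval_term M e' t"
proof (induction t)
  case (Fun f ts)
  then have "map (eval_term M e) ts = map (eval_term M e') ts"
    by (intro map_cong) auto
  then show ?case by (simp only: eval_term.simps)
qed simp

lemma sat_cong:
  "(\<And>i. i \<in> free_vars \<phi> \<Longrightarrow> e i = e' i) \<Longrightarrow> sat M e \<phi> \<longleftrightarrow> sat M e' \<phi>"
proof (induction \<phi> arbitrary: e e')
  case (Eq s t)
  then have "eval_term M e s = eval_term M e' s" "eval_term M e t = eval_term M e' t"
    by (auto intro: eval_term_cong)
  then show ?case by simp
next
  case (Rel r ts)
  then have "map (eval_term M e) ts = map (eval_term M e') ts"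
    by (intro map_cong eval_term_cong) auto
  then show ?case by (simp only: sat.simps)
next
  case (Neg \<phi>)
  have "sat M e \<phi> \<longleftrightarrow> sat M e' \<phi>" by (rule Neg.IH) (simp add: Neg.prems)
  then show ?case by (simp only: sat.simps)
next
  case (Conj \<phi> \<psi>)
  have "sat M e \<phi> \<longleftrightarrow> sat M e' \<phi>" by (rule Conj.IH) (simp add: Conj.prems)
  moreover have "sat M e \<psi> \<longleftrightarrow> sat M e' \<psi>" by (rule Conj.IH) (simp add: Conj.prems)
  ultimately show ?case by (simp only: sat.simps)
next
  case (Exists i \<phi>)
  have "sat M (e(i := a)) \<phi> \<longleftrightarrow> sat M (e'(i := a)) \<phi>" for a
    by (rule Exists.IH) (simp add: Exists.prems)
  then show ?case by (simp only: sat.simps)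
qed

lemma finite_term_vars [simp]: "finite (term_vars t)"
  by (induction t) auto

lemma finite_free_vars [simp]: "finite (free_vars \<phi>)"
  by (induction \<phi>) auto

section \<open>Renaming of variables without capture\<close>

primrec rename_term :: "(nat \<Rightarrow> nat) \<Rightarrow> 'f fo_term \<Rightarrow> 'f fo_term" where
  "rename_term \<rho> (Var i) = Var (\<rho> i)"
| "rename_term \<rho> (Fun f ts) = Fun f (map (rename_term \<rho>) ts)"

lemma eval_rename_term: "eval_term M e (rename_term \<rho> t) = eval_term M (\<lambda>i. e (\<rho> i)) t"
proof (induction t)
  case (Fun f ts)
  then have "map (\<lambda>t. eval_term M e (rename_term \<rho> t)) ts = map (eval_term M (\<lambda>i. e (\<rho> i))) ts"
    by (intro map_cong refl)
  then show ?case by (simp add: o_def del: map_eq_conv)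
qed simp

lemma wf_rename_term: "wf_term L t \<Longrightarrow> wf_term L (rename_term \<rho> t)"
  by (induction t) (auto simp: list_all_iff)

lemma vars_rename_term: "term_vars (rename_term \<rho> t) = \<rho> ` term_vars t"
  by (induction t) auto

text \<open>\<open>\<rho>\<close> need not be injective, so the bound variable must be renamed as
  well: it becomes a \<open>j\<close> outside the image of the other free variables. Asserting only
  the existence of \<open>\<phi>'\<close> avoids a recursive definition that has to choose fresh
  variables.\<close>

lemma rename_formula:
  assumes "wf_formula L \<phi>"
  shows "\<exists>\<phi>'. wf_formula L \<phi>' \<and> free_vars \<phi>' \<subseteq> \<rho> ` free_vars \<phi> \<and>
    (\<forall>e. sat M e \<phi>' \<longleftrightarrow> sat M (\<lambda>i. e (\<rho> i)) \<phi>)"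
  using assms
proof (induction \<phi> arbitrary: \<rho>)
  case (Eq s t)
  then show ?case
    by (intro exI[of _ "Eq (rename_term \<rho> s) (rename_term \<rho> t)"])
      (auto simp: eval_rename_term wf_rename_term vars_rename_term)
next
  case (Rel r ts)
  have "(\<lambda>t. eval_term M e (rename_term \<rho> t)) = eval_term M (\<lambda>i. e (\<rho> i))" for e
    by (intro ext) (rule eval_rename_term)
  with Rel show ?case
    by (intro exI[of _ "Rel r (map (rename_term \<rho>) ts)"])
      (auto simp: wf_rename_term vars_rename_term o_def)
next
  case (Neg \<phi>)
  then obtain \<phi>' where "wf_formula L \<phi>'" "free_vars \<phi>' \<subseteq> \<rho> ` free_vars \<phi>"
    "\<forall>e. sat M e \<phi>' \<longleftrightarrow> sat M (\<lambda>i. e (\<rho> i)) \<phi>" by fastforce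
  then show ?case by (intro exI[of _ "Neg \<phi>'"]) auto
next
  case (Conj \<phi> \<psi>)
  from Conj.prems have "wf_formula L \<phi>" "wf_formula L \<psi>" by auto
  with Conj.IH[of \<rho>] obtain \<phi>' \<psi>' where "wf_formula L \<phi>'" "free_vars \<phi>' \<subseteq> \<rho> ` free_vars \<phi>"
    "\<forall>e. sat M e \<phi>' \<longleftrightarrow> sat M (\<lambda>i. e (\<rho> i)) \<phi>" "wf_formula L \<psi>'" "free_vars \<psi>' \<subseteq> \<rho> ` free_vars \<psi>"
    "\<forall>e. sat M e \<psi>' \<longleftrightarrow> sat M (\<lambda>i. e (\<rho> i)) \<psi>" by metis
  then show ?case by (intro exI[of _ "Conj \<phi>' \<psi>'"]) auto
next
  case (Exists i \<phi>)
  have "finite (\<rho> ` (free_vars \<phi> - {i}))" by simp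
  then obtain j where j: "j \<notin> \<rho> ` (free_vars \<phi> - {i})"
    using ex_new_if_finite[OF infinite_UNIV_nat] by blast
  from Exists.prems have "wf_formula L \<phi>" by simp
  from Exists.IH[OF this, of "\<rho>(i := j)"] obtain \<phi>' where \<phi>': "wf_formula L \<phi>'"
    "free_vars \<phi>' \<subseteq> \<rho>(i := j) ` free_vars \<phi>"
    "\<forall>e. sat M e \<phi>' \<longleftrightarrow> sat M (\<lambda>k. e ((\<rho>(i := j)) k)) \<phi>" by blast
  have "sat M (\<lambda>k. (e(j := a)) ((\<rho>(i := j)) k)) \<phi> \<longleftrightarrow> sat M ((\<lambda>k. e (\<rho> k))(i := a)) \<phi>" for e a
    using j by (intro sat_cong) auto
  moreover have "free_vars \<phi>' - {j} \<subseteq> \<rho> ` (free_vars \<phi> - {i})"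
    using \<phi>'(2) by (auto split: if_splits)
  ultimately show ?case using \<phi>'
    by (intro exI[of _ "Exists j \<phi>'"]) auto
qed

text \<open>These are the parameter-free formulas up to equivalence in \<open>M\<close>. Valuations
  cover all variables at once, so Boolean operations need no matching of arities and a fresh
  variable is always at hand.\<close>

definition vdef :: "('f, 'r) language \<Rightarrow> ('f, 'r, 'a) struct \<Rightarrow> (nat \<Rightarrow> 'a) set \<Rightarrow> bool" where
  "vdef L M Q \<longleftrightarrow> (\<exists>\<phi>. wf_formula L \<phi> \<and> Q = {e. sat M e \<phi>})"

lemma vdefI: "wf_formula L \<phi> \<Longrightarrow> vdef L M {e. sat M e \<phi>}"
  unfolding vdef_def by blast

lemma vdef_Compl: "vdef L M Q \<Longrightarrow> vdef L M (- Q)"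
proof -
  assume "vdef L M Q"
  then obtain \<phi> where "wf_formula L \<phi>" "Q = {e. sat M e \<phi>}" unfolding vdef_def by blast
  then show ?thesis unfolding vdef_def by (intro exI[of _ "Neg \<phi>"]) auto
qed

lemma vdef_Int: "vdef L M Q \<Longrightarrow> vdef L M R \<Longrightarrow> vdef L M (Q \<inter> R)"
proof -
  assume "vdef L M Q" "vdef L M R"
  then obtain \<phi> \<psi> where "wf_formula L \<phi>" "Q = {e. sat M e \<phi>}" "wf_formula L \<psi>" "R = {e. sat M e \<psi>}"
    unfolding vdef_def by blast
  then show ?thesis unfolding vdef_def by (intro exI[of _ "Conj \<phi> \<psi>"]) auto
qed

lemma vdef_Ex: "vdef L M Q \<Longrightarrow> vdef L M {e. \<exists>a. e(i := a) \<in> Q}"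
proof -
  assume "vdef L M Q"
  then obtain \<phi> where "wf_formula L \<phi>" "Q = {e. sat M e \<phi>}" unfolding vdef_def by blast
  then show ?thesis unfolding vdef_def by (intro exI[of _ "Exists i \<phi>"]) auto
qed

lemma vdef_rename: "vdef L M Q \<Longrightarrow> vdef L M {e. (\<lambda>i. e (\<rho> i)) \<in> Q}"
proof -
  assume "vdef L M Q"
  then obtain \<phi> where \<phi>: "wf_formula L \<phi>" "Q = {e. sat M e \<phi>}" unfolding vdef_def by blast
  obtain \<phi>' where "wf_formula L \<phi>'" "\<forall>e. sat M e \<phi>' \<longleftrightarrow> sat M (\<lambda>i. e (\<rho> i)) \<phi>"
    using rename_formula[OF \<phi>(1), of \<rho> M] by blast
  then have "{e. (\<lambda>i. e (\<rho> i)) \<in> Q} = {e. sat M e \<phi>'}" by (simp add: \<phi>(2))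
  then show ?thesis using \<open>wf_formula L \<phi>'\<close> by (simp add: vdefI)
qed

lemma vdef_eq: "vdef L M {e. e i = e j}"
  using vdefI[of L "Eq (Var i) (Var j)" M] by simp

lemma vdef_UNIV: "vdef L M UNIV"
  using vdef_eq[of L M 0 0] by simp

lemma vdef_empty: "vdef L M {}"
  using vdef_Compl[OF vdef_UNIV] by simp

lemma vdef_Un: "vdef L M Q \<Longrightarrow> vdef L M R \<Longrightarrow> vdef L M (Q \<union> R)"
  using vdef_Compl[OF vdef_Int[OF vdef_Compl vdef_Compl]] by (metis Compl_Int double_complement)

lemma vdef_Inter: "finite I \<Longrightarrow> (\<And>i. i \<in> I \<Longrightarrow> vdef L M (Q i)) \<Longrightarrow> vdef L M (\<Inter>i\<in>I. Q i)"
  by (induction I rule: finite_induct) (auto intro: vdef_UNIV vdef_Int)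

lemma vdef_Union: "finite I \<Longrightarrow> (\<And>i. i \<in> I \<Longrightarrow> vdef L M (Q i)) \<Longrightarrow> vdef L M (\<Union>i\<in>I. Q i)"
  by (induction I rule: finite_induct) (auto intro: vdef_empty vdef_Un)

text \<open>The fresh variables in the density arguments are chosen outside such a
  \<open>V\<close>.\<close>

lemma vdef_support:
  assumes "vdef L M Q"
  obtains V where "finite V" "\<And>e e'. (\<And>i. i \<in> V \<Longrightarrow> e i = e' i) \<Longrightarrow> e \<in> Q \<longleftrightarrow> e' \<in> Q"
proof -
  obtain \<phi> where "Q = {e. sat M e \<phi>}" using assms unfolding vdef_def by blast
  then show ?thesis using that[of "free_vars \<phi>"] sat_cong[of \<phi> _ _ M] by (metis finite_free_vars mem_Collect_eq)
qed

text \<open>The variables in \<open>I\<close> are quantified away one at a time; \<open>e'\<close>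
  is free exactly on \<open>I\<close>. Applied to the free variables of index at least
  \<open>n\<close>, this leaves a formula in the variables below \<open>n\<close>.\<close>

lemma project_formula:
  assumes "wf_formula L \<phi>" "finite I"
  shows "\<exists>\<psi>. wf_formula L \<psi> \<and> free_vars \<psi> \<subseteq> free_vars \<phi> - I \<and>
    (\<forall>e. sat M e \<psi> \<longleftrightarrow> (\<exists>e'. (\<forall>k. k \<notin> I \<longrightarrow> e' k = e k) \<and> sat M e' \<phi>))"
  using assms(2)
proof (induction I rule: finite_induct)
  case empty
  have "(\<forall>k. e' k = e k) \<longleftrightarrow> e' = e" for e e' :: "nat \<Rightarrow> 'c" by auto
  then show ?case using assms(1) by (intro exI[of _ \<phi>]) auto
next
  case (insert i I)
  then obtain \<psi> where \<psi>: "wf_formula L \<psi>" "free_vars \<psi> \<subseteq> free_vars \<phi> - I"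
    "\<And>e. sat M e \<psi> \<longleftrightarrow> (\<exists>e'. (\<forall>k. k \<notin> I \<longrightarrow> e' k = e k) \<and> sat M e' \<phi>)" by blast
  have "(\<exists>a e'. (\<forall>k. k \<notin> I \<longrightarrow> e' k = (e(i := a)) k) \<and> sat M e' \<phi>) \<longleftrightarrow>
     (\<exists>e'. (\<forall>k. k \<notin> insert i I \<longrightarrow> e' k = e k) \<and> sat M e' \<phi>)" (is "?l \<longleftrightarrow> ?r") for e
  proof
    assume ?r
    then obtain e' where "\<forall>k. k \<notin> insert i I \<longrightarrow> e' k = e k" "sat M e' \<phi>" by blast
    then show ?l by (intro exI[of _ "e' i"] exI[of _ e']) auto
  next
    assume ?l
    then obtain a e' where "\<forall>k. k \<notin> I \<longrightarrow> e' k = (e(i := a)) k" "sat M e' \<phi>" by blast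
    then show ?r by (intro exI[of _ e']) auto
  qed
  then have "sat M e (Exists i \<psi>) \<longleftrightarrow> (\<exists>e'. (\<forall>k. k \<notin> insert i I \<longrightarrow> e' k = e k) \<and> sat M e' \<phi>)" for e
    by (simp only: sat.simps \<psi>(3))
  then show ?case using \<psi>(1,2) by (intro exI[of _ "Exists i \<psi>"]) auto
qed

section \<open>Passing between sets of valuations and sets of tuples\<close>

abbreviation defn :: "('f, 'r) language \<Rightarrow> ('f, 'r, 'a) struct \<Rightarrow> nat \<Rightarrow> 'a list set \<Rightarrow> bool" where
  "defn L M \<equiv> definable_over L M {}"

lemma definable_over_subset: "definable_over L M C n X \<Longrightarrow> X \<subseteq> tuples n"
  unfolding definable_over_def solution_set_def by auto

lemma defn_iff: "defn L M n X \<longleftrightarrow> (\<exists>\<phi>. formula_in L n \<phi> \<and> X = solution_set M n \<phi> [])"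
  unfolding definable_over_def by auto

lemma vdef_preimage:
  assumes "defn L M n X" "length is = n"
  shows "vdef L M {e. map e is \<in> X}"
proof -
  obtain \<phi> where \<phi>: "formula_in L n \<phi>" "X = solution_set M n \<phi> []"
    using assms(1) unfolding defn_iff by blast
  have "map e is \<in> X \<longleftrightarrow> (\<lambda>k. e (is ! k)) \<in> {e. sat M e \<phi>}" for e
  proof -
    have "sat M (\<lambda>i. (map e is @ []) ! i) \<phi> \<longleftrightarrow> sat M (\<lambda>k. e (is ! k)) \<phi>"
      using \<phi>(1) assms(2) by (intro sat_cong) (auto simp: formula_in_def)
    then show ?thesis using \<phi>(2) assms(2) by (simp add: solution_set_def tuples_def)
  qed
  moreover have "vdef L M {e. sat M e \<phi>}" using \<phi>(1) vdefI by (auto simp: formula_in_def)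
  ultimately show ?thesis using vdef_rename[of L M "{e. sat M e \<phi>}" "\<lambda>k. is ! k"] by simp
qed

lemma defn_proj0:
  assumes "vdef L M Q"
  shows "defn L M n {map e [0..<n] |e. e \<in> Q}"
proof -
  obtain \<phi> where \<phi>: "wf_formula L \<phi>" "Q = {e. sat M e \<phi>}" using assms unfolding vdef_def by blast
  obtain \<psi> where \<psi>: "wf_formula L \<psi>" "free_vars \<psi> \<subseteq> free_vars \<phi> - (free_vars \<phi> - {..<n})"
    "\<And>e. sat M e \<psi> \<longleftrightarrow> (\<exists>e'. (\<forall>k. k \<notin> free_vars \<phi> - {..<n} \<longrightarrow> e' k = e k) \<and> sat M e' \<phi>)"
    using project_formula[OF \<phi>(1), of "free_vars \<phi> - {..<n}" M] by auto
  have "formula_in L n \<psi>" using \<psi> by (auto simp: formula_in_def)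
  moreover have "{map e [0..<n] |e. e \<in> Q} = solution_set M n \<psi> []"
  proof (intro set_eqI iffI)
    fix xs assume "xs \<in> {map e [0..<n] |e. e \<in> Q}"
    then obtain e where e: "xs = map e [0..<n]" "sat M e \<phi>" using \<phi> by auto
    have "sat M e \<psi>" using e(2) \<psi>(3) by blast
    moreover have "sat M e \<psi> \<longleftrightarrow> sat M (\<lambda>i. (xs @ []) ! i) \<psi>"
      using e(1) \<psi>(2) by (intro sat_cong) auto
    ultimately show "xs \<in> solution_set M n \<psi> []" using e(1) by (simp add: solution_set_def tuples_def)
  next
    fix xs assume "xs \<in> solution_set M n \<psi> []"
    then have xs: "length xs = n" "sat M (\<lambda>i. xs ! i) \<psi>" by (auto simp: solution_set_def tuples_def)
    then obtain e' where e': "\<forall>k. k \<notin> free_vars \<phi> - {..<n} \<longrightarrow> e' k = xs ! k" "sat M e' \<phi>" using \<psi>(3) by blast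
    have "xs = map e' [0..<n]" using e'(1) xs(1) by (auto intro: nth_equalityI)
    then show "xs \<in> {map e [0..<n] |e. e \<in> Q}" using e'(2) \<phi>(2) by blast
  qed
  ultimately show ?thesis unfolding defn_iff by blast
qed

lemma defn_proj:
  assumes "vdef L M Q"
  shows "defn L M (length is) {map e is |e. e \<in> Q}"
proof -
  define n where "n = length is"
  \<comment> \<open>The list \<open>is\<close> may repeat variables or list them in any order. So
    the valuation is moved to the coordinates from \<open>n\<close> on, and the coordinates below
    \<open>n\<close> receive copies of the selected ones.\<close>
  define R where "R = {e. (\<lambda>k. e (n + k)) \<in> Q} \<inter> (\<Inter>k\<in>{..<n}. {e. e (n + is ! k) = e k})"
  have "vdef L M R" unfolding R_def
    by (intro vdef_Int vdef_rename vdef_Inter vdef_eq assms) auto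
  moreover have "{map e is |e. e \<in> Q} = {map e [0..<n] |e. e \<in> R}"
  proof (intro set_eqI iffI)
    fix xs assume "xs \<in> {map e is |e. e \<in> Q}"
    then obtain e where e: "xs = map e is" "e \<in> Q" by auto
    define e' where "e' k = (if k < n then xs ! k else e (k - n))" for k
    have "(\<lambda>k. e' (n + k)) = e" by (auto simp: e'_def)
    then have "e' \<in> R" using e by (auto simp: R_def e'_def n_def)
    moreover have "xs = map e' [0..<n]" using e by (auto intro!: nth_equalityI simp: e'_def n_def)
    ultimately show "xs \<in> {map e [0..<n] |e. e \<in> R}" by blast
  next
    fix xs assume "xs \<in> {map e [0..<n] |e. e \<in> R}"
    then obtain e where e: "xs = map e [0..<n]" "e \<in> R" by auto
    have "xs = map (\<lambda>k. e (n + k)) is" using e by (auto intro!: nth_equalityI simp: R_def n_def)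
    then show "xs \<in> {map e is |e. e \<in> Q}" using e(2) unfolding R_def by blast
  qed
  ultimately show ?thesis using defn_proj0[of L M R n] n_def by simp
qed

lemma defn_iff_vdef:
  "defn L M n X \<longleftrightarrow> X \<subseteq> tuples n \<and> vdef L M {e. map e [0..<n] \<in> X}"
proof
  assume "defn L M n X"
  then show "X \<subseteq> tuples n \<and> vdef L M {e. map e [0..<n] \<in> X}"
    using vdef_preimage[of L M n X "[0..<n]"] definable_over_subset[of L M "{}" n X] by simp
next
  assume *: "X \<subseteq> tuples n \<and> vdef L M {e. map e [0..<n] \<in> X}"
  have "xs \<in> {map e [0..<n] |e. map e [0..<n] \<in> X}" if "xs \<in> X" for xs
  proof -
    have "xs = map (\<lambda>k. xs ! k) [0..<n]" using * that by (auto intro!: nth_equalityI simp: tuples_def)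
    then show ?thesis using that by (metis (mono_tags, lifting) mem_Collect_eq)
  qed
  then have "X = {map e [0..<n] |e. map e [0..<n] \<in> X}" by auto
  then show "defn L M n X" using defn_proj0[of L M "{e. map e [0..<n] \<in> X}" n] * by simp
qed

lemma defn_Diff: "defn L M n X \<Longrightarrow> defn L M n (tuples n - X)"
  using vdef_Compl[of L M "{e. map e [0..<n] \<in> X}"]
  by (simp add: defn_iff_vdef tuples_def Collect_neg_eq[symmetric])

lemma defn_Union:
  assumes "finite \<X>" "\<And>X. X \<in> \<X> \<Longrightarrow> defn L M n X"
  shows "defn L M n (\<Union>\<X>)"
proof -
  have "vdef L M (\<Union>X\<in>\<X>. {e. map e [0..<n] \<in> X})"
    using assms by (intro vdef_Union) (auto simp: defn_iff_vdef)
  moreover have "(\<Union>X\<in>\<X>. {e. map e [0..<n] \<in> X}) = {e. map e [0..<n] \<in> \<Union>\<X>}" by auto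
  ultimately show ?thesis using assms(2) unfolding defn_iff_vdef by (simp add: Sup_le_iff)
qed

section \<open>Countability of the set of formulas\<close>

instance fo_term :: (countable) countable
  by countable_datatype

instance fo_formula :: (countable, countable) countable
  by countable_datatype

lemma wf_term_symbols: "wf_term L t \<Longrightarrow> set_fo_term t \<subseteq> fst ` funs L"
proof (induction t)
  case (Fun f ts)
  from Fun.prems have "(f, length ts) \<in> funs L" "\<forall>t\<in>set ts. wf_term L t"
    by (auto simp: list_all_iff)
  with Fun.IH show ?case by (force simp: image_iff)
qed simp

lemma wf_formula_symbols:
  "wf_formula L \<phi> \<Longrightarrow> set1_fo_formula \<phi> \<subseteq> fst ` funs L \<and> set2_fo_formula \<phi> \<subseteq> fst ` rels L"
proof (induction \<phi>)
  case (Eq s t)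
  then show ?case using wf_term_symbols[of L s] wf_term_symbols[of L t] by auto
next
  case (Rel r ts)
  then have "(r, length ts) \<in> rels L" "\<forall>t\<in>set ts. set_fo_term t \<subseteq> fst ` funs L"
    using wf_term_symbols by auto
  then show ?case by force
qed auto

text \<open>The types of symbol names may be uncountable; only the names in \<open>L\<close> are
  countable. They are replaced by numbers, which is injective on well-formed formulas because these
  use no other names.\<close>

lemma countable_wf_formulas:
  assumes "countable (funs L)" "countable (rels L)"
  shows "countable {\<phi>. wf_formula L \<phi>}"
proof -
  let ?F = "fst ` funs L" and ?R = "fst ` rels L"
  let ?\<pi> = "map_fo_formula (to_nat_on ?F) (to_nat_on ?R)"
  have inj: "inj_on (to_nat_on ?F) ?F" "inj_on (to_nat_on ?R) ?R" using assms by auto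
  have sym: "set1_fo_formula \<phi> \<subseteq> ?F" "set2_fo_formula \<phi> \<subseteq> ?R" if "wf_formula L \<phi>" for \<phi>
    using wf_formula_symbols[OF that] by blast+
  have "\<phi> = \<psi>" if "wf_formula L \<phi>" "wf_formula L \<psi>" "?\<pi> \<phi> = ?\<pi> \<psi>" for \<phi> \<psi>
  proof (rule fo_formula.inj_map_strong[OF _ _ that(3)])
    show "z = z'" if "z \<in> set1_fo_formula \<phi>" "z' \<in> set1_fo_formula \<psi>"
      "to_nat_on ?F z = to_nat_on ?F z'" for z z'
      using subsetD[OF sym(1)[OF \<open>wf_formula L \<phi>\<close>] that(1)]
        subsetD[OF sym(1)[OF \<open>wf_formula L \<psi>\<close>] that(2)]
      by (rule inj_onD[OF inj(1) that(3)])
    show "z = z'" if "z \<in> set2_fo_formula \<phi>" "z' \<in> set2_fo_formula \<psi>"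
      "to_nat_on ?R z = to_nat_on ?R z'" for z z'
      using subsetD[OF sym(2)[OF \<open>wf_formula L \<phi>\<close>] that(1)]
        subsetD[OF sym(2)[OF \<open>wf_formula L \<psi>\<close>] that(2)]
      by (rule inj_onD[OF inj(2) that(3)])
  qed
  then have "inj_on ?\<pi> {\<phi>. wf_formula L \<phi>}" by (auto intro: inj_onI)
  then show ?thesis by (rule countableI')
qed

lemma countable_vdef:
  assumes "countable (funs L)" "countable (rels L)"
  shows "countable {Q. vdef L M Q}"
proof -
  have "{Q. vdef L M Q} = (\<lambda>\<phi>. {e. sat M e \<phi>}) ` {\<phi>. wf_formula L \<phi>}"
    unfolding vdef_def by auto
  then show ?thesis using countable_wf_formulas[OF assms] by simp
qed

section \<open>The omitting types construction\<close>

lemma isomorphism_eval_term: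
  assumes "isomorphism L M N g" "wf_term L t"
  shows "eval_term N (\<lambda>i. g (e i)) t = g (eval_term M e t)"
  using assms(2)
proof (induction t)
  case (Fun f ts)
  then have "map (eval_term N (\<lambda>i. g (e i))) ts = map g (map (eval_term M e) ts)"
    by (auto simp: list_all_iff)
  moreover have "g (fun_int M f (map (eval_term M e) ts)) = fun_int N f (map g (map (eval_term M e) ts))"
    using assms(1) Fun.prems unfolding isomorphism_def by fastforce
  ultimately show ?case by (simp only: eval_term.simps)
qed simp

lemma isomorphism_sat:
  assumes "isomorphism L M N g" "wf_formula L \<phi>"
  shows "sat N (\<lambda>i. g (e i)) \<phi> \<longleftrightarrow> sat M e \<phi>"
  using assms(2)
proof (induction \<phi> arbitrary: e)
  case (Eq s t)
  have "inj g" using assms(1) by (auto simp: isomorphism_def bij_def)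
  with Eq isomorphism_eval_term[OF assms(1)] show ?case by (auto dest: injD)
next
  case (Rel r ts)
  then have "map (eval_term N (\<lambda>i. g (e i))) ts = map g (map (eval_term M e) ts)"
    using isomorphism_eval_term[OF assms(1)] by auto
  moreover have "rel_int M r (map (eval_term M e) ts) \<longleftrightarrow> rel_int N r (map g (map (eval_term M e) ts))"
    using assms(1) Rel.prems unfolding isomorphism_def by fastforce
  ultimately show ?case by (simp only: sat.simps)
next
  case (Exists i \<phi>)
  have "surj g" using assms(1) by (auto simp: isomorphism_def bij_def)
  have upd: "(\<lambda>k. g (e k))(i := g a) = (\<lambda>k. g ((e(i := a)) k))" for a by auto
  have "sat N ((\<lambda>k. g (e k))(i := g a)) \<phi> \<longleftrightarrow> sat M (e(i := a)) \<phi>" for a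
    unfolding upd using Exists by (simp only: wf_formula.simps)
  then show ?case using \<open>surj g\<close> by (metis sat.simps(5) surjD)
qed simp_all

text \<open>\<open>F\<close> plays the part of a complete Henkin theory: a formula counts as true if
  it holds eventually. Elements of \<open>N\<close> are classes of variables under eventual
  equality, \<open>s\<close> sends a variable to its class, and the hypothesis
  \<open>distinct\<close> yields infinitely many classes, so that they can be numbered by
  \<open>nat\<close>.\<close>

lemma henkin_model:
  fixes M :: "('f, 'r, 'a) struct" and F :: "(nat \<Rightarrow> 'a) filter"
  assumes nontriv: "F \<noteq> bot"
    and decide: "\<And>Q. vdef L M Q \<Longrightarrow> eventually (\<lambda>e. e \<in> Q) F \<or> eventually (\<lambda>e. e \<notin> Q) F"
    and witness: "\<And>Q i. vdef L M Q \<Longrightarrow> eventually (\<lambda>e. \<exists>a. e(i := a) \<in> Q) F \<Longrightarrow>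
      \<exists>j. eventually (\<lambda>e. e(i := e j) \<in> Q) F"
    and distinct: "\<And>k. \<exists>j. eventually (\<lambda>e. \<forall>i<k. e j \<noteq> e i) F"
  shows "\<exists>(N :: ('f, 'r, nat) struct) s. surj s \<and>
    (\<forall>\<phi>. wf_formula L \<phi> \<longrightarrow> (sat N s \<phi> \<longleftrightarrow> eventually (\<lambda>e. sat M e \<phi>) F))"
proof -
  define E where "E i j \<longleftrightarrow> eventually (\<lambda>e. e i = e j) F" for i j
  have E_refl: "E i i" for i by (simp add: E_def)
  have E_sym: "E i j \<Longrightarrow> E j i" for i j by (simp add: E_def eq_commute)
  have E_trans: "E i j \<Longrightarrow> E j k \<Longrightarrow> E i k" for i j k
    unfolding E_def by (erule (1) eventually_elim2) simp
  \<comment> \<open>The least member represents a class, so the classes form an infinite set of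
    numbers, which \<open>to_nat_on\<close> matches with \<open>nat\<close>.\<close>
  define r where "r i = (LEAST j. E i j)" for i
  have E_r: "E i (r i)" for i unfolding r_def by (rule LeastI[of _ i]) (rule E_refl)
  have r_eq: "r i = r j \<longleftrightarrow> E i j" for i j
  proof
    assume "E i j"
    then have "E i = E j" using E_sym E_trans by blast
    then show "r i = r j" by (simp add: r_def)
  qed (metis E_r E_sym E_trans)
  have "infinite (range r)"
  proof
    assume "finite (range r)"
    then obtain k where k: "\<And>i. r i < k" by (metis finite_nat_set_iff_bounded rangeI)
    obtain j where "eventually (\<lambda>e. \<forall>i<k. e j \<noteq> e i) F" using distinct by blast
    moreover have "eventually (\<lambda>e. e j = e (r j)) F" using E_r by (simp add: E_def)
    ultimately have "eventually (\<lambda>e. False) F"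
      by eventually_elim (use k in blast)
    with nontriv show False by (simp add: eventually_False)
  qed
  then have bij: "bij_betw (to_nat_on (range r)) (range r) UNIV"
    by (intro to_nat_on_infinite) auto
  define s where "s i = to_nat_on (range r) (r i)" for i
  have s_eq: "s i = s j \<longleftrightarrow> E i j" for i j
    unfolding s_def r_eq[symmetric]
    by (intro inj_on_eq_iff[OF bij_betw_imp_inj_on[OF bij]] rangeI)
  have "range s = to_nat_on (range r) ` range r" by (auto simp: s_def)
  then have "surj s" using bij by (simp add: bij_betw_def)
  define rep where "rep = inv s"
  have s_rep: "s (rep x) = x" for x using \<open>surj s\<close> by (simp add: rep_def surj_f_inv_f)
  have rep_list: "eventually (\<lambda>e. map e (map rep (map s js)) = map e js) F" for js
  proof -
    have "eventually (\<lambda>e. \<forall>x\<in>set js. e (rep (s x)) = e x) F"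
      using s_rep s_eq by (intro eventually_ball_finite) (auto simp: E_def)
    then show ?thesis by eventually_elim simp
  qed
  \<comment> \<open>An element of \<open>N\<close> is read as the variable \<open>rep\<close>
    assigns to it. The \<open>SOME\<close> is meaningful for the function symbols of
    \<open>L\<close> applied with their arity, where \<open>fun_ex\<close> provides a suitable
    \<open>j\<close>.\<close>
  define N :: "('f, 'r, nat) struct" where "N =
    \<lparr>fun_int = (\<lambda>f xs. s (SOME j. eventually (\<lambda>e. e j = fun_int M f (map e (map rep xs))) F)),
     rel_int = (\<lambda>r xs. eventually (\<lambda>e. rel_int M r (map e (map rep xs))) F)\<rparr>"

  have fun_ex: "\<exists>j. eventually (\<lambda>e. e j = fun_int M f (map e js)) F" if "(f, length js) \<in> funs L" for f js
  proof -
    \<comment> \<open>With \<open>i\<close> outside \<open>js\<close>, updating \<open>i\<close>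
      leaves the arguments alone, so the function value trivially exists as a value at
      \<open>i\<close>; \<open>witness\<close> turns it into a fixed variable.\<close>
    obtain i where i: "i \<notin> set js" using ex_new_if_finite[OF infinite_UNIV_nat] by blast
    let ?Q = "{e. e i = fun_int M f (map e js)}"
    have "vdef L M {e. sat M e (Eq (Var i) (Fun f (map Var js)))}"
      using that by (intro vdefI) (auto simp: list_all_iff)
    then have "vdef L M ?Q" by (simp add: o_def)
    moreover have upd: "map (e(i := a)) js = map e js" for e a using i by auto
    have "eventually (\<lambda>e. \<exists>a. e(i := a) \<in> ?Q) F"
      unfolding mem_Collect_eq upd by simp
    ultimately obtain j where "eventually (\<lambda>e. e(i := e j) \<in> ?Q) F" using witness by blast
    then show ?thesis unfolding mem_Collect_eq upd by auto
  qed
  have fun_N: "fun_int N f (map s js) = s j"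
    if "(f, length js) \<in> funs L" "eventually (\<lambda>e. e j = fun_int M f (map e js)) F" for f js j
  proof -
    let ?js = "map rep (map s js)"
    define j' where "j' = (SOME j. eventually (\<lambda>e. e j = fun_int M f (map e ?js)) F)"
    have "eventually (\<lambda>e. e j' = fun_int M f (map e ?js)) F"
      unfolding j'_def by (rule someI_ex[OF fun_ex]) (use that(1) in simp)
    then have "E j' j" using that(2) rep_list[of js] unfolding E_def
      by eventually_elim (simp only:)
    then show ?thesis unfolding N_def struct.simps j'_def[symmetric] by (simp only: s_eq)
  qed
  have term_N: "\<exists>j. s j = eval_term N (\<lambda>i. s (\<rho> i)) t \<and>
      eventually (\<lambda>e. e j = eval_term M (\<lambda>i. e (\<rho> i)) t) F" if "wf_term L t" for t \<rho>
    using that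
  proof (induction t)
    case (Fun f ts)
    then have "\<forall>t\<in>set ts. \<exists>j. s j = eval_term N (\<lambda>i. s (\<rho> i)) t \<and>
      eventually (\<lambda>e. e j = eval_term M (\<lambda>i. e (\<rho> i)) t) F" by (simp add: list_all_iff)
    from bchoice[OF this] obtain J where "\<forall>t\<in>set ts. s (J t) = eval_term N (\<lambda>i. s (\<rho> i)) t \<and>
      eventually (\<lambda>e. e (J t) = eval_term M (\<lambda>i. e (\<rho> i)) t) F" ..
    then have J: "\<And>t. t \<in> set ts \<Longrightarrow> s (J t) = eval_term N (\<lambda>i. s (\<rho> i)) t"
      "\<And>t. t \<in> set ts \<Longrightarrow> eventually (\<lambda>e. e (J t) = eval_term M (\<lambda>i. e (\<rho> i)) t) F" by blast+
    have f: "(f, length (map J ts)) \<in> funs L" using Fun.prems by simp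
    then obtain j where j: "eventually (\<lambda>e. e j = fun_int M f (map e (map J ts))) F" using fun_ex by blast
    have "eventually (\<lambda>e. \<forall>t\<in>set ts. e (J t) = eval_term M (\<lambda>i. e (\<rho> i)) t) F"
      using J(2) by (intro eventually_ball_finite) auto
    then have "eventually (\<lambda>e. map e (map J ts) = map (eval_term M (\<lambda>i. e (\<rho> i))) ts) F"
      by eventually_elim simp
    with j have "eventually (\<lambda>e. e j = fun_int M f (map (eval_term M (\<lambda>i. e (\<rho> i))) ts)) F"
      by eventually_elim (simp only:)
    moreover have "map s (map J ts) = map (eval_term N (\<lambda>i. s (\<rho> i))) ts" using J(1) by simp
    then have "s j = eval_term N (\<lambda>i. s (\<rho> i)) (Fun f ts)"
      unfolding eval_term.simps using fun_N[OF f j] by (simp only:)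
    ultimately show ?case unfolding eval_term.simps by blast
  qed auto
  \<comment> \<open>The renaming \<open>\<rho>\<close> is carried along for the quantifier: the
    element chosen for \<open>i\<close> is some \<open>s j\<close>, and updating the composed
    valuation at \<open>i\<close> to \<open>s j\<close> amounts to changing \<open>\<rho>\<close> at
    \<open>i\<close> to \<open>j\<close>.\<close>
  have sat_N: "sat N (\<lambda>i. s (\<rho> i)) \<phi> \<longleftrightarrow> eventually (\<lambda>e. sat M (\<lambda>i. e (\<rho> i)) \<phi>) F" if "wf_formula L \<phi>" for \<phi> \<rho>
    using that
  proof (induction \<phi> arbitrary: \<rho>)
    case (Eq t u)
    then obtain j k where j: "s j = eval_term N (\<lambda>i. s (\<rho> i)) t"
        "eventually (\<lambda>e. e j = eval_term M (\<lambda>i. e (\<rho> i)) t) F"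
      and k: "s k = eval_term N (\<lambda>i. s (\<rho> i)) u"
        "eventually (\<lambda>e. e k = eval_term M (\<lambda>i. e (\<rho> i)) u) F"
      using term_N[of t \<rho>] term_N[of u \<rho>] by auto
    have "eventually (\<lambda>e. (e j = e k) \<longleftrightarrow> sat M (\<lambda>i. e (\<rho> i)) (Eq t u)) F"
      using j(2) k(2) by eventually_elim simp
    then have "E j k \<longleftrightarrow> eventually (\<lambda>e. sat M (\<lambda>i. e (\<rho> i)) (Eq t u)) F"
      unfolding E_def by (rule eventually_subst)
    then show ?case unfolding sat.simps(1)[of N] j(1)[symmetric] k(1)[symmetric] s_eq .
  next
    case (Rel R ts)
    then have "\<forall>t\<in>set ts. \<exists>j. s j = eval_term N (\<lambda>i. s (\<rho> i)) t \<and>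
      eventually (\<lambda>e. e j = eval_term M (\<lambda>i. e (\<rho> i)) t) F" using term_N by simp
    from bchoice[OF this] obtain J where "\<forall>t\<in>set ts. s (J t) = eval_term N (\<lambda>i. s (\<rho> i)) t \<and>
      eventually (\<lambda>e. e (J t) = eval_term M (\<lambda>i. e (\<rho> i)) t) F" ..
    then have J: "\<And>t. t \<in> set ts \<Longrightarrow> s (J t) = eval_term N (\<lambda>i. s (\<rho> i)) t"
      "\<And>t. t \<in> set ts \<Longrightarrow> eventually (\<lambda>e. e (J t) = eval_term M (\<lambda>i. e (\<rho> i)) t) F" by blast+
    have "eventually (\<lambda>e. \<forall>t\<in>set ts. e (J t) = eval_term M (\<lambda>i. e (\<rho> i)) t) F"
      using J(2) by (intro eventually_ball_finite) auto
    then have "eventually (\<lambda>e. map e (map J ts) = map (eval_term M (\<lambda>i. e (\<rho> i))) ts) F"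
      by eventually_elim simp
    with rep_list[of "map J ts"] have "eventually (\<lambda>e. rel_int M R (map e (map rep (map s (map J ts)))) \<longleftrightarrow>
        sat M (\<lambda>i. e (\<rho> i)) (Rel R ts)) F"
      by eventually_elim (simp only: sat.simps)
    then have "rel_int N R (map s (map J ts)) \<longleftrightarrow> eventually (\<lambda>e. sat M (\<lambda>i. e (\<rho> i)) (Rel R ts)) F"
      unfolding N_def struct.simps by (rule eventually_subst)
    moreover have "map s (map J ts) = map (eval_term N (\<lambda>i. s (\<rho> i))) ts" using J(1) by simp
    ultimately show ?case unfolding sat.simps by (simp only:)
  next
    case (Neg \<phi>)
    then have "wf_formula L \<phi>" by simp
    then have "eventually (\<lambda>e. sat M (\<lambda>i. e (\<rho> i)) \<phi>) F \<or> eventually (\<lambda>e. \<not> sat M (\<lambda>i. e (\<rho> i)) \<phi>) F"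
      using decide[OF vdef_rename[OF vdefI]] by simp
    moreover have "\<not> (eventually (\<lambda>e. sat M (\<lambda>i. e (\<rho> i)) \<phi>) F \<and> eventually (\<lambda>e. \<not> sat M (\<lambda>i. e (\<rho> i)) \<phi>) F)"
      using nontriv unfolding eventually_conj_iff[symmetric] by (simp add: eventually_False)
    moreover have "sat N (\<lambda>i. s (\<rho> i)) \<phi> \<longleftrightarrow> eventually (\<lambda>e. sat M (\<lambda>i. e (\<rho> i)) \<phi>) F"
      using Neg.IH \<open>wf_formula L \<phi>\<close> by blast
    ultimately show ?case unfolding sat.simps by blast
  next
    case (Conj \<phi> \<psi>)
    then show ?case by (simp add: eventually_conj_iff)
  next
    case (Exists i \<phi>)
    then have wf: "wf_formula L \<phi>" by simp
    have updN: "(\<lambda>k. s (\<rho> k))(i := s j) = (\<lambda>k. s ((\<rho>(i := j)) k))" for j by auto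
    have "sat N (\<lambda>k. s (\<rho> k)) (Exists i \<phi>) \<longleftrightarrow> (\<exists>j. sat N ((\<lambda>k. s (\<rho> k))(i := s j)) \<phi>)"
      using \<open>surj s\<close> unfolding sat.simps by (metis surjD)
    also have "\<dots> \<longleftrightarrow> (\<exists>j. eventually (\<lambda>e. sat M (\<lambda>k. e ((\<rho>(i := j)) k)) \<phi>) F)"
      unfolding updN using Exists.IH[OF wf] by blast
    also have "\<dots> \<longleftrightarrow> eventually (\<lambda>e. sat M (\<lambda>i. e (\<rho> i)) (Exists i \<phi>)) F" (is "?l \<longleftrightarrow> ?r")
    proof
      assume ?l
      then obtain j where "eventually (\<lambda>e. sat M (\<lambda>k. e ((\<rho>(i := j)) k)) \<phi>) F" by blast
      then show ?r
      proof eventually_elim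
        case (elim e)
        have "(\<lambda>k. e ((\<rho>(i := j)) k)) = (\<lambda>k. e (\<rho> k))(i := e j)" by auto
        with elim show ?case by auto
      qed
    next
      assume r: ?r
      \<comment> \<open>\<open>witness\<close> updates a coordinate of the valuation itself, before
        \<open>\<rho>\<close> is applied. A coordinate \<open>i'\<close> to which
        \<open>\<rho>\<close> sends no other free variable of \<open>\<phi>\<close> can carry the
        quantified variable.\<close>
      have "finite (\<rho> ` (free_vars \<phi> - {i}))" by simp
      then obtain i' where i': "i' \<notin> \<rho> ` (free_vars \<phi> - {i})"
        using ex_new_if_finite[OF infinite_UNIV_nat] by blast
      let ?Q = "{e. (\<lambda>k. e ((\<rho>(i := i')) k)) \<in> {e. sat M e \<phi>}}"
      have Q: "vdef L M ?Q" by (rule vdef_rename[OF vdefI[OF wf]])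
      have fresh: "e(i' := a) \<in> ?Q \<longleftrightarrow> sat M ((\<lambda>k. e (\<rho> k))(i := a)) \<phi>" for e a
        unfolding mem_Collect_eq using i' by (intro sat_cong) auto
      have "eventually (\<lambda>e. \<exists>a. e(i' := a) \<in> ?Q) F"
        using r unfolding fresh sat.simps .
      from witness[OF Q this] obtain j where "eventually (\<lambda>e. e(i' := e j) \<in> ?Q) F" by blast
      moreover have "(\<lambda>k. e (\<rho> k))(i := e j) = (\<lambda>k. e ((\<rho>(i := j)) k))" for e :: "nat \<Rightarrow> 'a" by auto
      ultimately show ?l unfolding fresh by auto
    qed
    finally show ?case .
  qed
  show ?thesis
    using \<open>surj s\<close> sat_N[of _ "\<lambda>i. i"] by (intro exI[of _ N] exI[of _ s]) simp
qed

text \<open>The truth of a sentence does not depend on the valuation and \<open>F\<close> is proper,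
  so the model obtained from \<open>F\<close> is elementarily equivalent to \<open>M\<close>.
  Categoricity identifies it with \<open>M\<close>, and the naming \<open>s\<close> of its elements
  by variables becomes an enumeration of \<open>M\<close>.\<close>

lemma henkin_valuation:
  fixes M :: "('f, 'r, 'a) struct" and F :: "(nat \<Rightarrow> 'a) filter"
  assumes cat: "aleph0_categorical L M"
    and nontriv: "F \<noteq> bot"
    and decide: "\<And>Q. vdef L M Q \<Longrightarrow> eventually (\<lambda>e. e \<in> Q) F \<or> eventually (\<lambda>e. e \<notin> Q) F"
    and witness: "\<And>Q i. vdef L M Q \<Longrightarrow> eventually (\<lambda>e. \<exists>a. e(i := a) \<in> Q) F \<Longrightarrow>
      \<exists>j. eventually (\<lambda>e. e(i := e j) \<in> Q) F"
    and distinct: "\<And>k. \<exists>j. eventually (\<lambda>e. \<forall>i<k. e j \<noteq> e i) F"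
  shows "\<exists>e. surj e \<and> (\<forall>Q. vdef L M Q \<longrightarrow> (e \<in> Q \<longleftrightarrow> eventually (\<lambda>e. e \<in> Q) F))"
proof -
  have "\<exists>(N :: ('f, 'r, nat) struct) s. surj s \<and>
    (\<forall>\<phi>. wf_formula L \<phi> \<longrightarrow> (sat N s \<phi> \<longleftrightarrow> eventually (\<lambda>e. sat M e \<phi>) F))"
    by (rule henkin_model) (fact assms)+
  then obtain N :: "('f, 'r, nat) struct" and s :: "nat \<Rightarrow> nat"
    where s: "surj s" "\<And>\<phi>. wf_formula L \<phi> \<Longrightarrow> sat N s \<phi> \<longleftrightarrow> eventually (\<lambda>e. sat M e \<phi>) F"
    by blast
  have "(\<forall>e. sat M e \<sigma>) \<longleftrightarrow> (\<forall>e. sat N e \<sigma>)" if "formula_in L 0 \<sigma>" for \<sigma>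
  proof -
    have wf: "wf_formula L \<sigma>" and closed: "free_vars \<sigma> = {}" using that by (auto simp: formula_in_def)
    have M: "sat M e \<sigma> \<longleftrightarrow> sat M e' \<sigma>" and N: "sat N f \<sigma> \<longleftrightarrow> sat N f' \<sigma>" for e e' f f'
      by (rule sat_cong, simp add: closed)+
    have "(\<forall>e. sat N e \<sigma>) \<longleftrightarrow> sat N s \<sigma>" using N by blast
    also have "\<dots> \<longleftrightarrow> eventually (\<lambda>e. sat M e \<sigma>) F" by (rule s(2)[OF wf])
    also have "\<dots> \<longleftrightarrow> (\<forall>e. sat M e \<sigma>)"
    proof (cases "\<forall>e. sat M e \<sigma>")
      case False
      then have "(\<lambda>e. sat M e \<sigma>) = (\<lambda>e. False)" using M by blast
      then show ?thesis using nontriv False by (simp add: eventually_False)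
    qed simp
    finally show ?thesis ..
  qed
  then have "elementarily_equiv L M N" by (simp add: elementarily_equiv_def)
  with cat obtain g where g: "isomorphism L M N g" unfolding aleph0_categorical_def by blast
  then have "bij g" by (simp add: isomorphism_def)
  define e where "e i = inv g (s i)" for i
  have ge: "(\<lambda>i. g (e i)) = s" using \<open>bij g\<close> by (simp add: e_def bij_is_surj surj_f_inv_f)
  have "surj e" using s(1) \<open>bij g\<close> unfolding e_def
    by (metis bij_inv_eq_iff surj_def)
  moreover have "e \<in> Q \<longleftrightarrow> eventually (\<lambda>e. e \<in> Q) F" if "vdef L M Q" for Q
  proof -
    obtain \<phi> where \<phi>: "wf_formula L \<phi>" "Q = {e. sat M e \<phi>}" using \<open>vdef L M Q\<close> unfolding vdef_def by blast
    show ?thesis using isomorphism_sat[OF g \<phi>(1), of e] s(2)[OF \<phi>(1)] unfolding ge \<phi>(2) by simp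
  qed
  ultimately show ?thesis by blast
qed

lemma vdef_update:
  assumes "vdef L M Q"
  shows "vdef L M {e. e(i := e j) \<in> Q}"
proof -
  have "e(i := e j) = (\<lambda>k. e ((id(i := j)) k))" for e :: "nat \<Rightarrow> 'c" by auto
  then show ?thesis using vdef_rename[OF assms, of "id(i := j)"] by simp
qed

text \<open>
  A Rasiowa--Sikorski argument: the conditions are the definable sets of valuations meeting all
  members of \<open>\<P>\<close>, and besides the countable set \<open>\<W>\<close> of dense sets of conditions the chain
  meets those that make the limit complete, Henkin and infinite.
\<close>

lemma generic_valuation:
  fixes L :: "('f, 'r) language" and M :: "('f, 'r, 'a) struct" and \<P> :: "(nat \<Rightarrow> 'a) set set" and \<W> :: "(nat \<Rightarrow> 'a) set set set"
  defines "Con \<equiv> \<lambda>Q. vdef L M Q \<and> (\<forall>R\<in>\<P>. Q \<inter> R \<noteq> {})"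
  assumes cat: "aleph0_categorical L M" and inf: "infinite (UNIV :: 'a set)"
    and P_ne: "\<P> \<noteq> {}" "\<And>R. R \<in> \<P> \<Longrightarrow> R \<noteq> {}"
    and P_directed: "\<And>R S. R \<in> \<P> \<Longrightarrow> S \<in> \<P> \<Longrightarrow> \<exists>T\<in>\<P>. T \<subseteq> R \<inter> S"
    and P_vdef: "\<And>R. R \<in> \<P> \<Longrightarrow> vdef L M R"
    and P_support: "\<And>R e e'. R \<in> \<P> \<Longrightarrow> (\<And>i. i < n \<Longrightarrow> e i = e' i) \<Longrightarrow> e \<in> R \<longleftrightarrow> e' \<in> R"
    and W: "countable \<W>" "\<And>\<Omega> Q. \<Omega> \<in> \<W> \<Longrightarrow> Con Q \<Longrightarrow> \<exists>Q'\<subseteq>Q. Con Q' \<and> Q' \<in> \<Omega>"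
  shows "\<exists>e. surj e \<and> (\<forall>R\<in>\<P>. e \<in> R) \<and> (\<forall>\<Omega>\<in>\<W>. \<exists>Q\<in>\<Omega>. e \<in> Q)"
proof -
  \<comment> \<open>\<open>dec\<close>, \<open>wit\<close> and \<open>dis\<close> collect the
    conditions that secure, respectively, the hypotheses \<open>decide\<close>,
    \<open>witness\<close> and \<open>distinct\<close> of \<open>henkin_valuation\<close>.\<close>
  define dec where "dec Q = {Q'. Q' \<subseteq> Q \<or> Q' \<subseteq> - Q}" for Q :: "(nat \<Rightarrow> 'a) set"
  define wit where "wit = (\<lambda>(Q :: (nat \<Rightarrow> 'a) set, i).
    {Q'. Q' \<subseteq> {e. \<forall>a. e(i := a) \<notin> Q} \<or> (\<exists>j. Q' \<subseteq> {e. e(i := e j) \<in> Q})})"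
  define dis where "dis k = {Q'. \<exists>j. Q' \<subseteq> {e :: nat \<Rightarrow> 'a. \<forall>i<k. e j \<noteq> e i}}" for k
  define \<V> where "\<V> = {Q. vdef L M Q}"
  define \<W>' where "\<W>' = \<W> \<union> dec ` \<V> \<union> wit ` (\<V> \<times> UNIV) \<union> range dis"
  have "countable \<V>" using cat countable_vdef unfolding \<V>_def aleph0_categorical_def by blast
  then have "countable \<W>'" using W(1) by (auto simp: \<W>'_def)
  have ConI: "Con Q" if "vdef L M Q" "\<And>R. R \<in> \<P> \<Longrightarrow> \<exists>e. e \<in> Q \<and> e \<in> R" for Q
    using that unfolding Con_def by blast
  have ConD: "\<exists>e. e \<in> Q \<and> e \<in> R" if "Con Q" "R \<in> \<P>" for Q R
    using that unfolding Con_def by blast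
  have Con_vdef: "vdef L M Q" if "Con Q" for Q using that unfolding Con_def by blast

  text \<open>By directedness, a condition can be split.\<close>
  have split: "Con (Q \<inter> A) \<or> Con (Q \<inter> - A)" if Q: "Con Q" and A: "vdef L M A" for Q A
  proof (rule disjCI)
    assume "\<not> Con (Q \<inter> - A)"
    then obtain R where R: "R \<in> \<P>" "\<And>e. e \<in> Q \<Longrightarrow> e \<in> R \<Longrightarrow> e \<in> A"
      using ConI[OF vdef_Int[OF Con_vdef[OF Q] vdef_Compl[OF A]]] by blast
    show "Con (Q \<inter> A)"
    proof (rule ConI[OF vdef_Int[OF Con_vdef[OF Q] A]])
      fix S assume "S \<in> \<P>"
      then obtain T where "T \<in> \<P>" "T \<subseteq> R \<inter> S" using P_directed R(1) by blast
      moreover from ConD[OF Q \<open>T \<in> \<P>\<close>] obtain e where "e \<in> Q" "e \<in> T" by blast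
      ultimately show "\<exists>e. e \<in> Q \<inter> A \<and> e \<in> S" using R(2) by blast
    qed
  qed
  have dense_dec: "\<exists>Q'\<subseteq>Q. Con Q' \<and> Q' \<in> dec A" if "Con Q" "A \<in> \<V>" for Q A
    using split[OF that(1), of A] that(2) unfolding dec_def \<V>_def by blast
  have dense_wit: "\<exists>Q'\<subseteq>Q. Con Q' \<and> Q' \<in> wit (A, i)" if Q: "Con Q" and A: "A \<in> \<V>" for Q A i
  proof -
    define B where "B = {e. \<exists>a. e(i := a) \<in> A}"
    have vA: "vdef L M A" using A by (simp add: \<V>_def)
    have vB: "vdef L M B" unfolding B_def by (rule vdef_Ex[OF vA])
    from split[OF Q vB] show ?thesis
    proof
      assume "Con (Q \<inter> - B)"
      moreover have "Q \<inter> - B \<in> wit (A, i)" by (auto simp: wit_def B_def)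
      ultimately show ?thesis by blast
    next
      assume QB: "Con (Q \<inter> B)"
      obtain V where V: "finite V" "\<And>e e'. (\<And>i. i \<in> V \<Longrightarrow> e i = e' i) \<Longrightarrow> e \<in> Q \<longleftrightarrow> e' \<in> Q"
        using vdef_support[OF Con_vdef[OF Q]] by blast
      obtain U where U: "finite U" "\<And>e e'. (\<And>i. i \<in> U \<Longrightarrow> e i = e' i) \<Longrightarrow> e \<in> A \<longleftrightarrow> e' \<in> A"
        using vdef_support[OF vA] by blast
      have "finite (V \<union> U \<union> {..<n} \<union> {i})" using V U by simp
      \<comment> \<open>The witness is stored at a coordinate \<open>j\<close> on which neither
        \<open>Q\<close> nor \<open>A\<close> depends, nor, as \<open>j\<close> is at least
        \<open>n\<close>, any member of \<open>\<P>\<close>.\<close>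
      from ex_new_if_finite[OF infinite_UNIV_nat this] obtain j where j: "j \<notin> V \<union> U \<union> {..<n} \<union> {i}" ..
      let ?Q = "Q \<inter> {e. e(i := e j) \<in> A}"
      have "Con ?Q"
      proof (rule ConI[OF vdef_Int[OF Con_vdef[OF Q] vdef_update[OF vA]]])
        fix R assume "R \<in> \<P>"
        from ConD[OF QB this] obtain e a where e: "e \<in> Q" "e(i := a) \<in> A" "e \<in> R" by (auto simp: B_def)
        let ?e = "e(j := a)"
        have "?e \<in> Q \<longleftrightarrow> e \<in> Q" using j by (intro V(2)) auto
        moreover have "?e \<in> R \<longleftrightarrow> e \<in> R" using j by (intro P_support[OF \<open>R \<in> \<P>\<close>]) auto
        moreover have "?e(i := ?e j) \<in> A \<longleftrightarrow> e(i := a) \<in> A" using j by (intro U(2)) auto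
        ultimately show "\<exists>e. e \<in> ?Q \<and> e \<in> R" using e by blast
      qed
      moreover have "?Q \<in> wit (A, i)" by (auto simp: wit_def)
      ultimately show ?thesis by blast
    qed
  qed
  have dense_dis: "\<exists>Q'\<subseteq>Q. Con Q' \<and> Q' \<in> dis k" if Q: "Con Q" for Q k
  proof -
    obtain V where V: "finite V" "\<And>e e'. (\<And>i. i \<in> V \<Longrightarrow> e i = e' i) \<Longrightarrow> e \<in> Q \<longleftrightarrow> e' \<in> Q"
      using vdef_support[OF Con_vdef[OF Q]] by blast
    have "finite (V \<union> {..<n} \<union> {..<k})" using V by simp
    from ex_new_if_finite[OF infinite_UNIV_nat this] obtain j where j: "j \<notin> V \<union> {..<n} \<union> {..<k}" ..
    let ?Q = "Q \<inter> (\<Inter>i\<in>{..<k}. - {e. e j = e i})"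
    have v: "vdef L M ?Q"
      by (intro vdef_Int Con_vdef[OF Q] vdef_Inter vdef_Compl vdef_eq finite_lessThan)
    have "Con ?Q"
    proof (rule ConI[OF v])
      fix R assume "R \<in> \<P>"
      from ConD[OF Q this] obtain e where e: "e \<in> Q" "e \<in> R" by blast
      \<comment> \<open>Infinity of the universe supplies a value different from the first
        \<open>k\<close>, and the fresh coordinate \<open>j\<close> can take it.\<close>
      have "finite (e ` {..<k})" by simp
      from ex_new_if_finite[OF inf this] obtain a where a: "a \<notin> e ` {..<k}" ..
      let ?e = "e(j := a)"
      have "?e \<in> Q \<longleftrightarrow> e \<in> Q" using j by (intro V(2)) auto
      moreover have "?e \<in> R \<longleftrightarrow> e \<in> R" using j by (intro P_support[OF \<open>R \<in> \<P>\<close>]) auto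
      moreover have "?e j \<noteq> ?e i" if "i < k" for i using a j that by auto
      ultimately show "\<exists>e. e \<in> ?Q \<and> e \<in> R" using e by blast
    qed
    moreover have "?Q \<in> dis k" unfolding dis_def by blast
    ultimately show ?thesis by blast
  qed
  have dense: "\<exists>Q'\<subseteq>Q. Con Q' \<and> Q' \<in> \<Omega>" if "Con Q" "\<Omega> \<in> \<W>'" for Q \<Omega>
  proof -
    from that(2) consider "\<Omega> \<in> \<W>" | A where "\<Omega> = dec A" "A \<in> \<V>"
      | A i where "\<Omega> = wit (A, i)" "A \<in> \<V>" | k where "\<Omega> = dis k"
      unfolding \<W>'_def by (elim UnE imageE SigmaE) simp_all
    then show ?thesis
    proof cases
      case 1
      then show ?thesis by (rule W(2)[OF _ that(1)])
    next
      case 2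
      then show ?thesis using dense_dec[OF that(1) 2(2)] by (simp only:)
    next
      case 3
      then show ?thesis using dense_wit[OF that(1) 3(2)] by (simp only:)
    next
      case 4
      then show ?thesis using dense_dis[OF that(1)] by (simp only:)
    qed
  qed
  have "Con UNIV" using P_ne(2) by (intro ConI vdef_UNIV) auto
  have "\<exists>q. \<forall>k. Con (q k) \<and> (q (Suc k) \<subseteq> q k \<and> q (Suc k) \<in> from_nat_into \<W>' k)"
  proof (rule dependent_nat_choice)
    show "\<exists>Q. Con Q" using \<open>Con UNIV\<close> by blast
    show "\<exists>Q'. Con Q' \<and> (Q' \<subseteq> Q \<and> Q' \<in> from_nat_into \<W>' k)" if "Con Q" for Q k
      using dense[OF that from_nat_into[of \<W>' k]] by (auto simp: \<W>'_def)
  qed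
  then obtain q where q: "\<And>k. Con (q k)" "\<And>k. q (Suc k) \<subseteq> q k" "\<And>k. q (Suc k) \<in> from_nat_into \<W>' k"
    by blast
  have q_mono: "q l \<subseteq> q k" if "k \<le> l" for k l by (rule lift_Suc_antimono_le[of q, OF q(2) that])
  have meets: "\<exists>k. q k \<in> \<Omega>" if "\<Omega> \<in> \<W>'" for \<Omega>
    using q(3) from_nat_into_surj[OF \<open>countable \<W>'\<close> that] by metis
  \<comment> \<open>The chain is decreasing, so its members form a base: an eventual property is one
    that holds on some \<open>q k\<close>.\<close>
  define F where "F = (INF k. principal (q k))"
  have ev: "eventually P F \<longleftrightarrow> (\<exists>k. \<forall>e\<in>q k. P e)" for P
  proof -
    have "eventually P F \<longleftrightarrow> (\<exists>k\<in>UNIV. eventually P (principal (q k)))"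
      unfolding F_def
    proof (rule eventually_INF_base)
      fix a b :: nat
      show "\<exists>x\<in>UNIV. principal (q x) \<le> inf (principal (q a)) (principal (q b))"
        using q_mono[of a "max a b"] q_mono[of b "max a b"] by (intro bexI[of _ "max a b"]) auto
    qed simp
    then show ?thesis by (simp add: eventually_principal)
  qed
  have q_ne: "q k \<noteq> {}" for k using ConD[OF q(1)] P_ne(1) by blast
  have "F \<noteq> bot" using q_ne unfolding eventually_False[symmetric] ev by blast
  have decF: "eventually (\<lambda>e. e \<in> Q) F \<or> eventually (\<lambda>e. e \<notin> Q) F" if "vdef L M Q" for Q
  proof -
    have "dec Q \<in> \<W>'" using that by (simp add: \<W>'_def \<V>_def)
    from meets[OF this] show ?thesis unfolding dec_def ev by blast
  qed
  have witF: "\<exists>j. eventually (\<lambda>e. e(i := e j) \<in> Q) F"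
    if Q: "vdef L M Q" and exQ: "eventually (\<lambda>e. \<exists>a. e(i := a) \<in> Q) F" for Q i
  proof -
    have "(Q, i) \<in> \<V> \<times> UNIV" using Q by (simp add: \<V>_def)
    then have "wit (Q, i) \<in> \<W>'" unfolding \<W>'_def by blast
    from meets[OF this] obtain k where "q k \<in> wit (Q, i)" by blast
    moreover have "\<not> q k \<subseteq> {e. \<forall>a. e(i := a) \<notin> Q}"
    proof
      assume k: "q k \<subseteq> {e. \<forall>a. e(i := a) \<notin> Q}"
      obtain l where l: "\<forall>e\<in>q l. \<exists>a. e(i := a) \<in> Q" using exQ unfolding ev by blast
      obtain e where "e \<in> q (max k l)" using q_ne by blast
      then have "e \<in> q k" "e \<in> q l" using q_mono[of k "max k l"] q_mono[of l "max k l"] by auto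
      then show False using k l by blast
    qed
    ultimately obtain j where "q k \<subseteq> {e. e(i := e j) \<in> Q}" by (auto simp: wit_def)
    then show ?thesis unfolding ev by blast
  qed
  have disF: "\<exists>j. eventually (\<lambda>e. \<forall>i<k. e j \<noteq> e i) F" for k
  proof -
    have "dis k \<in> \<W>'" by (simp add: \<W>'_def)
    from meets[OF this] show ?thesis unfolding dis_def ev by blast
  qed
  have "\<exists>e. surj e \<and> (\<forall>Q. vdef L M Q \<longrightarrow> (e \<in> Q \<longleftrightarrow> eventually (\<lambda>e. e \<in> Q) F))"
    by (rule henkin_valuation) (fact cat \<open>F \<noteq> bot\<close> decF witF disF)+
  then obtain e where e: "surj e" "\<And>Q. vdef L M Q \<Longrightarrow> e \<in> Q \<longleftrightarrow> eventually (\<lambda>e. e \<in> Q) F"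
    by blast
  have eq: "e \<in> q k" for k using e(2)[OF Con_vdef[OF q(1)]] ev by blast
  \<comment> \<open>The chain decides \<open>R\<close>, and a negative decision would give a
    condition disjoint from \<open>R\<close>, which is not a condition at all.\<close>
  have "e \<in> R" if R: "R \<in> \<P>" for R
  proof (rule ccontr)
    assume "e \<notin> R"
    then have "\<not> eventually (\<lambda>e. e \<in> R) F" using e(2)[OF P_vdef[OF R]] by simp
    then obtain k where "\<forall>e\<in>q k. e \<notin> R" using decF[OF P_vdef[OF R]] unfolding ev by blast
    then show False using ConD[OF q(1) R] by blast
  qed
  moreover have "\<exists>Q\<in>\<Omega>. e \<in> Q" if "\<Omega> \<in> \<W>" for \<Omega>
  proof -
    have "\<Omega> \<in> \<W>'" using that by (simp add: \<W>'_def)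
    from meets[OF this] show "\<exists>Q\<in>\<Omega>. e \<in> Q" using eq by blast
  qed
  ultimately show ?thesis using e(1) by blast
qed

section \<open>The theorem of Ryll-Nardzewski\<close>

lemma map_nth_upt: "length xs = n \<Longrightarrow> map ((!) xs) [0..<n] = xs"
  using map_nth[of xs] by simp

text \<open>The cylinders over the members of \<open>\<P>\<close> are a directed family as in
  \<open>generic_valuation\<close>, with nothing to omit. The enumeration obtained lies in all of
  them, and its first \<open>n\<close> values form a common element.\<close>

lemma defn_compactness:
  fixes M :: "('f, 'r, 'a) struct"
  assumes cat: "aleph0_categorical L M" and inf: "infinite (UNIV :: 'a set)"
    and P: "\<P> \<noteq> {}" "\<And>X. X \<in> \<P> \<Longrightarrow> defn L M n X" "\<And>X. X \<in> \<P> \<Longrightarrow> X \<noteq> {}"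
    "\<And>X Y. X \<in> \<P> \<Longrightarrow> Y \<in> \<P> \<Longrightarrow> \<exists>Z\<in>\<P>. Z \<subseteq> X \<inter> Y"
  shows "\<Inter>\<P> \<noteq> {}"
proof -
  let ?v = "\<lambda>X. {e. map e [0..<n] \<in> X}"
  have 1: "?v ` \<P> \<noteq> {}" using P(1) by simp
  have 2: "R \<noteq> {}" if R: "R \<in> ?v ` \<P>" for R
    using R
  proof
    fix X assume X: "R = ?v X" "X \<in> \<P>"
    obtain xs where xs: "xs \<in> X" using P(3) X(2) by blast
    then have "length xs = n" using definable_over_subset[OF P(2)[OF X(2)]] by (auto simp: tuples_def)
    then have "(!) xs \<in> R" using xs X(1) by (simp add: map_nth_upt)
    then show "R \<noteq> {}" by blast
  qed
  have 3: "\<exists>T\<in>?v ` \<P>. T \<subseteq> R \<inter> S" if RS: "R \<in> ?v ` \<P>" "S \<in> ?v ` \<P>" for R S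
    using RS
  proof (elim imageE)
    fix X Y assume XY: "R = ?v X" "X \<in> \<P>" "S = ?v Y" "Y \<in> \<P>"
    then obtain Z where "Z \<in> \<P>" "Z \<subseteq> X \<inter> Y" using P(4) by blast
    then have "?v Z \<in> ?v ` \<P>" "?v Z \<subseteq> R \<inter> S" using XY by auto
    then show ?thesis by blast
  qed
  have 4: "vdef L M R" if "R \<in> ?v ` \<P>" for R
    using that P(2) by (auto simp: defn_iff_vdef)
  have 5: "e \<in> R \<longleftrightarrow> e' \<in> R" if "R \<in> ?v ` \<P>" "\<And>i. i < n \<Longrightarrow> e i = e' i" for R e e'
  proof -
    have "map e [0..<n] = map e' [0..<n]" using that(2) by simp
    then show ?thesis using that(1) by (auto simp del: map_eq_conv)
  qed
  have "\<exists>e :: nat \<Rightarrow> 'a. surj e \<and> (\<forall>R\<in>?v ` \<P>. e \<in> R) \<and>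
      (\<forall>\<Omega>\<in>({} :: (nat \<Rightarrow> 'a) set set set). \<exists>Q\<in>\<Omega>. e \<in> Q)"
    by (rule generic_valuation[where L = L and M = M and n = n])
      (fact cat, fact inf, fact 1, fact 2, fact 3, fact 4, fact 5, simp, simp)
  then obtain e where "\<forall>R\<in>?v ` \<P>. e \<in> R" by (elim exE conjE) (rule that)
  then have "map e [0..<n] \<in> \<Inter>\<P>" by simp
  then show ?thesis by blast
qed

text \<open>Otherwise the type of \<open>as\<close> could be omitted.\<close>

lemma defn_atom_ex:
  fixes M :: "('f, 'r, 'a) struct"
  assumes cat: "aleph0_categorical L M" and inf: "infinite (UNIV :: 'a set)"
    and as: "as \<in> tuples n"
  shows "\<exists>X. defn L M n X \<and> as \<in> X \<and> (\<forall>Y. defn L M n Y \<longrightarrow> as \<in> Y \<longrightarrow> X \<subseteq> Y)"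
proof (rule ccontr)
  assume "\<not> ?thesis"
  then have na: "\<And>X. defn L M n X \<Longrightarrow> as \<in> X \<Longrightarrow> \<exists>Y. defn L M n Y \<and> as \<in> Y \<and> \<not> X \<subseteq> Y" by blast
  \<comment> \<open>A condition in \<open>om js\<close> keeps the tuple at the variables
    \<open>js\<close> out of some definable set containing \<open>as\<close>. An enumeration of
    \<open>M\<close> meeting all these sets would never list \<open>as\<close>, which is
    absurd.\<close>
  define om where "om js = {Q. \<exists>Y. defn L M n Y \<and> as \<in> Y \<and> (\<forall>e\<in>Q. map e js \<notin> Y)}" for js :: "nat list"
  let ?W = "om ` {js. length js = n}"
  have dense: "\<exists>Q'\<subseteq>Q. (vdef L M Q' \<and> (\<forall>R\<in>{UNIV}. Q' \<inter> R \<noteq> {})) \<and> Q' \<in> \<Omega>"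
    if \<Omega>: "\<Omega> \<in> ?W" and Q: "vdef L M Q \<and> (\<forall>R\<in>{UNIV}. Q \<inter> R \<noteq> {})" for \<Omega> Q
  proof -
    obtain js where js: "length js = n" "\<Omega> = om js" using \<Omega> by blast
    let ?X = "{map e js |e. e \<in> Q}"
    have X: "defn L M n ?X" using defn_proj[of L M Q js] Q js by simp
    \<comment> \<open>If the projection of \<open>Q\<close> contains \<open>as\<close>, it does not
      isolate it, so some \<open>Y\<close> around \<open>as\<close> leaves a part of
      \<open>Q\<close> outside. Otherwise the complement of the projection serves as
      \<open>Y\<close>, and \<open>Q\<close> need not shrink.\<close>
    show ?thesis
    proof (cases "as \<in> ?X")
      case True
      then obtain Y where Y: "defn L M n Y" "as \<in> Y" "\<not> ?X \<subseteq> Y" using na[OF X] by blast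
      let ?Q = "Q \<inter> - {e. map e js \<in> Y}"
      have "vdef L M ?Q" using Q vdef_preimage[OF Y(1) js(1)] by (blast intro: vdef_Int vdef_Compl)
      moreover have "?Q \<noteq> {}" using Y(3) by blast
      moreover have "?Q \<in> \<Omega>" unfolding js(2) om_def using Y(1,2) by blast
      ultimately show ?thesis by blast
    next
      case False
      have "Q \<in> \<Omega>" unfolding js(2) om_def
        using defn_Diff[OF X] False as by (intro CollectI exI[of _ "tuples n - ?X"]) blast
      then show ?thesis using Q by blast
    qed
  qed
  have "countable ?W" by simp
  have "\<exists>e :: nat \<Rightarrow> 'a. surj e \<and> (\<forall>R\<in>{UNIV}. e \<in> R) \<and> (\<forall>\<Omega>\<in>?W. \<exists>Q\<in>\<Omega>. e \<in> Q)"
    by (rule generic_valuation[where L = L and M = M and n = 0])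
      (fact cat, fact inf, simp, simp, simp, simp add: vdef_UNIV, simp,
       fact \<open>countable ?W\<close>, fact dense)
  then obtain e where e: "surj e" "\<forall>\<Omega>\<in>?W. \<exists>Q\<in>\<Omega>. e \<in> Q" by (elim exE conjE) (rule that)
  define js where "js = map (inv e) as"
  have "map e js = as" using e(1) by (simp add: js_def surj_f_inv_f o_def)
  moreover have "length js = n" using as by (simp add: js_def tuples_def)
  moreover from this have "\<exists>Q\<in>om js. e \<in> Q" using e(2) by simp
  ultimately show False unfolding om_def by blast
qed

text \<open>The minimal nonempty definable sets cover all tuples. If no finite number of them did,
  the complements of the finite unions would have a common element by compactness, lying in no atom.
  Each definable set is then the union of the atoms of a finite cover that it contains.\<close>

lemma finite_defn:
  fixes M :: "('f, 'r, 'a) struct"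
  assumes cat: "aleph0_categorical L M" and inf: "infinite (UNIV :: 'a set)"
  shows "finite {X. defn L M n X}"
proof -
  define At where "At = {X. defn L M n X \<and> X \<noteq> {} \<and> (\<forall>Y. defn L M n Y \<longrightarrow> X \<inter> Y = {} \<or> X \<subseteq> Y)}"
  have cover: "\<exists>X\<in>At. as \<in> X" if as: "as \<in> tuples n" for as
  proof -
    obtain X where X: "defn L M n X" "as \<in> X" "\<And>Y. defn L M n Y \<Longrightarrow> as \<in> Y \<Longrightarrow> X \<subseteq> Y"
      using defn_atom_ex[OF cat inf as] by blast
    have "X \<inter> Y = {} \<or> X \<subseteq> Y" if Y: "defn L M n Y" for Y
    proof (cases "as \<in> Y")
      case False
      then have "X \<subseteq> tuples n - Y" using X(3)[OF defn_Diff[OF Y]] as by blast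
      then show ?thesis by blast
    qed (use X(3)[OF Y] in blast)
    then show ?thesis using X(1,2) unfolding At_def by blast
  qed
  have At_defn: "defn L M n X" if "X \<in> At" for X using that by (simp add: At_def)
  have "\<exists>\<F>. finite \<F> \<and> \<F> \<subseteq> At \<and> tuples n \<subseteq> \<Union>\<F>"
  proof (rule ccontr)
    assume no: "\<not> ?thesis"
    let ?P = "{tuples n - \<Union>\<F> |\<F>. finite \<F> \<and> \<F> \<subseteq> At}"
    have "\<Inter>?P \<noteq> {}"
    proof (rule defn_compactness[OF cat inf])
      show "?P \<noteq> {}" by blast
      show "defn L M n X" if "X \<in> ?P" for X using that defn_Diff defn_Union At_defn by blast
      show "X \<noteq> {}" if "X \<in> ?P" for X using that no by blast
      show "\<exists>Z\<in>?P. Z \<subseteq> X \<inter> Y" if XY: "X \<in> ?P" "Y \<in> ?P" for X Y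
      proof -
        from XY(1) obtain F where F: "X = tuples n - \<Union>F" "finite F" "F \<subseteq> At" by blast
        from XY(2) obtain G where G: "Y = tuples n - \<Union>G" "finite G" "G \<subseteq> At" by blast
        have "finite (F \<union> G)" "F \<union> G \<subseteq> At" using F G by auto
        then have "tuples n - \<Union>(F \<union> G) \<in> ?P" by blast
        moreover have "tuples n - \<Union>(F \<union> G) \<subseteq> X \<inter> Y" using F G by blast
        ultimately show ?thesis by (rule bexI[rotated])
      qed
    qed
    then obtain as where *: "as \<in> \<Inter>?P" unfolding ex_in_conv[symmetric] ..
    have as: "as \<in> tuples n - \<Union>\<F>" if "finite \<F>" "\<F> \<subseteq> At" for \<F>
      by (rule InterD[OF *]) (use that in blast)
    then have "as \<in> tuples n" using as[of "{}"] by simp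
    then obtain X where "X \<in> At" "as \<in> X" using cover by blast
    then show False using as[of "{X}"] by simp
  qed
  then obtain \<F> where F: "finite \<F>" "\<F> \<subseteq> At" "tuples n \<subseteq> \<Union>\<F>" by blast
  have "X = \<Union>{A \<in> \<F>. A \<subseteq> X}" if X: "defn L M n X" for X
  proof
    show "X \<subseteq> \<Union>{A \<in> \<F>. A \<subseteq> X}"
    proof
      fix x assume x: "x \<in> X"
      then obtain A where A: "A \<in> \<F>" "x \<in> A" using definable_over_subset[OF X] F(3) by blast
      then have "A \<in> At" using F(2) by blast
      then have "A \<subseteq> X" using X x A(2) unfolding At_def by blast
      then show "x \<in> \<Union>{A \<in> \<F>. A \<subseteq> X}" using A by blast
    qed
  qed blast
  then have "{X. defn L M n X} \<subseteq> Union ` Pow \<F>" by blast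
  then show ?thesis using F(1) by (meson finite_Pow_iff finite_imageI finite_subset)
qed

section \<open>Types over finite sets are orbits\<close>

lemma Aut_bij: "g \<in> Aut L M \<Longrightarrow> bij g"
  by (simp add: Aut_def isomorphism_def)

lemma Aut_fun: "g \<in> Aut L M \<Longrightarrow> (f, length xs) \<in> funs L \<Longrightarrow> g (fun_int M f xs) = fun_int M f (map g xs)"
  unfolding Aut_def isomorphism_def by blast

lemma Aut_rel: "g \<in> Aut L M \<Longrightarrow> (r, length xs) \<in> rels L \<Longrightarrow> rel_int M r (map g xs) \<longleftrightarrow> rel_int M r xs"
  unfolding Aut_def isomorphism_def by blast

lemma AutI:
  assumes "bij g"
    and "\<And>f xs. (f, length xs) \<in> funs L \<Longrightarrow> g (fun_int M f xs) = fun_int M f (map g xs)"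
    and "\<And>r xs. (r, length xs) \<in> rels L \<Longrightarrow> rel_int M r (map g xs) \<longleftrightarrow> rel_int M r xs"
  shows "g \<in> Aut L M"
  using assms unfolding Aut_def isomorphism_def by blast

lemma Aut_id: "id \<in> Aut L M"
  by (rule AutI) auto

lemma Aut_comp:
  assumes "g \<in> Aut L M" "h \<in> Aut L M"
  shows "g \<circ> h \<in> Aut L M"
proof (rule AutI)
  show "bij (g \<circ> h)" using assms by (intro bij_comp) (auto intro: Aut_bij)
  show "(g \<circ> h) (fun_int M f xs) = fun_int M f (map (g \<circ> h) xs)" if "(f, length xs) \<in> funs L" for f xs
    using Aut_fun[OF assms(2) that] Aut_fun[OF assms(1), of f "map h xs"] that by simp
  show "rel_int M r (map (g \<circ> h) xs) \<longleftrightarrow> rel_int M r xs" if "(r, length xs) \<in> rels L" for r xs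
    using Aut_rel[OF assms(2) that] Aut_rel[OF assms(1), of r "map h xs"] that by simp
qed

lemma map_inv_map: "bij g \<Longrightarrow> map (inv g) (map g xs) = xs"
  by (simp add: bij_is_inj inv_f_f o_def)

lemma map_map_inv: "bij g \<Longrightarrow> map g (map (inv g) xs) = xs"
  by (simp add: bij_is_surj surj_f_inv_f o_def)

lemma Aut_inv:
  assumes "g \<in> Aut L M"
  shows "inv g \<in> Aut L M"
proof (rule AutI)
  have bij: "bij g" by (rule Aut_bij[OF assms])
  then show "bij (inv g)" by (rule bij_imp_bij_inv)
  show "inv g (fun_int M f xs) = fun_int M f (map (inv g) xs)" if "(f, length xs) \<in> funs L" for f xs
  proof -
    have "g (fun_int M f (map (inv g) xs)) = fun_int M f xs"
      using Aut_fun[OF assms, of f "map (inv g) xs"] that unfolding map_map_inv[OF bij] by simp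
    then show ?thesis using bij by (metis bij_inv_eq_iff)
  qed
  show "rel_int M r (map (inv g) xs) \<longleftrightarrow> rel_int M r xs" if "(r, length xs) \<in> rels L" for r xs
    using Aut_rel[OF assms, of r "map (inv g) xs"] that unfolding map_map_inv[OF bij] by simp
qed

lemma Aut_over_subset: "g \<in> Aut_over L M C \<Longrightarrow> g \<in> Aut L M"
  by (simp add: Aut_over_def)

lemma Aut_over_id: "id \<in> Aut_over L M C"
  by (simp add: Aut_over_def Aut_id)

lemma Aut_over_comp: "g \<in> Aut_over L M C \<Longrightarrow> h \<in> Aut_over L M C \<Longrightarrow> g \<circ> h \<in> Aut_over L M C"
  by (simp add: Aut_over_def Aut_comp)

lemma Aut_over_inv: "g \<in> Aut_over L M C \<Longrightarrow> inv g \<in> Aut_over L M C"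
  by (auto simp: Aut_over_def Aut_inv) (metis Aut_bij bij_inv_eq_iff)

lemma Aut_over_mono: "C \<subseteq> D \<Longrightarrow> g \<in> Aut_over L M D \<Longrightarrow> g \<in> Aut_over L M C"
  by (auto simp: Aut_over_def)

lemma solution_set_Aut:
  assumes g: "g \<in> Aut L M" and \<phi>: "formula_in L (n + length cs) \<phi>"
  shows "map g xs \<in> solution_set M n \<phi> (map g cs) \<longleftrightarrow> xs \<in> solution_set M n \<phi> cs"
proof (cases "length xs = n")
  case True
  have "sat M (\<lambda>i. (map g xs @ map g cs) ! i) \<phi> \<longleftrightarrow> sat M (\<lambda>i. g ((xs @ cs) ! i)) \<phi>"
    using \<phi> True by (intro sat_cong) (auto simp: formula_in_def nth_append)
  also have "\<dots> \<longleftrightarrow> sat M (\<lambda>i. (xs @ cs) ! i) \<phi>"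
    using g \<phi> by (intro isomorphism_sat[of L]) (auto simp: Aut_def formula_in_def)
  finally show ?thesis using True by (simp add: solution_set_def tuples_def)
qed (simp add: solution_set_def tuples_def)

section \<open>Equality of types and homogeneity\<close>

definition same_type :: "('f, 'r) language \<Rightarrow> ('f, 'r, 'a) struct \<Rightarrow> 'a list \<Rightarrow> 'a list \<Rightarrow> bool" where
  "same_type L M as bs \<longleftrightarrow> length as = length bs \<and>
     (\<forall>X. defn L M (length as) X \<longrightarrow> (as \<in> X \<longleftrightarrow> bs \<in> X))"

lemma same_type_sym: "same_type L M as bs \<Longrightarrow> same_type L M bs as"
  by (auto simp: same_type_def)

lemma same_type_map:
  assumes "same_type L M as bs" "set js \<subseteq> {..<length as}"
  shows "same_type L M (map ((!) as) js) (map ((!) bs) js)"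
proof -
  have "as \<in> Z \<longleftrightarrow> bs \<in> Z" if X: "defn L M (length js) X" and Z: "Z = {xs \<in> tuples (length as). map ((!) xs) js \<in> X}" for X Z
  proof -
    have "{e. map e [0..<length as] \<in> Z} = {e. map e js \<in> X}"
    proof -
      have "map ((!) (map e [0..<length as])) js = map e js" for e :: "nat \<Rightarrow> 'c"
        using assms(2) by auto
      then show ?thesis by (simp add: Z tuples_def del: map_eq_conv)
    qed
    then have "defn L M (length as) Z" unfolding defn_iff_vdef
      using vdef_preimage[OF X refl] by (auto simp: Z)
    then show ?thesis using assms(1) by (simp add: same_type_def)
  qed
  then show ?thesis using assms(1) by (auto simp: same_type_def tuples_def)
qed

text \<open>\<open>Q\<close> depends on finitely many coordinates, so membership can be read off a
  long enough initial segment, and the set of such segments is a definable set of tuples.\<close>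

lemma same_type_vdef:
  assumes "\<And>m. same_type L M (map \<alpha> [0..<m]) (map \<beta> [0..<m])" "vdef L M Q" "\<alpha> \<in> Q"
  shows "\<beta> \<in> Q"
proof -
  obtain V where V: "finite V" "\<And>e e'. (\<And>i. i \<in> V \<Longrightarrow> e i = e' i) \<Longrightarrow> e \<in> Q \<longleftrightarrow> e' \<in> Q"
    using vdef_support[OF assms(2)] by blast
  obtain m where m: "\<forall>i\<in>V. i < m" using V(1) finite_nat_set_iff_bounded by blast
  have "map \<alpha> [0..<m] \<in> {map e [0..<m] |e. e \<in> Q}" using assms(3) by blast
  then have "map \<beta> [0..<m] \<in> {map e [0..<m] |e. e \<in> Q}"
    using assms(1)[of m] defn_proj0[OF assms(2), of m] unfolding same_type_def length_map length_upt diff_zero by blast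
  then obtain e where e: "map \<beta> [0..<m] = map e [0..<m]" "e \<in> Q" by blast
  have "\<beta> \<in> Q \<longleftrightarrow> e \<in> Q" using e(1) m by (intro V(2)) auto
  then show ?thesis using e(2) by blast
qed

text \<open>Sending \<open>\<alpha> i\<close> to \<open>\<beta> i\<close> is well defined and
  injective since equality of two coordinates is a definable condition; graphs of functions and
  relations transfer likewise. Surjectivity of \<open>\<alpha>\<close> makes the map total, that of
  \<open>\<beta>\<close> makes it onto.\<close>

lemma same_type_surj_Aut:
  assumes "surj \<alpha>" "surj \<beta>" "\<And>m. same_type L M (map \<alpha> [0..<m]) (map \<beta> [0..<m])"
  shows "\<exists>g\<in>Aut L M. \<forall>i. g (\<alpha> i) = \<beta> i"
proof -
  have *: "\<alpha> \<in> Q \<longleftrightarrow> \<beta> \<in> Q" if "vdef L M Q" for Q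
    using same_type_vdef[OF assms(3) that] same_type_vdef[OF same_type_sym[OF assms(3)] that] by blast
  have eq: "\<alpha> i = \<alpha> j \<longleftrightarrow> \<beta> i = \<beta> j" for i j using *[OF vdef_eq[of L M i j]] by simp
  define g where "g a = \<beta> (inv \<alpha> a)" for a
  have g: "g (\<alpha> i) = \<beta> i" for i
    using eq[of "inv \<alpha> (\<alpha> i)" i] assms(1) by (simp add: g_def surj_f_inv_f)
  have "bij g"
  proof (rule bijI)
    show "inj g" using assms(1) eq g by (metis injI surjD)
    show "surj g" unfolding surj_def using g assms(2) by (metis surjD)
  qed
  moreover have "g (fun_int M f xs) = fun_int M f (map g xs)" if "(f, length xs) \<in> funs L" for f xs
  proof -
    define js where "js = map (inv \<alpha>) xs"
    have js: "map \<alpha> js = xs" using assms(1) by (simp add: js_def surj_f_inv_f o_def)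
    then have js': "map \<beta> js = map g xs" using g by auto
    obtain j where j: "fun_int M f xs = \<alpha> j" using assms(1) by (metis surjD)
    have "vdef L M {e. sat M e (Eq (Var j) (Fun f (map Var js)))}"
      using that by (intro vdefI) (auto simp: js_def list_all_iff)
    from *[OF this] have "\<alpha> j = fun_int M f (map \<alpha> js) \<longleftrightarrow> \<beta> j = fun_int M f (map \<beta> js)"
      by (simp add: o_def)
    then show ?thesis using js js' j g by simp
  qed
  moreover have "rel_int M r (map g xs) \<longleftrightarrow> rel_int M r xs" if "(r, length xs) \<in> rels L" for r xs
  proof -
    define js where "js = map (inv \<alpha>) xs"
    have js: "map \<alpha> js = xs" using assms(1) by (simp add: js_def surj_f_inv_f o_def)
    then have js': "map \<beta> js = map g xs" using g by auto
    have "vdef L M {e. sat M e (Rel r (map Var js))}"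
      using that by (intro vdefI) (auto simp: js_def)
    from *[OF this] have "rel_int M r (map \<alpha> js) \<longleftrightarrow> rel_int M r (map \<beta> js)"
      by (simp add: o_def)
    then show ?thesis using js js' by simp
  qed
  ultimately have "g \<in> Aut L M" by (rule AutI)
  then show ?thesis using g by blast
qed

section \<open>Definability as invariance under automorphisms\<close>

definition invariant :: "('f, 'r) language \<Rightarrow> ('f, 'r, 'a) struct \<Rightarrow> 'a set \<Rightarrow> nat \<Rightarrow> 'a list set \<Rightarrow> bool" where
  "invariant L M C n X \<longleftrightarrow> X \<subseteq> tuples n \<and> (\<forall>g\<in>Aut_over L M C. \<forall>xs\<in>X. map g xs \<in> X)"

lemma definable_over_invariant:
  assumes "definable_over L M C n X"
  shows "invariant L M C n X"
proof -
  obtain \<phi> cs where \<phi>: "set cs \<subseteq> C" "formula_in L (n + length cs) \<phi>" "X = solution_set M n \<phi> cs"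
    using assms unfolding definable_over_def by blast
  have "map g xs \<in> X" if "g \<in> Aut_over L M C" "xs \<in> X" for g xs
  proof -
    have "map g cs = cs" using that(1) \<phi>(1) by (intro map_idI) (auto simp: Aut_over_def)
    then show ?thesis using solution_set_Aut[OF Aut_over_subset[OF that(1)] \<phi>(2), of xs] that(2) \<phi>(3) by simp
  qed
  then show ?thesis using definable_over_subset[OF assms] by (simp add: invariant_def)
qed

lemma definable_over_mono: "definable_over L M C n X \<Longrightarrow> C \<subseteq> D \<Longrightarrow> definable_over L M D n X"
  unfolding definable_over_def by blast

lemma definable_over_finite:
  assumes "definable_over L M C n X"
  obtains D where "finite D" "D \<subseteq> C" "definable_over L M D n X"
  using assms unfolding definable_over_def by (metis List.finite_set order_refl)

locale omega_categorical =
  fixes L :: "('f, 'r) language" and M :: "('f, 'r, 'a) struct"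
  assumes categorical: "aleph0_categorical L M"
    and infinite_universe: "infinite (UNIV :: 'a set)"
    and countable_universe: "countable (UNIV :: 'a set)"
begin

lemma atom:
  assumes "length as = n"
  obtains A where "defn L M n A" "as \<in> A" "\<And>bs. bs \<in> A \<Longrightarrow> same_type L M as bs"
proof -
  have as: "as \<in> tuples n" using assms by (simp add: tuples_def)
  obtain A where A: "defn L M n A" "as \<in> A" "\<forall>Y. defn L M n Y \<longrightarrow> as \<in> Y \<longrightarrow> A \<subseteq> Y"
    using defn_atom_ex[OF categorical infinite_universe as] by blast
  have "same_type L M as bs" if bs: "bs \<in> A" for bs
  proof -
    have "as \<in> X \<longleftrightarrow> bs \<in> X" if X: "defn L M n X" for X
    proof (cases "as \<in> X")
      case False
      then have "A \<subseteq> tuples n - X" using A(3) defn_Diff[OF X] as by blast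
      then show ?thesis using bs False by blast
    qed (use A(3) X bs in blast)
    moreover have "length bs = n" using definable_over_subset[OF A(1)] bs by (auto simp: tuples_def)
    ultimately show ?thesis using assms by (simp add: same_type_def)
  qed
  then show thesis using that A(1,2) by blast
qed

text \<open>Quantifying the last coordinate out of an atom around \<open>as @ [c]\<close> gives a
  definable set containing \<open>as\<close>, hence \<open>bs\<close>, and this yields
  \<open>d\<close>. One quantifier suffices because a single definable set isolates the
  type.\<close>

lemma same_type_extend:
  assumes "same_type L M as bs"
  shows "\<exists>d. same_type L M (as @ [c]) (bs @ [d])"
proof -
  define n where "n = length as"
  have "length (as @ [c]) = Suc n" by (simp add: n_def)
  then obtain A where A: "defn L M (Suc n) A" "as @ [c] \<in> A" "\<And>bs. bs \<in> A \<Longrightarrow> same_type L M (as @ [c]) bs"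
    using atom by blast
  let ?Q = "{e. map e [0..<Suc n] \<in> A}"
  let ?X = "{map e [0..<n] |e. e \<in> ?Q}"
  have "defn L M n ?X" by (intro defn_proj0 vdef_preimage[OF A(1)]) simp
  moreover have "as \<in> ?X"
  proof -
    let ?e = "(!) (as @ [c])"
    have "map ?e [0..<Suc n] = as @ [c]" by (rule map_nth_upt) (simp add: n_def)
    moreover have "map ?e [0..<n] = as" by (auto simp: n_def nth_append intro: nth_equalityI)
    ultimately have "?e \<in> ?Q" "as = map ?e [0..<n]" using A(2) by (simp_all only: mem_Collect_eq)
    then show ?thesis by blast
  qed
  ultimately have "bs \<in> ?X" using assms unfolding same_type_def n_def by blast
  then obtain e where e: "bs = map e [0..<n]" "map e [0..<Suc n] \<in> A" by blast
  then have "bs @ [e n] \<in> A" by simp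
  then show ?thesis using A(3) by blast
qed

text \<open>Back and forth: stage \<open>k\<close> appends the \<open>k\<close>-th element of the
  universe to either tuple, each time with a partner on the other side. In the limit both sequences
  enumerate \<open>M\<close>, with equal types on all initial segments.\<close>

lemma same_type_imp_Aut:
  assumes "same_type L M as bs"
  shows "\<exists>g\<in>Aut L M. map g as = bs"
proof -
  define n where "n = length as"
  let ?c = "from_nat_into (UNIV :: 'a set)"
  have "\<exists>p. \<forall>k. (same_type L M (fst (p k)) (snd (p k)) \<and> (k = 0 \<longrightarrow> p k = (as, bs))) \<and>
    (\<exists>x y. p (Suc k) = (fst (p k) @ [?c k, x], snd (p k) @ [y, ?c k]))"
  proof (rule dependent_nat_choice)
    show "\<exists>p. same_type L M (fst p) (snd p) \<and> (0 = (0::nat) \<longrightarrow> p = (as, bs))" using assms by auto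
  next
    fix p and k :: nat
    assume p: "same_type L M (fst p) (snd p) \<and> (k = 0 \<longrightarrow> p = (as, bs))"
    obtain y where "same_type L M (fst p @ [?c k]) (snd p @ [y])" using same_type_extend p by blast
    from same_type_extend[OF same_type_sym[OF this]]
    obtain x where "same_type L M ((snd p @ [y]) @ [?c k]) ((fst p @ [?c k]) @ [x])" by blast
    then have "same_type L M (fst p @ [?c k, x]) (snd p @ [y, ?c k])" using same_type_sym by fastforce
    then show "\<exists>p'. (same_type L M (fst p') (snd p') \<and> (Suc k = 0 \<longrightarrow> p' = (as, bs))) \<and>
        (\<exists>x y. p' = (fst p @ [?c k, x], snd p @ [y, ?c k]))"
      by (intro exI[of _ "(fst p @ [?c k, x], snd p @ [y, ?c k])"]) auto
  qed
  then obtain p where p: "\<And>k. same_type L M (fst (p k)) (snd (p k))" "p 0 = (as, bs)"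
    "\<And>k. \<exists>x y. p (Suc k) = (fst (p k) @ [?c k, x], snd (p k) @ [y, ?c k])" by blast
  have len: "length (fst (p k)) = n + 2 * k \<and> length (snd (p k)) = n + 2 * k" for k
  proof (induction k)
    case 0
    then show ?case using p(2) assms by (simp add: n_def same_type_def)
  next
    case (Suc k)
    then show ?case using p(3)[of k] by auto
  qed
  have stable: "fst (p (k + l)) ! i = fst (p k) ! i \<and> snd (p (k + l)) ! i = snd (p k) ! i"
    if "i < n + 2 * k" for i k l
  proof (induction l)
    case (Suc l)
    obtain x y where "p (Suc (k + l)) = (fst (p (k + l)) @ [?c (k + l), x], snd (p (k + l)) @ [y, ?c (k + l)])"
      using p(3) by blast
    then show ?case using Suc that len[of "k + l"] by (simp add: nth_append)
  qed simp
  \<comment> \<open>Stage \<open>k\<close> has length \<open>n + 2 * k\<close>. For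
    \<open>n = 0\<close> stage \<open>0\<close> does not yet have a position \<open>0\<close>, so
    position \<open>i\<close> is read at stage \<open>Suc i\<close>.\<close>
  define \<alpha> where "\<alpha> i = fst (p (Suc i)) ! i" for i
  define \<beta> where "\<beta> i = snd (p (Suc i)) ! i" for i
  have nth: "fst (p k) ! i = \<alpha> i \<and> snd (p k) ! i = \<beta> i" if "i < n + 2 * k" for i k
  proof (cases "k \<le> Suc i")
    case True
    then show ?thesis using stable[OF that, of "Suc i - k"] by (simp add: \<alpha>_def \<beta>_def)
  next
    case False
    then show ?thesis using stable[of i "Suc i" "k - Suc i"] by (simp add: \<alpha>_def \<beta>_def)
  qed
  have "a \<in> range \<alpha> \<and> a \<in> range \<beta>" for a
  proof -
    obtain k where k: "?c k = a"
      using from_nat_into_surj[OF countable_universe UNIV_I] by blast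
    obtain x y where xy: "p (Suc k) = (fst (p k) @ [?c k, x], snd (p k) @ [y, ?c k])"
      using p(3) by blast
    \<comment> \<open>Of the two positions added at stage \<open>k\<close>, the first holds
      \<open>?c k\<close> on the left and the second holds it on the right.\<close>
    have "a = \<alpha> (n + 2 * k)" using nth[of "n + 2 * k" "Suc k"] xy k len[of k] by (simp add: nth_append)
    moreover have "a = \<beta> (Suc (n + 2 * k))"
      using nth[of "Suc (n + 2 * k)" "Suc k"] xy k len[of k] by (simp add: nth_append)
    ultimately show ?thesis by blast
  qed
  then have "surj \<alpha>" "surj \<beta>" by blast+
  moreover have "same_type L M (map \<alpha> [0..<m]) (map \<beta> [0..<m])" for m
  proof -
    have "map ((!) (fst (p m))) [0..<m] = map \<alpha> [0..<m]" "map ((!) (snd (p m))) [0..<m] = map \<beta> [0..<m]"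
      using nth[of _ m] by auto
    moreover have "set [0..<m] \<subseteq> {..<length (fst (p m))}" using len[of m] by auto
    ultimately show ?thesis using same_type_map[OF p(1)[of m], of "[0..<m]"] by (simp only:)
  qed
  ultimately obtain g where g: "g \<in> Aut L M" "\<And>i. g (\<alpha> i) = \<beta> i"
    using same_type_surj_Aut by blast
  have "as ! i = \<alpha> i \<and> bs ! i = \<beta> i" if "i < n" for i using nth[of i 0] that p(2) by simp
  moreover have "length bs = n" using assms by (simp add: same_type_def n_def)
  ultimately have "map g as = bs" using g(2) by (auto intro!: nth_equalityI simp: n_def)
  then show ?thesis using g(1) by blast
qed

text \<open>By homogeneity an invariant set contains a whole atom around each of its points. The
  union of these is a finite one, as there are only finitely many definable sets.\<close>

lemma invariant_defn:
  assumes "invariant L M {} n X"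
  shows "defn L M n X"
proof -
  let ?F = "{A. defn L M n A \<and> A \<subseteq> X}"
  have "\<exists>A\<in>?F. xs \<in> A" if "xs \<in> X" for xs
  proof -
    have "length xs = n" using assms that by (auto simp: invariant_def tuples_def)
    then obtain A where A: "defn L M n A" "xs \<in> A" "\<And>ys. ys \<in> A \<Longrightarrow> same_type L M xs ys"
      using atom by blast
    have "ys \<in> X" if "ys \<in> A" for ys
    proof -
      obtain g where "g \<in> Aut L M" "map g xs = ys" using same_type_imp_Aut A(3) \<open>ys \<in> A\<close> by blast
      then show ?thesis using assms \<open>xs \<in> X\<close> by (auto simp: invariant_def Aut_over_def)
    qed
    then show ?thesis using A by blast
  qed
  then have "X = \<Union>?F" by blast
  moreover have "finite ?F"
    by (rule finite_subset[OF _ finite_defn[OF categorical infinite_universe, of n]]) blast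
  then have "defn L M n (\<Union>?F)" by (rule defn_Union) blast
  ultimately show ?thesis by simp
qed

text \<open>Parameters become coordinates: \<open>X'\<close> collects the images of all
  \<open>xs @ cs\<close>, which is invariant without parameters. An automorphism that brings such a
  tuple back over \<open>cs\<close> fixes \<open>cs\<close> pointwise, so the fibre over
  \<open>cs\<close> is no larger than \<open>X\<close>.\<close>

lemma invariant_fibre:
  assumes "set cs = C" "invariant L M C n X"
  shows "\<exists>X'. defn L M (n + length cs) X' \<and> X = {xs \<in> tuples n. xs @ cs \<in> X'}"
proof -
  define X' where "X' = {map g (xs @ cs) |g xs. g \<in> Aut L M \<and> xs \<in> X}"
  have "invariant L M {} (n + length cs) X'"
  proof -
    have "map h (map g (xs @ cs)) \<in> X'" if "h \<in> Aut L M" "g \<in> Aut L M" "xs \<in> X" for h g xs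
      unfolding X'_def map_map using Aut_comp[OF that(1,2)] that(3) by blast
    moreover have "X' \<subseteq> tuples (n + length cs)"
      using assms(2) by (auto simp: X'_def invariant_def tuples_def)
    ultimately show ?thesis unfolding invariant_def using Aut_over_subset
      unfolding X'_def by blast
  qed
  then have "defn L M (n + length cs) X'" by (rule invariant_defn)
  moreover have "X = {xs \<in> tuples n. xs @ cs \<in> X'}"
  proof (intro set_eqI iffI)
    fix xs assume xs: "xs \<in> X"
    have "xs @ cs = map id (xs @ cs)" by simp
    then have "xs @ cs \<in> X'" unfolding X'_def using Aut_id xs by blast
    then show "xs \<in> {xs \<in> tuples n. xs @ cs \<in> X'}" using xs assms(2) by (auto simp: invariant_def)
  next
    fix xs assume "xs \<in> {xs \<in> tuples n. xs @ cs \<in> X'}"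
    then obtain g ys where g: "length xs = n" "g \<in> Aut L M" "ys \<in> X" "xs @ cs = map g (ys @ cs)"
      by (auto simp: X'_def tuples_def)
    have "length ys = n" using g(3) assms(2) by (auto simp: invariant_def tuples_def)
    then have eq: "xs = map g ys" "cs = map g cs" using g(1,4) by auto
    have "\<forall>c\<in>set cs. g c = c" using eq(2) by (metis map_eq_conv list.map_id0 id_apply list.map_id)
    then have "g \<in> Aut_over L M C" using g(2) assms(1) by (simp add: Aut_over_def)
    then show "xs \<in> X" using assms(2) g(3) eq(1) by (simp add: invariant_def)
  qed
  ultimately show ?thesis by blast
qed

lemma definable_iff_invariant:
  assumes "finite C"
  shows "definable_over L M C n X \<longleftrightarrow> invariant L M C n X"
proof
  assume X: "invariant L M C n X"
  obtain cs where cs: "set cs = C" using finite_list[OF assms] by blast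
  obtain X' where X': "defn L M (n + length cs) X'" "X = {xs \<in> tuples n. xs @ cs \<in> X'}"
    using invariant_fibre[OF cs X] by blast
  obtain \<phi> where \<phi>: "formula_in L (n + length cs) \<phi>" "X' = solution_set M (n + length cs) \<phi> []"
    using X'(1) unfolding defn_iff by blast
  have "X = solution_set M n \<phi> cs"
    unfolding X'(2) \<phi>(2) by (auto simp: solution_set_def tuples_def)
  then show "definable_over L M C n X" using \<phi>(1) cs unfolding definable_over_def by blast
qed (rule definable_over_invariant)

text \<open>For a fixed list \<open>cs\<close> of the elements of \<open>C\<close>, each of these
  sets is the fibre over \<open>cs\<close> of one of finitely many parameter-free definable
  sets.\<close>

lemma finite_invariant:
  assumes "finite C"
  shows "finite {X. invariant L M C n X}"
proof -
  obtain cs where cs: "set cs = C" using finite_list[OF assms] by blast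
  have "{X. invariant L M C n X} \<subseteq> (\<lambda>X'. {xs \<in> tuples n. xs @ cs \<in> X'}) ` {X'. defn L M (n + length cs) X'}"
    using invariant_fibre[OF cs] by blast
  then show ?thesis
    using finite_defn[OF categorical infinite_universe, of "n + length cs"] by (meson finite_imageI finite_subset)
qed

text \<open>Automorphisms over \<open>C\<close> preserve formulas over \<open>C\<close>. Conversely
  the orbit is invariant, hence itself defined by a formula over \<open>C\<close>, and this formula
  belongs to the type.\<close>

lemma tp_eq_orbit:
  assumes "finite C"
  shows "tp L M as C = {map g as |g. g \<in> Aut_over L M C}"
proof (intro set_eqI iffI)
  fix xs assume "xs \<in> {map g as |g. g \<in> Aut_over L M C}"
  then obtain g where g: "g \<in> Aut_over L M C" "xs = map g as" by blast
  have "xs \<in> solution_set M (length as) \<phi> cs"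
    if "set cs \<subseteq> C" "formula_in L (length as + length cs) \<phi>" "as \<in> solution_set M (length as) \<phi> cs" for \<phi> cs
  proof -
    have "definable_over L M C (length as) (solution_set M (length as) \<phi> cs)"
      using that unfolding definable_over_def by blast
    from definable_over_invariant[OF this] show ?thesis using g that(3) by (simp add: invariant_def)
  qed
  then show "xs \<in> tp L M as C" using g(2) by (auto simp: tp_def complete_type_def tuples_def)
next
  fix xs assume xs: "xs \<in> tp L M as C"
  let ?O = "{map g as |g. g \<in> Aut_over L M C}"
  have "map h (map g as) \<in> ?O" if "h \<in> Aut_over L M C" "g \<in> Aut_over L M C" for h g
    unfolding map_map using Aut_over_comp[OF that] by blast
  then have "invariant L M C (length as) ?O" by (auto simp: invariant_def tuples_def simp del: map_map)
  then have "definable_over L M C (length as) ?O" using definable_iff_invariant[OF assms] by blast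
  then obtain \<phi> cs where \<phi>: "set cs \<subseteq> C" "formula_in L (length as + length cs) \<phi>" "?O = solution_set M (length as) \<phi> cs"
    unfolding definable_over_def by blast
  have "as = map id as" by simp
  then have "as \<in> ?O" using Aut_over_id by blast
  then have "(\<phi>, cs) \<in> complete_type L M as C" using \<phi> by (auto simp: complete_type_def)
  then show "xs \<in> ?O" using xs unfolding tp_def \<phi>(3) by blast
qed

lemma mem_tp_iff: "finite C \<Longrightarrow> xs \<in> tp L M as C \<longleftrightarrow> (\<exists>g\<in>Aut_over L M C. xs = map g as)"
  by (auto simp: tp_eq_orbit)

lemma tpI: "finite C \<Longrightarrow> g \<in> Aut_over L M C \<Longrightarrow> map g as \<in> tp L M as C"
  unfolding mem_tp_iff by blast

lemma tpE:
  assumes "xs \<in> tp L M as C" "finite C"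
  obtains g where "g \<in> Aut_over L M C" "xs = map g as"
  using assms(1) unfolding mem_tp_iff[OF assms(2)] by blast

lemma mem_tp_self: "finite C \<Longrightarrow> as \<in> tp L M as C"
  unfolding mem_tp_iff by (rule bexI[OF _ Aut_over_id]) simp

lemma tp_eq:
  assumes "finite C" "bs \<in> tp L M as C"
  shows "tp L M bs C = tp L M as C"
proof -
  obtain g where g: "g \<in> Aut_over L M C" "bs = map g as" using assms(2,1) by (rule tpE)
  have as: "as = map (inv g) bs" using g Aut_bij[OF Aut_over_subset[OF g(1)]] by (simp only: map_inv_map)
  have "map h bs \<in> tp L M as C" if "h \<in> Aut_over L M C" for h
    using tpI[OF assms(1) Aut_over_comp[OF that g(1)], of as] by (simp add: g(2))
  moreover have "map h as \<in> tp L M bs C" if "h \<in> Aut_over L M C" for h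
    using tpI[OF assms(1) Aut_over_comp[OF that Aut_over_inv[OF g(1)]], of bs] by (subst as) simp
  ultimately show ?thesis by (auto elim!: tpE[OF _ assms(1)])
qed

lemma tp_invariant:
  assumes "finite C"
  shows "invariant L M C (length as) (tp L M as C)"
  unfolding invariant_def
proof (intro conjI ballI)
  show "tp L M as C \<subseteq> tuples (length as)" by (auto simp: tp_def)
  show "map g xs \<in> tp L M as C" if "g \<in> Aut_over L M C" "xs \<in> tp L M as C" for g xs
    using tpI[OF assms that(1), of xs] tp_eq[OF assms that(2)] by simp
qed

lemma tp_subset: "invariant L M C n X \<Longrightarrow> finite C \<Longrightarrow> as \<in> X \<Longrightarrow> tp L M as C \<subseteq> X"
  by (auto simp: invariant_def mem_tp_iff)

text \<open>Conjugation by \<open>g\<close> carries the stabiliser of \<open>C\<close> into that of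
  its image. The reverse inclusion is the same one for \<open>inv g\<close>.\<close>

lemma tp_image:
  assumes "g \<in> Aut L M" "finite C"
  shows "tp L M (map g as) (g ` C) = map g ` tp L M as C"
proof -
  have bij: "bij g" by (rule Aut_bij[OF assms(1)])
  have sub: "map g ` tp L M as C \<subseteq> tp L M (map g as) (g ` C)" if g: "g \<in> Aut L M" "finite C" for g as C
  proof
    fix xs assume "xs \<in> map g ` tp L M as C"
    then obtain ys where ys: "xs = map g ys" "ys \<in> tp L M as C" by blast
    from ys(2) g(2) obtain h where h: "h \<in> Aut_over L M C" "ys = map h as" by (rule tpE)
    have bij: "bij g" by (rule Aut_bij[OF g(1)])
    then have inv: "inv g (g x) = x" for x by (simp add: bij_is_inj inv_f_f)
    have "g \<circ> h \<circ> inv g \<in> Aut L M" by (intro Aut_comp g(1) Aut_inv Aut_over_subset[OF h(1)])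
    then have conj: "g \<circ> h \<circ> inv g \<in> Aut_over L M (g ` C)" using h(1) inv by (auto simp: Aut_over_def)
    from tpI[OF finite_imageI[OF g(2)] conj]
    have "map (g \<circ> h \<circ> inv g) (map g as) \<in> tp L M (map g as) (g ` C)" .
    moreover have "xs = map (g \<circ> h \<circ> inv g) (map g as)" using ys h(2) inv by simp
    ultimately show "xs \<in> tp L M (map g as) (g ` C)" by simp
  qed
  have "tp L M (map g as) (g ` C) \<subseteq> map g ` tp L M as C"
  proof
    fix xs assume "xs \<in> tp L M (map g as) (g ` C)"
    then have "map (inv g) xs \<in> tp L M (map (inv g) (map g as)) (inv g ` g ` C)"
      using sub[OF Aut_inv[OF assms(1)], of "g ` C" "map g as"] assms(2) by blast
    moreover have "inv g ` g ` C = C" using bij by (simp add: bij_is_inj image_inv_f_f)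
    ultimately have "map (inv g) xs \<in> tp L M as C" unfolding map_inv_map[OF bij] by simp
    then show "xs \<in> map g ` tp L M as C" using map_map_inv[OF bij, of xs] by (metis imageI)
  qed
  then show ?thesis using sub[OF assms] by blast
qed

text \<open>Each coordinate can move only within a finite invariant set, which leaves finitely many
  tuples of the given length.\<close>

lemma finite_tp_acl:
  assumes "finite C" "set as \<subseteq> acl L M C"
  shows "finite (tp L M as C)"
proof -
  have "\<exists>X. invariant L M C 1 X \<and> finite X \<and> [a] \<in> X" if "a \<in> set as" for a
    using assms(2) that definable_over_invariant[of L M C 1] by (auto simp: acl_def)
  then obtain X where X: "\<And>a. a \<in> set as \<Longrightarrow> invariant L M C 1 (X a) \<and> finite (X a) \<and> [a] \<in> X a" by metis
  let ?B = "\<Union>a\<in>set as. hd ` X a"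
  have "finite ?B" using X by blast
  moreover have "tp L M as C \<subseteq> {xs. set xs \<subseteq> ?B \<and> length xs = length as}"
  proof
    fix xs assume "xs \<in> tp L M as C"
    from this assms(1) obtain g where g: "g \<in> Aut_over L M C" "xs = map g as" by (rule tpE)
    have "g a \<in> ?B" if "a \<in> set as" for a
    proof -
      have "map g [a] \<in> X a" using X[OF that] g(1) unfolding invariant_def by blast
      then have "hd (map g [a]) \<in> hd ` X a" by (rule imageI)
      then show ?thesis using that by auto
    qed
    then show "xs \<in> {xs. set xs \<subseteq> ?B \<and> length xs = length as}" using g(2) by auto
  qed
  ultimately show ?thesis using finite_lists_length_eq[of ?B] by (meson finite_subset)
qed

text \<open>The entries of all tuples in \<open>X\<close> form one finite invariant set, which
  witnesses algebraicity for each of them.\<close>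

lemma finite_invariant_acl:
  assumes "finite C" "invariant L M C n X" "finite X" "as \<in> X"
  shows "set as \<subseteq> acl L M C"
proof
  fix a assume a: "a \<in> set as"
  let ?X = "(\<lambda>b. [b]) ` (\<Union>xs\<in>X. set xs)"
  have "invariant L M C 1 ?X"
    unfolding invariant_def
  proof (intro conjI ballI)
    show "?X \<subseteq> tuples 1" by (auto simp: tuples_def)
    fix g ys assume g: "g \<in> Aut_over L M C" and "ys \<in> ?X"
    then obtain xs b where "ys = [b]" "xs \<in> X" "b \<in> set xs" by blast
    moreover have "map g xs \<in> X" using assms(2) g \<open>xs \<in> X\<close> by (simp add: invariant_def)
    ultimately show "map g ys \<in> ?X" by force
  qed
  then have "definable_over L M C 1 ?X" using definable_iff_invariant[OF assms(1)] by blast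
  moreover have "finite ?X" "[a] \<in> ?X" using a assms(3,4) by auto
  ultimately show "a \<in> acl L M C" unfolding acl_def by blast
qed

lemma dcl_iff:
  assumes "finite C"
  shows "a \<in> dcl L M C \<longleftrightarrow> (\<forall>g\<in>Aut_over L M C. g a = a)"
  unfolding dcl_def mem_Collect_eq definable_iff_invariant[OF assms]
  by (auto simp: invariant_def tuples_def)

end

section \<open>Sums of values of \<open>h\<close>\<close>

text \<open>
  Addition of values keeps the contributions of maximal dimension; with it both (cMS2) and (MS4)
  become plain summation formulas in a commutative monoid.
\<close>

definition gadd :: "nat \<times> real \<Rightarrow> nat \<times> real \<Rightarrow> nat \<times> real" where
  "gadd p q = (if fst p < fst q then q else if fst q < fst p then p else (fst p, snd p + snd q))"

text \<open>The value that (MS4) prescribes for a set whose fibres all have value \<open>p\<close>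
  over a base of value \<open>q\<close>.\<close>

definition gmul :: "nat \<times> real \<Rightarrow> nat \<times> real \<Rightarrow> nat \<times> real" where
  "gmul p q = (fst p + fst q, snd p * snd q)"

global_interpretation gsum: comm_monoid_set gadd "(0, 0)"
  defines gsum = gsum.F
  by unfold_locales (auto simp: gadd_def prod_eq_iff)

lemma gmul_commute: "gmul p q = gmul q p"
  by (simp add: gmul_def)

lemma gmul_gadd_distrib: "gmul p (gadd q r) = gadd (gmul p q) (gmul p r)"
  by (simp add: gmul_def gadd_def algebra_simps)

text \<open>This fails for empty \<open>A\<close>, as \<open>gmul p (0, 0)\<close> has the dimension of \<open>p\<close>.\<close>

lemma gsum_distrib_left:
  assumes "finite A" "A \<noteq> {}"
  shows "gsum (\<lambda>i. gmul p (v i)) A = gmul p (gsum v A)"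
  using assms by (induction A rule: finite_ne_induct) (simp_all add: gmul_gadd_distrib)

text \<open>A further value replaces the sum, is absorbed by it or adds to its measure, according to
  whether its dimension exceeds, falls below or equals the current maximum.\<close>

lemma gsum_fst_snd:
  assumes "finite A" "A \<noteq> {}"
  shows "fst (gsum v A) = Max ((\<lambda>i. fst (v i)) ` A)"
    and "snd (gsum v A) = (\<Sum>i | i \<in> A \<and> fst (v i) = fst (gsum v A). snd (v i))"
proof -
  have "fst (gsum v A) = Max ((\<lambda>i. fst (v i)) ` A) \<and>
    snd (gsum v A) = (\<Sum>i | i \<in> A \<and> fst (v i) = fst (gsum v A). snd (v i))"
    using assms
  proof (induction A rule: finite_ne_induct)
    case (singleton x)
    have "{i. i = x \<and> fst (v i) = fst (v x)} = {x}" by auto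
    then show ?case by simp
  next
    case (insert x F)
    let ?m = "fst (gsum v F)"
    have le: "fst (v i) \<le> ?m" if "i \<in> F" for i using insert that by simp
    have step: "gsum v (insert x F) = gadd (v x) (gsum v F)" using insert by simp
    have max: "Max ((\<lambda>i. fst (v i)) ` insert x F) = max (fst (v x)) ?m" using insert by simp
    consider "fst (v x) < ?m" | "fst (v x) > ?m" | "fst (v x) = ?m" by linarith
    then show ?case
    proof cases
      case 1
      then have "{i. i \<in> insert x F \<and> fst (v i) = ?m} = {i. i \<in> F \<and> fst (v i) = ?m}" by auto
      moreover have "gsum v (insert x F) = gsum v F" unfolding step using 1 by (simp add: gadd_def)
      ultimately show ?thesis unfolding max using insert 1 by simp
    next
      case 2
      then have "{i. i \<in> insert x F \<and> fst (v i) = fst (v x)} = {x}" using le by fastforce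
      moreover have "gsum v (insert x F) = v x" unfolding step using 2 by (simp add: gadd_def)
      ultimately show ?thesis unfolding max using 2 by simp
    next
      case 3
      then have "{i. i \<in> insert x F \<and> fst (v i) = ?m} = insert x {i. i \<in> F \<and> fst (v i) = ?m}" by auto
      moreover have "gsum v (insert x F) = (?m, snd (v x) + snd (gsum v F))"
        unfolding step using 3 by (simp add: gadd_def)
      ultimately show ?thesis unfolding max using insert 3 by simp
    qed
  qed
  then show "fst (gsum v A) = Max ((\<lambda>i. fst (v i)) ` A)"
    and "snd (gsum v A) = (\<Sum>i | i \<in> A \<and> fst (v i) = fst (gsum v A). snd (v i))" by simp_all
qed

lemma eq_gsum_iff:
  assumes "finite A" "A \<noteq> {}"
  shows "p = gsum v A \<longleftrightarrow> fst p = Max ((\<lambda>i. fst (v i)) ` A) \<and>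
    snd p = (\<Sum>i | i \<in> A \<and> fst (v i) = fst p. snd (v i))"
  using gsum_fst_snd[OF assms, of v] by (metis prod_eq_iff)

lemma gsum_dim_zero: "finite A \<Longrightarrow> gsum (\<lambda>i. (0, f i)) A = (0, sum f A)"
  by (induction A rule: finite_induct) (auto simp: gadd_def)

text \<open>Repeated addition of one value is multiplication by the value of a finite set.\<close>

lemma gsum_const: "finite A \<Longrightarrow> A \<noteq> {} \<Longrightarrow> gsum (\<lambda>i. p) A = gmul p (0, real (card A))"
  by (induction A rule: finite_ne_induct) (auto simp: gadd_def gmul_def algebra_simps prod_eq_iff)

lemma MS4_equation_iff:
  assumes "finite D" "D \<noteq> {}"
  shows "(fst p = Max {d + fst (w d \<mu>) |d \<mu>. (d, \<mu>) \<in> D} \<and>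
      snd p = (\<Sum>(d, \<mu>)\<in>{(d, \<mu>) \<in> D. d + fst (w d \<mu>) = fst p}. \<mu> * snd (w d \<mu>))) \<longleftrightarrow>
    p = gsum (\<lambda>v. gmul v (w (fst v) (snd v))) D"
proof -
  have "{d + fst (w d \<mu>) |d \<mu>. (d, \<mu>) \<in> D} = (\<lambda>v. fst (gmul v (w (fst v) (snd v)))) ` D"
    by (force simp: gmul_def)
  moreover have "{(d, \<mu>) \<in> D. d + fst (w d \<mu>) = fst p} =
      {v. v \<in> D \<and> fst (gmul v (w (fst v) (snd v))) = fst p}"
    by (auto simp: gmul_def)
  ultimately show ?thesis unfolding eq_gsum_iff[OF assms]
    by (simp add: gmul_def case_prod_beta)
qed

section \<open>Invariant sets and maps\<close>

context omega_categorical
begin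

definition orbits :: "'a set \<Rightarrow> 'a list set \<Rightarrow> 'a list set set" where
  "orbits C X = (\<lambda>as. tp L M as C) ` X"

lemma finite_orbits:
  assumes "finite C" "invariant L M C n X"
  shows "finite (orbits C X)"
proof (rule finite_subset[OF _ finite_invariant[OF assms(1), of n]])
  show "orbits C X \<subseteq> {X. invariant L M C n X}"
  proof
    fix P assume "P \<in> orbits C X"
    then obtain as where as: "as \<in> X" "P = tp L M as C" by (auto simp: orbits_def)
    then have "length as = n" using assms(2) by (auto simp: invariant_def tuples_def)
    then show "P \<in> {X. invariant L M C n X}" using tp_invariant[OF assms(1), of as] as(2) by simp
  qed
qed

lemma orbits_mem:
  assumes "finite C" "P \<in> orbits C X" "as \<in> P"
  shows "tp L M as C = P"
  using assms tp_eq by (auto simp: orbits_def)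

lemma Union_orbits:
  assumes "finite C" "invariant L M C n X"
  shows "\<Union>(orbits C X) = X"
proof -
  have "tp L M as C \<subseteq> X" "as \<in> tp L M as C" if "as \<in> X" for as
    using tp_subset[OF assms(2,1) that] mem_tp_self[OF assms(1)] by auto
  then show ?thesis unfolding orbits_def by blast
qed

lemma invariant_definable: "finite C \<Longrightarrow> invariant L M C n X \<Longrightarrow> definable_over L M UNIV n X"
  using definable_iff_invariant definable_over_mono by (metis subset_UNIV)

lemma definable_invariant:
  assumes "definable_over L M UNIV n X"
  obtains C where "finite C" "invariant L M C n X"
  using assms definable_over_finite definable_over_invariant by metis

lemma invariant_mono: "invariant L M C n X \<Longrightarrow> C \<subseteq> D \<Longrightarrow> invariant L M D n X"
  unfolding invariant_def using Aut_over_mono by blast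

lemma invariant_Def: "finite C \<Longrightarrow> invariant L M C n X \<Longrightarrow> 1 \<le> n \<Longrightarrow> X \<in> Def L M"
  unfolding Def_def using invariant_definable by blast

lemma invariant_finite_support:
  assumes "finite A" "X \<subseteq> lists A" "X \<subseteq> tuples n"
  shows "invariant L M A n X"
proof -
  have "map g xs \<in> X" if "g \<in> Aut_over L M A" "xs \<in> X" for g xs
  proof -
    have "map g xs = xs" using that assms(2) by (intro map_idI) (auto simp: Aut_over_def lists_eq_set)
    then show ?thesis using that(2) by simp
  qed
  then show ?thesis using assms(3) by (simp add: invariant_def)
qed

lemma invariant_image_mem:
  assumes "invariant L M C n X" "g \<in> Aut_over L M C"
  shows "map g xs \<in> X \<longleftrightarrow> xs \<in> X"
proof
  assume "map g xs \<in> X"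
  then have "map (inv g) (map g xs) \<in> X" using assms Aut_over_inv unfolding invariant_def by blast
  then show "xs \<in> X" using map_inv_map[OF Aut_bij[OF Aut_over_subset[OF assms(2)]]] by simp
qed (use assms in \<open>simp add: invariant_def\<close>)

end

text \<open>\<open>C\<close> is one finite parameter set for the domain, the codomain and the map.
  Definability of \<open>f\<close> is expressed as commuting with the automorphisms over
  \<open>C\<close> on \<open>X\<close>, which corresponds to invariance of the graph; values of
  \<open>f\<close> outside \<open>X\<close> are unconstrained.\<close>

locale definable_map = omega_categorical L M
  for L :: "('f, 'r) language" and M :: "('f, 'r, 'a) struct" +
  fixes C :: "'a set" and n m :: nat and X Y :: "'a list set" and f :: "'a list \<Rightarrow> 'a list"
  assumes finite_C: "finite C"
    and X_invariant: "invariant L M C n X"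
    and Y_invariant: "invariant L M C m Y"
    and surjective: "f ` X = Y"
    and equivariant: "\<And>g xs. g \<in> Aut_over L M C \<Longrightarrow> xs \<in> X \<Longrightarrow> f (map g xs) = map g (f xs)"
begin

abbreviation fibre :: "'a list \<Rightarrow> 'a list set" where
  "fibre b \<equiv> {x \<in> X. f x = b}"

lemma graph_invariant: "invariant L M C (n + m) ((\<lambda>x. x @ f x) ` X)"
  unfolding invariant_def
proof (intro conjI ballI)
  have "length x = n" "length (f x) = m" if "x \<in> X" for x
    using X_invariant Y_invariant surjective that by (auto simp: invariant_def tuples_def)
  then show "(\<lambda>x. x @ f x) ` X \<subseteq> tuples (n + m)" by (auto simp: tuples_def)
  fix g ys assume g: "g \<in> Aut_over L M C" and "ys \<in> (\<lambda>x. x @ f x) ` X"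
  then obtain x where x: "x \<in> X" "ys = x @ f x" by blast
  then have "map g ys = map g x @ f (map g x)" using equivariant[OF g x(1)] by simp
  then show "map g ys \<in> (\<lambda>x. x @ f x) ` X" using invariant_image_mem[OF X_invariant g] x(1) by blast
qed

lemma fibre_map:
  assumes "g \<in> Aut_over L M C"
  shows "fibre (map g b) = map g ` fibre b"
proof (intro set_eqI iffI)
  have bij: "bij g" by (rule Aut_bij[OF Aut_over_subset[OF assms]])
  fix x assume x: "x \<in> fibre (map g b)"
  let ?y = "map (inv g) x"
  have "?y \<in> X" using invariant_image_mem[OF X_invariant Aut_over_inv[OF assms]] x by blast
  moreover have "f ?y = b"
    using equivariant[OF Aut_over_inv[OF assms]] x map_inv_map[OF bij, of b] by simp
  ultimately have "map g ?y \<in> map g ` fibre b" by blast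
  then show "x \<in> map g ` fibre b" unfolding map_map_inv[OF bij] .
next
  fix x assume "x \<in> map g ` fibre b"
  then show "x \<in> fibre (map g b)" using invariant_image_mem[OF X_invariant assms] equivariant[OF assms] by auto
qed

lemma fibre_invariant: "invariant L M (C \<union> set b) n (fibre b)"
  unfolding invariant_def
proof (intro conjI ballI)
  show "fibre b \<subseteq> tuples n" using X_invariant by (auto simp: invariant_def)
  fix g x assume g: "g \<in> Aut_over L M (C \<union> set b)" and x: "x \<in> fibre b"
  have "map g b = b" using g by (intro map_idI) (auto simp: Aut_over_def)
  then show "map g x \<in> fibre b" using fibre_map[OF Aut_over_mono[OF _ g], of b] x by auto
qed

text \<open>An automorphism fixing \<open>C\<close> and \<open>x\<close> fixes \<open>f x\<close> by
  equivariance. This makes (cMS4) applicable to \<open>x\<close> and \<open>f x\<close>.\<close>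

lemma dcl_value:
  assumes "x \<in> X"
  shows "set (f x) \<subseteq> dcl L M (C \<union> set x)"
proof
  fix a assume a: "a \<in> set (f x)"
  have "g a = a" if g: "g \<in> Aut_over L M (C \<union> set x)" for g
  proof -
    have "map g x = x" using g by (intro map_idI) (auto simp: Aut_over_def)
    then have "map g (f x) = f x" using equivariant[OF Aut_over_mono[OF _ g] assms] by simp
    then show ?thesis using a by (metis map_eq_conv list.map_ident)
  qed
  then show "a \<in> dcl L M (C \<union> set x)" using dcl_iff[of "C \<union> set x"] finite_C by simp
qed

lemma image_tp:
  assumes "x \<in> X"
  shows "f ` tp L M x C = tp L M (f x) C"
proof (intro set_eqI iffI)
  fix y assume "y \<in> f ` tp L M x C"
  then obtain x' where x': "x' \<in> tp L M x C" "y = f x'" by blast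
  from x'(1) finite_C obtain g where "g \<in> Aut_over L M C" "x' = map g x" by (rule tpE)
  then show "y \<in> tp L M (f x) C" using equivariant[OF _ assms] x'(2) tpI[OF finite_C] by simp
next
  fix y assume "y \<in> tp L M (f x) C"
  from this finite_C obtain g where g: "g \<in> Aut_over L M C" "y = map g (f x)" by (rule tpE)
  then have "y = f (map g x)" using equivariant[OF _ assms] by simp
  then show "y \<in> f ` tp L M x C" using tpI[OF finite_C g(1)] by blast
qed

text \<open>If an automorphism over \<open>C\<close> moves \<open>x\<close> within the fibre of
  \<open>b\<close>, equivariance forces it to fix \<open>b\<close>.\<close>

lemma tp_Int_fibre:
  assumes "x \<in> fibre b"
  shows "tp L M x C \<inter> fibre b = tp L M x (C \<union> set b)"
proof (intro set_eqI iffI)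
  have fin: "finite (C \<union> set b)" using finite_C by simp
  fix y assume y: "y \<in> tp L M x C \<inter> fibre b"
  then have "y \<in> tp L M x C" by blast
  from this finite_C obtain g where g: "g \<in> Aut_over L M C" "y = map g x" by (rule tpE)
  have "map g b = b" using equivariant[OF g(1), of x] assms y g(2) by simp
  then have "\<forall>a\<in>set b. g a = a" by (metis map_eq_conv list.map_ident)
  then have "g \<in> Aut_over L M (C \<union> set b)" using g(1) by (auto simp: Aut_over_def)
  then show "y \<in> tp L M x (C \<union> set b)" unfolding g(2) by (rule tpI[OF fin])
next
  have fin: "finite (C \<union> set b)" using finite_C by simp
  fix y assume "y \<in> tp L M x (C \<union> set b)"
  from this fin obtain g where g: "g \<in> Aut_over L M (C \<union> set b)" "y = map g x" by (rule tpE)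
  have "y \<in> fibre b" unfolding g(2) using invariant_image_mem[OF fibre_invariant g(1)] assms by blast
  moreover have "y \<in> tp L M x C" unfolding g(2) by (rule tpI[OF finite_C Aut_over_mono[OF _ g(1)]]) blast
  ultimately show "y \<in> tp L M x C \<inter> fibre b" by blast
qed

text \<open>An orbit above that of \<open>b\<close> has a representative in the fibre, and by
  \<open>tp_Int_fibre\<close> its trace there is a single orbit over the larger parameter set. The
  trace determines the orbit because distinct orbits are disjoint.\<close>

lemma orbits_over:
  assumes "b \<in> Y"
  shows "bij_betw (\<lambda>P. P \<inter> fibre b) {P \<in> orbits C X. f ` P = tp L M b C} (orbits (C \<union> set b) (fibre b))"
proof -
  let ?S = "{P \<in> orbits C X. f ` P = tp L M b C}"
  have rep: "\<exists>x\<in>fibre b. P = tp L M x C" if P: "P \<in> ?S" for P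
  proof -
    from P obtain x where x: "x \<in> X" "P = tp L M x C" by (auto simp: orbits_def)
    have "b \<in> f ` tp L M x C" using P x mem_tp_self[OF finite_C] by auto
    then obtain y where y: "y \<in> tp L M x C" "f y = b" by blast
    then have "y \<in> X" using tp_subset[OF X_invariant finite_C x(1)] by blast
    then show ?thesis using y tp_eq[OF finite_C y(1)] x(2) by auto
  qed
  have "inj_on (\<lambda>P. P \<inter> fibre b) ?S"
  proof (rule inj_onI)
    fix P P' assume OO: "P \<in> ?S" "P' \<in> ?S" "P \<inter> fibre b = P' \<inter> fibre b"
    obtain x where x: "x \<in> fibre b" "P = tp L M x C" using rep[OF OO(1)] by blast
    then have "x \<in> P'" using OO(3) mem_tp_self[OF finite_C, of x] by blast
    then show "P = P'" using orbits_mem[OF finite_C, of P' X x] OO(2) x(2) by simp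
  qed
  moreover have "(\<lambda>P. P \<inter> fibre b) ` ?S = orbits (C \<union> set b) (fibre b)"
  proof (intro set_eqI iffI)
    fix Q assume "Q \<in> (\<lambda>P. P \<inter> fibre b) ` ?S"
    then obtain P where P: "P \<in> ?S" "Q = P \<inter> fibre b" by blast
    obtain x where x: "x \<in> fibre b" "P = tp L M x C" using rep[OF P(1)] by blast
    then have "Q = tp L M x (C \<union> set b)" using tp_Int_fibre[OF x(1)] P(2) by simp
    then show "Q \<in> orbits (C \<union> set b) (fibre b)" using x(1) by (auto simp: orbits_def)
  next
    fix Q assume "Q \<in> orbits (C \<union> set b) (fibre b)"
    then obtain x where x: "x \<in> fibre b" "Q = tp L M x (C \<union> set b)" by (auto simp: orbits_def)
    have "tp L M x C \<in> ?S" using x(1) image_tp[of x] by (auto simp: orbits_def)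
    moreover have "Q = tp L M x C \<inter> fibre b" unfolding x(2) tp_Int_fibre[OF x(1)] ..
    ultimately show "Q \<in> (\<lambda>P. P \<inter> fibre b) ` ?S" by blast
  qed
  ultimately show ?thesis by (simp add: bij_betw_def)
qed

end

context omega_categorical
begin

text \<open>An automorphism over \<open>C\<close> maps a point of the graph to a point of the graph;
  comparing the first \<open>n\<close> entries shows that it is the one above
  \<open>map g xs\<close>.\<close>

lemma definable_mapI:
  assumes "finite C" "invariant L M C n X" "invariant L M C m Y" "f ` X = Y"
    "invariant L M C (n + m) ((\<lambda>x. x @ f x) ` X)"
  shows "definable_map L M C n m X Y f"
proof unfold_locales
  fix g xs assume g: "g \<in> Aut_over L M C" and xs: "xs \<in> X"
  have "map g (xs @ f xs) \<in> (\<lambda>x. x @ f x) ` X"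
    using assms(5) g xs unfolding invariant_def by blast
  then obtain ys where ys: "ys \<in> X" "map g xs @ map g (f xs) = ys @ f ys" by auto
  moreover have "length xs = length ys" using assms(2) xs ys(1) by (auto simp: invariant_def tuples_def)
  ultimately show "f (map g xs) = map g (f xs)" by simp
qed (use assms in auto)

end

section \<open>The two conditions\<close>

lemma (in definable_map) MS4_equation:
  assumes "finite ((\<lambda>b. h (fibre b)) ` Y)" "X \<noteq> {}"
  shows "h X = gsum (\<lambda>v. gmul v (h {b \<in> Y. h (fibre b) = v})) ((\<lambda>b. h (fibre b)) ` Y) \<longleftrightarrow>
    (let D = (\<lambda>b. h (fibre b)) ` Y;
         Yv = (\<lambda>d \<mu>. {b \<in> Y. h (fibre b) = (d, \<mu>)})
     in (X \<noteq> {} \<longrightarrow> dim h X = Max {d + dim h (Yv d \<mu>) |d \<mu>. (d, \<mu>) \<in> D}) \<and>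
        meas h X = (\<Sum>(d, \<mu>)\<in>{(d, \<mu>) \<in> D. d + dim h (Yv d \<mu>) = dim h X}. \<mu> * meas h (Yv d \<mu>)))"
proof -
  have "(\<lambda>b. h (fibre b)) ` Y \<noteq> {}" using assms(2) surjective by blast
  from MS4_equation_iff[OF assms(1) this, of "h X" "\<lambda>d \<mu>. h {b \<in> Y. h (fibre b) = (d, \<mu>)}"]
  show ?thesis using assms(2) unfolding Let_def prod.collapse by blast
qed

lemma (in definable_map) definable:
  "definable_over L M UNIV n X" "definable_over L M UNIV m Y"
  "definable_over L M UNIV (n + m) ((\<lambda>x. x @ f x) ` X)"
  using invariant_definable[OF finite_C] X_invariant Y_invariant graph_invariant by blast+

lemma (in definable_map) MS4D:
  assumes "MS4 L M h" "1 \<le> n" "1 \<le> m" "finite ((\<lambda>b. h (fibre b)) ` Y)" "X \<noteq> {}"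
  shows "h X = gsum (\<lambda>v. gmul v (h {b \<in> Y. h (fibre b) = v})) ((\<lambda>b. h (fibre b)) ` Y)"
  unfolding MS4_equation[OF assms(4,5)]
  using assms(1)[unfolded MS4_def, rule_format, OF assms(2,3), of X Y f] definable surjective by blast

section \<open>From measurability to the conditions on types\<close>

context omega_categorical
begin

text \<open>Applying \<open>g\<close> to \<open>X\<close> replaces its parameters by their images.
  By (MS3) the parameters giving a fixed value form a parameter-free definable set, and
  \<open>g\<close> preserves such a set.\<close>

lemma MS_image:
  assumes "MS1_MS3 L M h" "1 \<le> n" "definable_over L M C n X" "g \<in> Aut L M"
  shows "h (map g ` X) = h X"
proof -
  have bij: "bij g" by (rule Aut_bij[OF assms(4)])
  obtain \<phi> cs where \<phi>: "formula_in L (n + length cs) \<phi>" "X = solution_set M n \<phi> cs"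
    using assms(3) unfolding definable_over_def by blast
  have "xs \<in> map g ` X \<longleftrightarrow> xs \<in> solution_set M n \<phi> (map g cs)" for xs
  proof -
    have "xs \<in> solution_set M n \<phi> (map g cs) \<longleftrightarrow> map (inv g) xs \<in> X"
      using solution_set_Aut[OF assms(4) \<phi>(1), of "map (inv g) xs"] \<phi>(2) unfolding map_map_inv[OF bij] by simp
    also have "\<dots> \<longleftrightarrow> xs \<in> map g ` X"
      using map_map_inv[OF bij, of xs] map_inv_map[OF bij] by (metis imageE imageI)
    finally show ?thesis ..
  qed
  then have image: "map g ` X = solution_set M n \<phi> (map g cs)" by blast
  obtain D where D: "h X \<in> D" "\<And>v. v \<in> D \<Longrightarrow>
      defn L M (length cs) {as \<in> tuples (length cs). h (solution_set M n \<phi> as) = v}"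
    using assms(1)[unfolded MS1_MS3_def, rule_format, OF assms(2) \<phi>(1)] \<phi>(2)
    by (fastforce simp: tuples_def)
  have "invariant L M {} (length cs) {as \<in> tuples (length cs). h (solution_set M n \<phi> as) = h X}"
    by (rule definable_over_invariant[OF D(2)[OF D(1)]])
  moreover have "g \<in> Aut_over L M {}" using assms(4) by (simp add: Aut_over_def)
  ultimately have "map g cs \<in> {as \<in> tuples (length cs). h (solution_set M n \<phi> as) = h X}"
    using \<phi>(2) by (simp add: invariant_def tuples_def)
  then show ?thesis using image by simp
qed

lemma MS_orbit_sum:
  assumes MS2: "MS2 L M h" and MS4: "MS4 L M h" and C: "finite C" and X: "invariant L M C n X" and n: "1 \<le> n"
  shows "h X = gsum h (orbits C X)"
proof (cases "X = {}")
  case True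
  then show ?thesis using MS2 invariant_Def[OF C X n] by (simp add: MS2_def orbits_def)
next
  case False
  let ?R = "orbits C X"
  have finR: "finite ?R" by (rule finite_orbits[OF C X])
  obtain e :: "nat \<Rightarrow> 'a" where e: "inj e" using infinite_countable_subset[OF infinite_universe] by blast
  \<comment> \<open>Each orbit gets a label in \<open>M\<close>. There are enough labels since
    \<open>M\<close> is infinite, and they need not be related to the orbits.\<close>
  define pt where "pt P = [e (to_nat_on ?R P)]" for P
  have inj: "inj_on pt ?R"
    using inj_on_to_nat_on[OF countable_finite[OF finR]] e by (auto simp: pt_def inj_on_def)
  define f where "f x = pt (tp L M x C)" for x
  define Y where "Y = pt ` ?R"
  \<comment> \<open>The labels become parameters, so that the collapsing map is definable; the
    orbits being collapsed are still those over \<open>C\<close>.\<close>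
  define B where "B = C \<union> (\<Union>P\<in>?R. set (pt P))"
  have "finite B" using C finR by (simp add: B_def)
  have len: "pt P \<in> tuples 1" for P by (simp add: pt_def tuples_def)
  have fY: "f ` X = Y" by (auto simp: f_def Y_def orbits_def)
  interpret definable_map L M B n 1 X Y f
  proof unfold_locales
    show "finite B" by fact
    show "invariant L M B n X" by (rule invariant_mono[OF X]) (simp add: B_def)
    have "invariant L M (\<Union>P\<in>?R. set (pt P)) 1 Y"
      using finR len by (intro invariant_finite_support) (auto simp: Y_def lists_eq_set)
    then show "invariant L M B 1 Y" by (rule invariant_mono) (simp add: B_def)
    show "f ` X = Y" by fact
    fix g x assume g: "g \<in> Aut_over L M B" and x: "x \<in> X"
    have "g \<in> Aut_over L M C" by (rule Aut_over_mono[OF _ g]) (simp add: B_def)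
    then have "tp L M (map g x) C = tp L M x C" using tp_eq[OF C] tpI[OF C] by blast
    moreover have "map g (f x) = f x"
    proof (rule map_idI)
      fix a assume "a \<in> set (f x)"
      then have "a \<in> B" using x by (auto simp: B_def f_def orbits_def)
      then show "g a = a" using g by (simp add: Aut_over_def)
    qed
    ultimately show "f (map g x) = map g (f x)" by (simp add: f_def)
  qed
  have fibre: "fibre (pt P) = P" if P: "P \<in> ?R" for P
  proof (intro set_eqI iffI)
    fix x assume "x \<in> fibre (pt P)"
    then have "x \<in> X" "pt (tp L M x C) = pt P" by (auto simp: f_def)
    then have "tp L M x C = P" using inj_onD[OF inj] P by (auto simp: orbits_def)
    then show "x \<in> P" using mem_tp_self[OF C] by blast
  next
    fix x assume "x \<in> P"
    then show "x \<in> fibre (pt P)" using orbits_mem[OF C P] Union_orbits[OF C X] P by (auto simp: f_def)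
  qed
  have D: "(\<lambda>b. h (fibre b)) ` Y = h ` ?R"
    unfolding Y_def image_image by (rule image_cong) (simp_all add: fibre)
  \<comment> \<open>A level set consists of finitely many labels, one per orbit of value
    \<open>v\<close>, so (MS2) evaluates it by counting.\<close>
  have Yv: "h {b \<in> Y. h (fibre b) = v} = (0, real (card {P \<in> ?R. h P = v}))" for v
  proof -
    have eq: "{b \<in> Y. h (fibre b) = v} = pt ` {P \<in> ?R. h P = v}"
    proof (intro set_eqI iffI)
      fix b assume "b \<in> {b \<in> Y. h (fibre b) = v}"
      then obtain P where "P \<in> ?R" "b = pt P" "h (fibre (pt P)) = v" unfolding Y_def by blast
      then show "b \<in> pt ` {P \<in> ?R. h P = v}" using fibre by simp
    next
      fix b assume "b \<in> pt ` {P \<in> ?R. h P = v}"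
      then obtain P where "P \<in> ?R" "b = pt P" "h P = v" by blast
      then show "b \<in> {b \<in> Y. h (fibre b) = v}" using fibre unfolding Y_def by simp
    qed
    have fin: "finite {P \<in> ?R. h P = v}" using finR by simp
    have "invariant L M (\<Union>P\<in>?R. set (pt P)) 1 {b \<in> Y. h (fibre b) = v}"
      unfolding eq using finR len by (intro invariant_finite_support) (auto simp: lists_eq_set)
    then have "{b \<in> Y. h (fibre b) = v} \<in> Def L M"
      by (rule invariant_Def[rotated]) (use finR in auto)
    moreover have "finite {b \<in> Y. h (fibre b) = v}" unfolding eq using fin by simp
    moreover have "card {b \<in> Y. h (fibre b) = v} = card {P \<in> ?R. h P = v}"
      unfolding eq by (rule card_image) (rule inj_on_subset[OF inj], blast)
    ultimately show ?thesis using MS2[unfolded MS2_def, rule_format, of "{b \<in> Y. h (fibre b) = v}"] by simp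
  qed
  have "h X = gsum (\<lambda>v. gmul v (h {b \<in> Y. h (fibre b) = v})) ((\<lambda>b. h (fibre b)) ` Y)"
    by (rule MS4D[OF MS4 n order_refl _ False]) (simp only: D, use finR in simp)
  also have "\<dots> = gsum (\<lambda>v. gmul v (0, real (card {P \<in> ?R. h P = v}))) (h ` ?R)"
    unfolding D Yv ..
  also have "\<dots> = gsum (\<lambda>v. gsum h {P \<in> ?R. h P = v}) (h ` ?R)"
  proof (rule gsum.cong[OF refl])
    fix v assume "v \<in> h ` ?R"
    then have "{P \<in> ?R. h P = v} \<noteq> {}" by blast
    moreover have "finite {P \<in> ?R. h P = v}" using finR by simp
    ultimately have "gmul v (0, real (card {P \<in> ?R. h P = v})) = gsum (\<lambda>P. v) {P \<in> ?R. h P = v}"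
      by (simp add: gsum_const)
    also have "\<dots> = gsum h {P \<in> ?R. h P = v}" by (rule gsum.cong) auto
    finally show "gmul v (0, real (card {P \<in> ?R. h P = v})) = gsum h {P \<in> ?R. h P = v}" .
  qed
  also have "\<dots> = gsum h ?R" using finR by (intro gsum.group) auto
  finally show ?thesis .
qed

text \<open>The index \<open>i\<close> can be recovered because the types are nonempty and disjoint,
  and any type inside \<open>X\<close> equals the listed type that it meets.\<close>

lemma orbits_index:
  assumes C: "finite C" and disj: "disjoint_family_on (\<lambda>i. tp L M (a i) C) {..<k}"
    and X: "X = (\<Union>i<k. tp L M (a i) C)"
  shows "bij_betw (\<lambda>i. tp L M (a i) C) {..<k} (orbits C X)"
  unfolding bij_betw_def
proof
  show "inj_on (\<lambda>i. tp L M (a i) C) {..<k}"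
  proof (rule inj_onI)
    fix i j assume ij: "i \<in> {..<k}" "j \<in> {..<k}" "tp L M (a i) C = tp L M (a j) C"
    show "i = j"
    proof (rule ccontr)
      assume "i \<noteq> j"
      then have "tp L M (a i) C \<inter> tp L M (a j) C = {}" using disjoint_family_onD[OF disj ij(1,2)] by blast
      then show False using ij(3) mem_tp_self[OF C, of "a i"] by blast
    qed
  qed
  show "(\<lambda>i. tp L M (a i) C) ` {..<k} = orbits C X"
  proof (intro set_eqI iffI)
    fix P assume "P \<in> (\<lambda>i. tp L M (a i) C) ` {..<k}"
    then obtain i where i: "i < k" "P = tp L M (a i) C" by blast
    then have "a i \<in> X" using X mem_tp_self[OF C, of "a i"] by blast
    then show "P \<in> orbits C X" using i(2) by (auto simp: orbits_def)
  next
    fix P assume "P \<in> orbits C X"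
    then obtain x i where "P = tp L M x C" "i < k" "x \<in> tp L M (a i) C" using X by (auto simp: orbits_def)
    then show "P \<in> (\<lambda>i. tp L M (a i) C) ` {..<k}" using tp_eq[OF C] by blast
  qed
qed

lemma cMS2I:
  assumes "\<And>C n X. finite C \<Longrightarrow> invariant L M C n X \<Longrightarrow> 1 \<le> n \<Longrightarrow> h X = gsum h (orbits C X)"
  shows "cMS2 L M h"
  unfolding cMS2_def
proof (intro allI impI)
  fix C :: "'a set" and n X k and a :: "nat \<Rightarrow> 'a list"
  assume n: "1 \<le> n" and *: "finite C \<and> definable_over L M C n X \<and> (\<forall>i<k. a i \<in> tuples n) \<and>
    disjoint_family_on (\<lambda>i. tp L M (a i) C) {..<k} \<and> X = (\<Union>i<k. tp L M (a i) C)"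
  let ?v = "\<lambda>i. h (tp L M (a i) C)"
  have C: "finite C" using * by blast
  have X: "invariant L M C n X" using * definable_over_invariant by blast
  have "bij_betw (\<lambda>i. tp L M (a i) C) {..<k} (orbits C X)" using * by (intro orbits_index) blast+
  then have hX: "h X = gsum ?v {..<k}"
    using assms[OF C X n] gsum.reindex_bij_betw[of _ "{..<k}" "orbits C X" h] by simp
  show "(0 < k \<longrightarrow> dim h X = Max ((\<lambda>i. dim h (tp L M (a i) C)) ` {..<k})) \<and>
    meas h X = (\<Sum>i | i < k \<and> dim h (tp L M (a i) C) = dim h X. meas h (tp L M (a i) C))"
  proof (cases "k = 0")
    case False
    then have "finite {..<k}" "{..<k} \<noteq> {}" by auto
    from gsum_fst_snd[OF this, of ?v] show ?thesis using hX by simp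
  qed (use hX in simp)
qed

lemma cMS2D:
  assumes "dim_meas_fun L M h" "cMS2 L M h" and C: "finite C" and X: "invariant L M C n X" and n: "1 \<le> n"
  shows "h X = gsum h (orbits C X)"
proof -
  let ?k = "card (orbits C X)"
  obtain p where p: "bij_betw p {0..<?k} (orbits C X)"
    using ex_bij_betw_nat_finite[OF finite_orbits[OF C X]] by blast
  have "\<exists>x. x \<in> X \<and> p i = tp L M x C" if "i < ?k" for i
  proof -
    have "p i \<in> orbits C X" using p that by (auto simp: bij_betw_def)
    then show ?thesis by (auto simp: orbits_def)
  qed
  then obtain a where a: "\<And>i. i < ?k \<Longrightarrow> a i \<in> X \<and> p i = tp L M (a i) C" by metis
  let ?v = "\<lambda>i. h (tp L M (a i) C)"
  have b: "bij_betw (\<lambda>i. tp L M (a i) C) {..<?k} (orbits C X)"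
  proof -
    have "bij_betw p {..<?k} (orbits C X) \<longleftrightarrow> bij_betw (\<lambda>i. tp L M (a i) C) {..<?k} (orbits C X)"
      using a by (intro bij_betw_cong) simp
    then show ?thesis using p by (simp add: atLeast0LessThan)
  qed
  have sum: "gsum h (orbits C X) = gsum ?v {..<?k}"
    using gsum.reindex_bij_betw[OF b, of h] by simp
  have "disjoint_family_on (\<lambda>i. tp L M (a i) C) {..<?k}"
    unfolding disjoint_family_on_def
  proof (intro ballI impI)
    fix i j assume ij: "i \<in> {..<?k}" "j \<in> {..<?k}" "i \<noteq> j"
    then have "tp L M (a i) C \<noteq> tp L M (a j) C" using b by (auto simp: bij_betw_def inj_on_def)
    then show "tp L M (a i) C \<inter> tp L M (a j) C = {}" using tp_eq[OF C] by blast
  qed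
  moreover have "X = (\<Union>i<?k. tp L M (a i) C)"
    using Union_orbits[OF C X] b by (simp add: bij_betw_def)
  moreover have "\<forall>i<?k. a i \<in> tuples n" using a X by (auto simp: invariant_def)
  moreover have "definable_over L M C n X" using X definable_iff_invariant[OF C] by blast
  ultimately have *: "0 < ?k \<longrightarrow> dim h X = Max ((\<lambda>i. dim h (tp L M (a i) C)) ` {..<?k})"
    "meas h X = (\<Sum>i | i < ?k \<and> dim h (tp L M (a i) C) = dim h X. meas h (tp L M (a i) C))"
    using assms(2)[unfolded cMS2_def, rule_format, OF n, of C X ?k a] C by blast+
  show ?thesis
  proof (cases "?k = 0")
    \<comment> \<open>Here (cMS2) says nothing about the dimension of the empty set; the range of
      \<open>h\<close> forces it to be zero once the measure is.\<close>
    case True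
    then have "meas h X = 0" using *(2) by simp
    moreover have "h X \<in> UNIV \<times> {0<..} \<union> {(0, 0)}"
      using assms(1) invariant_Def[OF C X n] by (auto simp: dim_meas_fun_def)
    ultimately have "h X = (0, 0)" by auto
    then show ?thesis unfolding sum using True by simp
  next
    case False
    then have ne: "finite {..<?k}" "{..<?k} \<noteq> {}" by auto
    show ?thesis unfolding sum eq_gsum_iff[OF ne] using * False by simp
  qed
qed

lemma MS_imp_cMS4:
  assumes MS13: "MS1_MS3 L M h" and MS4: "MS4 L M h" and C: "finite C"
    and as: "as \<noteq> []" and bs: "bs \<noteq> []" "set bs \<subseteq> dcl L M (C \<union> set as)"
  shows "h (tp L M as C) = gmul (h (tp L M bs C)) (h (tp L M as (C \<union> set bs)))"
proof -
  \<comment> \<open>The map sends \<open>map g as\<close> to \<open>map g bs\<close>. It does not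
    depend on \<open>g\<close>: two choices differ by an automorphism fixing \<open>C\<close> and
    \<open>as\<close>, which fixes \<open>bs\<close> by the assumption on
    \<open>dcl\<close>.\<close>
  define f where "f xs = map (SOME g. g \<in> Aut_over L M C \<and> xs = map g as) bs" for xs
  have f: "f (map g as) = map g bs" if g: "g \<in> Aut_over L M C" for g
  proof -
    define k where "k = (SOME k. k \<in> Aut_over L M C \<and> map g as = map k as)"
    have k: "k \<in> Aut_over L M C" "map g as = map k as"
      using someI[of "\<lambda>k. k \<in> Aut_over L M C \<and> map g as = map k as" g] g unfolding k_def by blast+
    have bij: "bij k" by (rule Aut_bij[OF Aut_over_subset[OF k(1)]])
    have "(inv k \<circ> g) c = c" if "c \<in> set as" for c
      using k(2) that bij by (simp add: bij_is_inj inv_f_f)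
    moreover have "inv k \<circ> g \<in> Aut_over L M C" by (intro Aut_over_comp Aut_over_inv g k)
    ultimately have "inv k \<circ> g \<in> Aut_over L M (C \<union> set as)" by (auto simp: Aut_over_def)
    then have fixed: "inv k (g b) = b" if "b \<in> set bs" for b
      using bs(2) that dcl_iff[of "C \<union> set as" b] C by auto
    have "k b = g b" if "b \<in> set bs" for b using fixed[OF that] bij_inv_eq_iff[OF bij, of b "g b"] by simp
    then have "map k bs = map g bs" by simp
    then show ?thesis unfolding f_def k_def[symmetric] .
  qed
  interpret definable_map L M C "length as" "length bs" "tp L M as C" "tp L M bs C" f
  proof unfold_locales
    show "finite C" by fact
    show "invariant L M C (length as) (tp L M as C)" "invariant L M C (length bs) (tp L M bs C)"
      by (rule tp_invariant[OF C])+
    show "f ` tp L M as C = tp L M bs C"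
      unfolding tp_eq_orbit[OF C] using f by force
    fix g xs assume g: "g \<in> Aut_over L M C" and "xs \<in> tp L M as C"
    from this(2) C obtain k where k: "k \<in> Aut_over L M C" "xs = map k as" by (rule tpE)
    then show "f (map g xs) = map g (f xs)" using f[OF Aut_over_comp[OF g k(1)]] f[OF k(1)] by simp
  qed
  let ?v = "h (tp L M as (C \<union> set bs))"
  have "as \<in> fibre bs" using mem_tp_self[OF C, of as] f[OF Aut_over_id] by simp
  then have fib: "fibre bs = tp L M as (C \<union> set bs)" using tp_Int_fibre[of as bs] by auto
  \<comment> \<open>Every \<open>b\<close> is conjugate to \<open>bs\<close> over \<open>C\<close>,
    so its fibre is a translate of the fibre of \<open>bs\<close>. Hence only one value occurs, and
    the sum in (MS4) has a single term.\<close>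
  have hfib: "h (fibre b) = ?v" if "b \<in> tp L M bs C" for b
  proof -
    from that C obtain g where g: "g \<in> Aut_over L M C" "b = map g bs" by (rule tpE)
    have "h (map g ` fibre bs) = h (fibre bs)"
      using as C fibre_invariant[of bs] definable_iff_invariant[of "C \<union> set bs"] Aut_over_subset[OF g(1)]
      by (intro MS_image[OF MS13, of "length as" "C \<union> set bs"]) (auto simp: Suc_leI)
    then show ?thesis using fibre_map[OF g(1), of bs] g(2) fib by simp
  qed
  have ne: "tp L M as C \<noteq> {}" "tp L M bs C \<noteq> {}" using mem_tp_self[OF C] by blast+
  have D: "(\<lambda>b. h (fibre b)) ` tp L M bs C = {?v}" using hfib ne(2) by auto
  have Yv: "{b \<in> tp L M bs C. h (fibre b) = ?v} = tp L M bs C" using hfib by blast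
  have "h (tp L M as C) = gsum (\<lambda>v. gmul v (h {b \<in> tp L M bs C. h (fibre b) = v})) ((\<lambda>b. h (fibre b)) ` tp L M bs C)"
    using as bs(1) by (intro MS4D[OF MS4] ne) (simp_all add: D Suc_leI)
  also have "\<dots> = gmul ?v (h (tp L M bs C))" unfolding D by (simp add: Yv)
  finally show ?thesis by (simp only: gmul_commute)
qed

lemma MS_imp_cMS:
  assumes "MS1_MS3 L M h" "MS2 L M h" "MS4 L M h"
  shows "cMS1 L M h" "cMS2 L M h" "cMS3 L M h" "cMS4 L M h"
proof -
  show "cMS1 L M h" unfolding cMS1_def
  proof (intro allI ballI impI)
    fix C :: "'a set" and as :: "'a list" and g assume g: "g \<in> Aut L M" and *: "finite C \<and> as \<noteq> []"
    then have "definable_over L M C (length as) (tp L M as C)"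
      using definable_iff_invariant tp_invariant by blast
    moreover have "1 \<le> length as" using * by (simp add: Suc_leI)
    ultimately show "h (tp L M (map g as) (g ` C)) = h (tp L M as C)"
      using MS_image[OF assms(1) _ _ g] tp_image[OF g] * by metis
  qed
  show "cMS2 L M h" by (rule cMS2I) (rule MS_orbit_sum[OF assms(2,3)])
  show "cMS3 L M h" unfolding cMS3_def
  proof (intro allI impI)
    fix C :: "'a set" and as :: "'a list" assume *: "finite C \<and> as \<noteq> [] \<and> set as \<subseteq> acl L M C"
    then have C: "finite C" by blast
    have "1 \<le> length as" using * by (simp add: Suc_leI)
    then have "tp L M as C \<in> Def L M" by (rule invariant_Def[OF C tp_invariant[OF C]])
    moreover have "finite (tp L M as C)" using finite_tp_acl * by blast
    ultimately have "h (tp L M as C) = (0, real (card (tp L M as C)))" using assms(2) by (simp add: MS2_def)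
    then show "dim h (tp L M as C) = 0 \<and>
        meas h (tp L M as C) = real (card {map g as |g. g \<in> Aut_over L M C})"
      using tp_eq_orbit[OF C] by simp
  qed
  show "cMS4 L M h" unfolding cMS4_def
  proof (intro allI impI)
    fix C :: "'a set" and as bs :: "'a list"
    assume "finite C \<and> as \<noteq> [] \<and> bs \<noteq> [] \<and> set bs \<subseteq> dcl L M (C \<union> set as)"
    then have "h (tp L M as C) = gmul (h (tp L M bs C)) (h (tp L M as (C \<union> set bs)))"
      by (intro MS_imp_cMS4[OF assms(1,3)]) blast+
    then show "dim h (tp L M as C) = dim h (tp L M bs C) + dim h (tp L M as (C \<union> set bs)) \<and>
        meas h (tp L M as C) = meas h (tp L M bs C) * meas h (tp L M as (C \<union> set bs))"
      by (simp add: gmul_def)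
  qed
qed

section \<open>From the conditions on types to measurability\<close>

lemma invariant_image:
  assumes "g \<in> Aut L M" "invariant L M C n X"
  shows "invariant L M (g ` C) n (map g ` X)"
  unfolding invariant_def
proof (intro conjI ballI)
  show "map g ` X \<subseteq> tuples n" using assms(2) by (auto simp: invariant_def tuples_def)
  fix k ys assume k: "k \<in> Aut_over L M (g ` C)" and "ys \<in> map g ` X"
  then obtain x where x: "x \<in> X" "ys = map g x" by blast
  have bij: "bij g" by (rule Aut_bij[OF assms(1)])
  have "inv g \<circ> (k \<circ> g) \<in> Aut L M" by (intro Aut_comp Aut_inv assms(1) Aut_over_subset[OF k])
  then have "inv g \<circ> (k \<circ> g) \<in> Aut_over L M C"
    using k bij by (auto simp: Aut_over_def bij_is_inj inv_f_f)
  then have "map (inv g \<circ> (k \<circ> g)) x \<in> X" using assms(2) x(1) by (simp add: invariant_def)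
  moreover have "map k ys = map g (map (inv g \<circ> (k \<circ> g)) x)"
    using bij x(2) by (simp add: bij_is_surj surj_f_inv_f)
  ultimately show "map k ys \<in> map g ` X" by blast
qed

text \<open>(cMS1) only concerns types. An automorphism carries the orbits over \<open>C\<close> in
  \<open>X\<close> to the orbits over the image of \<open>C\<close>, so (cMS2) on both sides extends
  invariance to all definable sets.\<close>

lemma cMS_image:
  assumes h: "dim_meas_fun L M h" "cMS1 L M h" "cMS2 L M h"
    and C: "finite C" and X: "invariant L M C n X" and n: "1 \<le> n" and g: "g \<in> Aut L M"
  shows "h (map g ` X) = h X"
proof -
  have "inj (map g)" using Aut_bij[OF g] by (simp add: bij_is_inj)
  then have inj: "inj_on ((`) (map g)) (orbits C X)"
    using inj_on_subset[OF inj_on_image_Pow[of "map g" UNIV]] by simp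
  have "orbits (g ` C) (map g ` X) = (`) (map g) ` orbits C X"
    unfolding orbits_def image_image tp_image[OF g C] ..
  then have "h (map g ` X) = gsum (h \<circ> (`) (map g)) (orbits C X)"
    using cMS2D[OF h(1,3) finite_imageI[OF C] invariant_image[OF g X] n] gsum.reindex[OF inj, of h] by simp
  also have "\<dots> = gsum h (orbits C X)"
  proof (rule gsum.cong[OF refl])
    fix P assume "P \<in> orbits C X"
    then obtain x where x: "x \<in> X" "P = tp L M x C" by (auto simp: orbits_def)
    then have "x \<noteq> []" using X n by (auto simp: invariant_def tuples_def)
    then have "h (tp L M (map g x) (g ` C)) = h (tp L M x C)"
      using h(2) g C unfolding cMS1_def by blast
    then show "(h \<circ> (`) (map g)) P = h P"
      unfolding tp_image[OF g C] x(2) by simp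
  qed
  also have "\<dots> = h X" using cMS2D[OF h(1,3) C X n] by simp
  finally show ?thesis .
qed

text \<open>By \<open>cMS_image\<close> the parameters giving a fixed value form an invariant set,
  which is (MS3). Distinct attained values have distinct level sets, and there are finitely many
  invariant sets of \<open>m\<close>-tuples over the empty set, which is (MS1).\<close>

lemma cMS_imp_MS1_MS3:
  assumes h: "dim_meas_fun L M h" "cMS1 L M h" "cMS2 L M h"
  shows "MS1_MS3 L M h"
  unfolding MS1_MS3_def
proof (intro allI impI)
  fix n m and \<phi> :: "('f, 'r) fo_formula" assume n: "1 \<le> n" and \<phi>: "formula_in L (n + m) \<phi>"
  let ?h = "\<lambda>as. h (solution_set M n \<phi> as)"
  define D where "D = ?h ` tuples m"
  define lev where "lev v = {as \<in> tuples m. ?h as = v}" for v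
  have inv: "invariant L M {} m (lev v)" for v
  proof -
    have "?h (map g as) = ?h as" if g: "g \<in> Aut L M" and as: "as \<in> tuples m" for g as
    proof -
      have len: "length as = m" using as by (simp add: tuples_def)
      have bij: "bij g" by (rule Aut_bij[OF g])
      have "definable_over L M (set as) n (solution_set M n \<phi> as)"
        using \<phi> len unfolding definable_over_def by blast
      then have "h (map g ` solution_set M n \<phi> as) = ?h as"
        using definable_over_invariant by (intro cMS_image[OF h _ _ n g, of "set as"]) auto
      moreover have "map g ` solution_set M n \<phi> as = solution_set M n \<phi> (map g as)"
      proof (intro set_eqI iffI)
        fix xs assume "xs \<in> map g ` solution_set M n \<phi> as"
        then show "xs \<in> solution_set M n \<phi> (map g as)" using solution_set_Aut[OF g, of n as \<phi>] \<phi> len by auto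
      next
        fix xs assume xs: "xs \<in> solution_set M n \<phi> (map g as)"
        have "map (inv g) xs \<in> solution_set M n \<phi> as"
          using solution_set_Aut[OF g, of n as \<phi> "map (inv g) xs"] \<phi> len xs unfolding map_map_inv[OF bij] by simp
        then have "map g (map (inv g) xs) \<in> map g ` solution_set M n \<phi> as" by (rule imageI)
        then show "xs \<in> map g ` solution_set M n \<phi> as" unfolding map_map_inv[OF bij] .
      qed
      ultimately show ?thesis by simp
    qed
    then have "map g as \<in> lev v" if "g \<in> Aut_over L M {}" "as \<in> lev v" for g as
      using that Aut_over_subset[OF that(1)] by (simp add: lev_def tuples_def)
    then show ?thesis by (auto simp: invariant_def lev_def)
  qed
  have "inj_on lev D"
  proof (rule inj_onI)
    fix v v' assume "v \<in> D" "v' \<in> D" and eq: "lev v = lev v'"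
    then obtain as where "as \<in> lev v" unfolding D_def lev_def by blast
    moreover from this have "as \<in> lev v'" using eq by simp
    ultimately show "v = v'" by (simp add: lev_def)
  qed
  moreover have "lev ` D \<subseteq> {X. invariant L M {} m X}" using inv by blast
  ultimately have "finite D" using finite_invariant[of "{}" m] by (meson finite.emptyI inj_on_finite)
  moreover have "\<forall>as\<in>tuples m. ?h as \<in> D" by (simp add: D_def)
  moreover have "\<forall>(d, \<mu>)\<in>D. defn L M m {as \<in> tuples m. ?h as = (d, \<mu>)}"
    using inv invariant_defn by (auto simp: lev_def)
  ultimately show "\<exists>D. finite D \<and> (\<forall>as\<in>tuples m. ?h as \<in> D) \<and>
      (\<forall>(d, \<mu>)\<in>D. defn L M m {as \<in> tuples m. ?h as = (d, \<mu>)})" by blast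
qed

text \<open>Tuples in a finite \<open>C\<close>-definable set are algebraic over \<open>C\<close>,
  so (cMS3) assigns to each orbit its size, and in dimension zero the sum over orbits is the
  ordinary sum of sizes.\<close>

lemma cMS_imp_MS2:
  assumes h: "dim_meas_fun L M h" "cMS2 L M h" "cMS3 L M h"
  shows "MS2 L M h"
  unfolding MS2_def
proof (intro ballI impI)
  fix X assume "X \<in> Def L M" and fin: "finite X"
  then obtain n where n: "1 \<le> n" "definable_over L M UNIV n X" by (auto simp: Def_def)
  obtain C where C: "finite C" and X: "invariant L M C n X" using definable_invariant[OF n(2)] by blast
  have orb: "h P = (0, real (card P)) \<and> finite P" if "P \<in> orbits C X" for P
  proof -
    obtain as where as: "as \<in> X" "P = tp L M as C" using \<open>P \<in> orbits C X\<close> by (auto simp: orbits_def)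
    have acl: "set as \<subseteq> acl L M C" by (rule finite_invariant_acl[OF C X fin as(1)])
    have "as \<noteq> []" using as(1) X n(1) by (auto simp: invariant_def tuples_def)
    then have "dim h P = 0 \<and> meas h P = real (card {map g as |g. g \<in> Aut_over L M C})"
      using h(3) C acl unfolding as(2) cMS3_def by blast
    then have "h P = (0, real (card P))" unfolding as(2) tp_eq_orbit[OF C] by (simp only: prod_eq_iff fst_conv snd_conv)
    then show ?thesis using finite_tp_acl[OF C acl] as(2) by simp
  qed
  have finR: "finite (orbits C X)" by (rule finite_orbits[OF C X])
  have "h X = gsum h (orbits C X)" by (rule cMS2D[OF h(1,2) C X n(1)])
  also have "\<dots> = gsum (\<lambda>P. (0, real (card P))) (orbits C X)" using orb by (intro gsum.cong) auto
  also have "\<dots> = (0, real (\<Sum>P\<in>orbits C X. card P))" using gsum_dim_zero[OF finR] by simp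
  also have "(\<Sum>P\<in>orbits C X. card P) = card (\<Union>(orbits C X))"
  proof (rule card_Union_disjoint[symmetric])
    show "pairwise disjnt (orbits C X)"
      unfolding pairwise_def disjnt_def using orbits_mem[OF C] by blast
  qed (use orb in blast)
  finally show "h X = (0, real (card X))" unfolding Union_orbits[OF C X] .
qed

end

text \<open>(cMS4) factors the value of each orbit above \<open>tp L M b C\<close> into that of
  \<open>tp L M b C\<close> and that of its trace on the fibre. The first factor is common, and the
  traces are exactly the orbits of the fibre, so they add up to its value.\<close>

lemma (in definable_map) cMS_fibre_sum:
  assumes h: "dim_meas_fun L M h" "cMS1 L M h" "cMS2 L M h" "cMS4 L M h" and n: "1 \<le> n" and m: "1 \<le> m"
    and b: "b \<in> Y"
  shows "gsum h {P \<in> orbits C X. f ` P = tp L M b C} = gmul (h (tp L M b C)) (h (fibre b))"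
proof -
  let ?S = "{P \<in> orbits C X. f ` P = tp L M b C}" and ?Cb = "C \<union> set b"
  have fin: "finite ?Cb" using finite_C by simp
  note bij = orbits_over[OF b]
  have "h P = gmul (h (tp L M b C)) (h (P \<inter> fibre b))" if P: "P \<in> ?S" for P
  proof -
    have "P \<inter> fibre b \<in> orbits ?Cb (fibre b)" using bij P by (auto simp: bij_betw_def)
    then obtain x where x: "x \<in> fibre b" "P \<inter> fibre b = tp L M x ?Cb" by (auto simp: orbits_def)
    have "x \<in> P" using x mem_tp_self[OF fin, of x] by blast
    then have Px: "P = tp L M x C" using orbits_mem[OF finite_C, of P X x] P by simp
    have "x \<noteq> []" using x(1) X_invariant n by (auto simp: invariant_def tuples_def)
    moreover have "b \<noteq> []" using b Y_invariant m by (auto simp: invariant_def tuples_def)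
    moreover have "set b \<subseteq> dcl L M (C \<union> set x)" using dcl_value[of x] x(1) by auto
    ultimately have "h (tp L M x C) = gmul (h (tp L M b C)) (h (tp L M x ?Cb))"
      using h(4)[unfolded cMS4_def, rule_format, of C x b] finite_C by (simp add: gmul_def prod_eq_iff)
    then show ?thesis using Px x(2) by simp
  qed
  then have "gsum h ?S = gsum (\<lambda>P. gmul (h (tp L M b C)) (h (P \<inter> fibre b))) ?S"
    by (rule gsum.cong[OF refl])
  also have "\<dots> = gsum (\<lambda>Q. gmul (h (tp L M b C)) (h Q)) (orbits ?Cb (fibre b))"
    by (rule gsum.reindex_bij_betw[OF bij])
  also have "\<dots> = gmul (h (tp L M b C)) (gsum h (orbits ?Cb (fibre b)))"
  proof (rule gsum_distrib_left)
    show "finite (orbits ?Cb (fibre b))" by (rule finite_orbits[OF fin fibre_invariant])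
    \<comment> \<open>Pulling out the factor requires at least one summand; the fibre is nonempty as
      \<open>b\<close> is a value of \<open>f\<close>.\<close>
    show "orbits ?Cb (fibre b) \<noteq> {}" using b surjective by (auto simp: orbits_def)
  qed
  also have "gsum h (orbits ?Cb (fibre b)) = h (fibre b)"
    by (rule cMS2D[OF h(1,3) fin fibre_invariant n, symmetric])
  finally show ?thesis .
qed

lemma (in definable_map) cMS_imp_MS4_equation:
  assumes h: "dim_meas_fun L M h" "cMS1 L M h" "cMS2 L M h" "cMS4 L M h" and n: "1 \<le> n" and m: "1 \<le> m"
  shows "finite ((\<lambda>b. h (fibre b)) ` Y)"
    and "h X = gsum (\<lambda>v. gmul v (h {b \<in> Y. h (fibre b) = v})) ((\<lambda>b. h (fibre b)) ` Y)"
proof -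
  let ?R = "orbits C Y" and ?D = "(\<lambda>b. h (fibre b)) ` Y"
  \<comment> \<open>Fibres over conjugate points are conjugate, so the value of \<open>h\<close>
    depends only on the orbit in \<open>Y\<close>, and any representative may be used.\<close>
  define w where "w P = h (fibre (SOME b. b \<in> P))" for P
  have const: "h (fibre (map g b)) = h (fibre b)" if "g \<in> Aut_over L M C" for g b
    unfolding fibre_map[OF that] using finite_C
    by (intro cMS_image[OF h(1,2,3) _ fibre_invariant[of b] n Aut_over_subset[OF that]]) simp
  have w: "w (tp L M b C) = h (fibre b)" for b
  proof -
    let ?b = "SOME b'. b' \<in> tp L M b C"
    have "?b \<in> tp L M b C" by (rule someI[of _ b]) (rule mem_tp_self[OF finite_C])
    from this finite_C obtain g where "g \<in> Aut_over L M C" "?b = map g b" by (rule tpE)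
    then show ?thesis using const[of g b] unfolding w_def by simp
  qed
  have finR: "finite ?R" by (rule finite_orbits[OF finite_C Y_invariant])
  have D: "?D = w ` ?R" unfolding orbits_def image_image w ..
  then show "finite ?D" using finR by simp
  have "h X = gsum h (orbits C X)" by (rule cMS2D[OF h(1,3) finite_C X_invariant n])
  \<comment> \<open>\<open>f\<close> maps orbits onto orbits, so the orbits in \<open>X\<close> can
    be collected by their images.\<close>
  also have "\<dots> = gsum (\<lambda>P. gsum h {Q \<in> orbits C X. f ` Q = P}) ?R"
  proof (rule gsum.group[symmetric])
    show "finite (orbits C X)" by (rule finite_orbits[OF finite_C X_invariant])
    show "(`) f ` orbits C X \<subseteq> ?R"
    proof
      fix P assume "P \<in> (`) f ` orbits C X"
      then obtain x where x: "x \<in> X" "P = f ` tp L M x C" by (auto simp: orbits_def)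
      then have "P = tp L M (f x) C" "f x \<in> Y" using image_tp[OF x(1)] surjective by auto
      then show "P \<in> ?R" by (auto simp: orbits_def)
    qed
  qed (rule finR)
  also have "\<dots> = gsum (\<lambda>P. gmul (w P) (h P)) ?R"
  proof (rule gsum.cong[OF refl])
    fix P assume "P \<in> ?R"
    then obtain b where b: "b \<in> Y" "P = tp L M b C" by (auto simp: orbits_def)
    show "gsum h {Q \<in> orbits C X. f ` Q = P} = gmul (w P) (h P)"
      unfolding b(2) w cMS_fibre_sum[OF h n m b(1)] by (rule gmul_commute)
  qed
  \<comment> \<open>Now the orbits in \<open>Y\<close> are collected by their fibre value, as in
    (MS4).\<close>
  also have "\<dots> = gsum (\<lambda>v. gsum (\<lambda>P. gmul (w P) (h P)) {P \<in> ?R. w P = v}) ?D"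
    unfolding D using finR by (intro gsum.group[symmetric]) auto
  also have "\<dots> = gsum (\<lambda>v. gmul v (h {b \<in> Y. h (fibre b) = v})) ?D"
  proof (rule gsum.cong[OF refl])
    fix v assume v: "v \<in> ?D"
    let ?Y = "{b \<in> Y. h (fibre b) = v}" and ?S = "{P \<in> ?R. w P = v}"
    \<comment> \<open>A level set of the fibre value is invariant over the same \<open>C\<close>.
      Its orbits are those with \<open>w P = v\<close>, and (cMS2) identifies the inner sum with its
      value.\<close>
    have Yv: "invariant L M C m ?Y"
      using Y_invariant const invariant_image_mem[OF Y_invariant] by (auto simp: invariant_def)
    have S: "orbits C ?Y = ?S" unfolding orbits_def using w by auto
    have "gsum (\<lambda>P. gmul (w P) (h P)) ?S = gsum (\<lambda>P. gmul v (h P)) ?S" by (rule gsum.cong) auto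
    also have "\<dots> = gmul v (gsum h ?S)" using v finR unfolding D by (intro gsum_distrib_left) auto
    also have "gsum h ?S = h ?Y" using cMS2D[OF h(1,3) finite_C Yv m] S by simp
    finally show "gsum (\<lambda>P. gmul (w P) (h P)) ?S = gmul v (h ?Y)" .
  qed
  finally show "h X = gsum (\<lambda>v. gmul v (h {b \<in> Y. h (fibre b) = v})) ?D" .
qed

lemma (in omega_categorical) cMS_imp_MS4:
  assumes h: "dim_meas_fun L M h" "cMS1 L M h" "cMS2 L M h" "cMS4 L M h"
  shows "MS4 L M h"
  unfolding MS4_def
proof (intro allI impI, elim conjE)
  fix n m :: nat and X Y :: "'a list set" and f
  assume n: "1 \<le> n" and m: "1 \<le> m" and X: "definable_over L M UNIV n X" and Y: "definable_over L M UNIV m Y"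
    and graph: "definable_over L M UNIV (n + m) ((\<lambda>x. x @ f x) ` X)" and f: "f ` X = Y"
  obtain C1 where C1: "finite C1" "invariant L M C1 n X" using definable_invariant[OF X] by blast
  obtain C2 where C2: "finite C2" "invariant L M C2 m Y" using definable_invariant[OF Y] by blast
  obtain C3 where C3: "finite C3" "invariant L M C3 (n + m) ((\<lambda>x. x @ f x) ` X)"
    using definable_invariant[OF graph] by blast
  define C where "C = C1 \<union> C2 \<union> C3"
  interpret definable_map L M C n m X Y f
  proof (rule definable_mapI)
    show "finite C" using C1 C2 C3 by (simp add: C_def)
    show "invariant L M C n X" by (rule invariant_mono[OF C1(2)]) (auto simp: C_def)
    show "invariant L M C m Y" by (rule invariant_mono[OF C2(2)]) (auto simp: C_def)
    show "invariant L M C (n + m) ((\<lambda>x. x @ f x) ` X)" by (rule invariant_mono[OF C3(2)]) (auto simp: C_def)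
  qed (rule f)
  show "let D = (\<lambda>b. h (fibre b)) ` Y; Yv = (\<lambda>d \<mu>. {b \<in> Y. h (fibre b) = (d, \<mu>)})
    in (X \<noteq> {} \<longrightarrow> dim h X = Max {d + dim h (Yv d \<mu>) |d \<mu>. (d, \<mu>) \<in> D}) \<and>
       meas h X = (\<Sum>(d, \<mu>)\<in>{(d, \<mu>) \<in> D. d + dim h (Yv d \<mu>) = dim h X}. \<mu> * meas h (Yv d \<mu>))"
  proof (cases "X = {}")
    \<comment> \<open>For empty \<open>X\<close> only the measure equation is asserted, and both of
      its sides vanish.\<close>
    case True
    then have "h X = (0, 0)" using cMS2D[OF h(1,3) C1 n] by (simp add: orbits_def)
    moreover have "Y = {}" using f True by simp
    ultimately show ?thesis using True by simp
  next
    case False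
    show ?thesis
      using cMS_imp_MS4_equation[OF h n m]
      unfolding MS4_equation[OF cMS_imp_MS4_equation(1)[OF h n m] False] by blast
  qed
qed

theorem theorem4p2p1:
  fixes L :: "('f, 'r) language" and M :: "('f, 'r, 'a) struct"
  assumes "countable (UNIV :: 'a set)" and "infinite (UNIV :: 'a set)"
    and "aleph0_categorical L M"
  shows "MS_measurable L M \<longleftrightarrow>
    (\<exists>h. dim_meas_fun L M h \<and> cMS1 L M h \<and> cMS2 L M h \<and> cMS3 L M h \<and> cMS4 L M h)"
proof -
  interpret omega_categorical L M using assms by unfold_locales
  have "dim_meas_fun L M h \<and> MS1_MS3 L M h \<and> MS2 L M h \<and> MS4 L M h \<longleftrightarrow>
      dim_meas_fun L M h \<and> cMS1 L M h \<and> cMS2 L M h \<and> cMS3 L M h \<and> cMS4 L M h" for h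
    using MS_imp_cMS[of h] cMS_imp_MS1_MS3[of h] cMS_imp_MS2[of h] cMS_imp_MS4[of h] by blast
  then show ?thesis unfolding MS_measurable_def using assms(2) by simp
qed

end
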